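(* For every integer $N>e^{18}$, the quantum channels $\Phi_{N,l},\Phi_{N,r}:\mathcal{T}(\ell^2(\mathbb{F}_\infty))\to\mathcal{T}(\ell^2(\mathbb{F}_\infty))$ given by $$\Phi_{N,l}(\rho)=\frac1N\sum_{i=1}^N U_i\rho U_i^*,\qquad \Phi_{N,r}(\rho)=\frac1N\sum_{j=1}^N V_j\rho V_j^*$$ satisfy $$\overline{H}_{min}(\Phi_{N,l}\circ \Phi_{N,r}) <\overline{H}_{min}(\Phi_{N,l})+\overline{H}_{min}(\Phi_{N,r}).$$ In other words, the regularized MOE is not additive.
   Context: $\mathbb{F}_\infty$ is the free group on countably many free generators $g_1,g_2,\dots$. For $i,j\in\mathbb{N}$, $U_i$ and $V_j$ are the unitary operators on $\ell^2(\mathbb{F}_\infty)$ given by $(U_if)(x)=f(g_i^{-1}x)$ and $(V_jf)(x)=f(xg_j)$ for $f\in\ell^2(\mathbb{F}_\infty)$, $x\in\mathbb{F}_\infty$; one has $U_iV_j=V_jU_i$ for all $i,j$. $\mathcal{T}(H)$ denotes the trace class operators on a Hilbert space $H$. A state on $H$ is a positive element of $\mathcal{T}(H)$ of trace $1$. The von Neumann entropy of a state $\rho$ with eigenvalues $\lambda_1(\rho)\geq\lambda_2(\rho)\geq\cdots$ (counted with multiplicity) is $H(\rho)=-\sum_i\lambda_i(\rho)\log\lambda_i(\rho)$ (natural logarithm, $0\log 0=0$). For a quantum channel $\Phi:\mathcal{T}(H)\to\mathcal{T}(H)$ of the form $\Phi(\rho)=\sum_{i=1}^M A_i\rho A_i^*$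 with $\sum_i A_i^*A_i=\mathrm{Id}_H$, its $k$-fold tensor power is the channel $\Phi^{\otimes k}:\mathcal{T}(H^{\otimes k})\to\mathcal{T}(H^{\otimes k})$, $\Phi^{\otimes k}(\rho)=\sum_{i_1,\dots,i_k=1}^M (A_{i_1}\otimes\cdots\otimes A_{i_k})\rho(A_{i_1}\otimes\cdots\otimes A_{i_k})^*$. The minimum output entropy (MOE) is $H_{min}(\Phi)=\inf_{\xi}H(\Phi(|\xi\rangle\langle\xi|))$, with the infimum over all unit vectors $\xi$ in the input Hilbert space, and the regularized MOE is $\overline{H}_{min}(\Phi)=\lim_{k\to\infty}\frac1k H_{min}(\Phi^{\otimes k})$. *)

theory Defs
  imports "HOL-Analysis.Analysis" "HOL-Algebra.Group" "HOL-Library.Function_Algebras"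
begin

section \<open>The free group on countably many generators\<close>

text \<open>
  The letter \<open>(i, True)\<close> stands for the generator with index \<open>i\<close> and \<open>(i, False)\<close> for its
  inverse. Group elements are reduced words.
\<close>

type_synonym letter = "nat \<times> bool"

definition flip :: "letter \<Rightarrow> letter" where
  "flip a = (fst a, \<not> snd a)"

definition reduced :: "letter list \<Rightarrow> bool" where
  "reduced w \<longleftrightarrow> successively (\<lambda>a b. b \<noteq> flip a) w"

fun push :: "letter \<Rightarrow> letter list \<Rightarrow> letter list" where
  "push a [] = [a]"
| "push a (b # w) = (if b = flip a then w else a # b # w)"

text \<open>For a reduced word \<open>w\<close>, \<open>foldr push v w\<close> is the reduced form of the concatenation
  \<open>v @ w\<close>.\<close>

definition Finf :: "letter list monoid" where
  "Finf = \<lparr>carrier = {w. reduced w}, mult = (\<lambda>v w. foldr push v w), one = []\<rparr>"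

definition gen :: "nat \<Rightarrow> letter list" where
  "gen i = [(i, True)]"

lemma flip_flip [simp]: "flip (flip a) = a"
  by (simp add: flip_def)

lemma flip_neq [simp]: "flip a \<noteq> a" "a \<noteq> flip a"
  by (cases a; simp add: flip_def)+

lemma reduced_Nil [simp]: "reduced []"
  and reduced_Cons: "reduced (a # w) \<longleftrightarrow> reduced w \<and> (w \<noteq> [] \<longrightarrow> hd w \<noteq> flip a)"
  by (cases w; auto simp: reduced_def)+

lemma reduced_push: "reduced w \<Longrightarrow> reduced (push a w)"
  by (cases w) (auto simp: reduced_Cons)

lemma push_flip_push: "reduced w \<Longrightarrow> push (flip a) (push a w) = w"
  by (cases w rule: remdups_adj.cases) (auto simp: reduced_Cons)

lemma push_push_flip: "reduced w \<Longrightarrow> push a (push (flip a) w) = w"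
  using push_flip_push[of w "flip a"] by simp

lemma reduced_foldr_push: "reduced w \<Longrightarrow> reduced (foldr push v w)"
  by (induction v) (auto simp: reduced_push)

lemma foldr_push_Nil: "reduced v \<Longrightarrow> foldr push v [] = v"
proof (induction v)
  case (Cons a v)
  then show ?case by (cases v) (auto simp: reduced_Cons)
qed simp

lemma foldr_push_push:
  assumes "reduced w"
  shows "foldr push (push a v) w = push a (foldr push v w)"
  using assms by (cases v) (auto simp: push_push_flip reduced_foldr_push)

lemma foldr_push_assoc:
  assumes "reduced w"
  shows "foldr push (foldr push u v) w = foldr push u (foldr push v w)"
  by (induction u) (simp_all add: foldr_push_push assms)

lemma foldr_push_inverse:
  assumes "reduced w"
  shows "foldr push (rev (map flip v)) (foldr push v w) = w"
  using assms
proof (induction v arbitrary: w)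
  case (Cons a v)
  then show ?case by (simp add: push_flip_push reduced_foldr_push)
qed simp

lemma group_Finf: "group Finf"
proof (rule groupI)
  fix x assume x: "x \<in> carrier Finf"
  define y where "y = foldr push (rev (map flip x)) []"
  have "foldr push y x = foldr push (rev (map flip x)) (foldr push [] x)"
    unfolding y_def using x by (intro foldr_push_assoc) (simp add: Finf_def)
  also have "\<dots> = foldr push (rev (map flip x)) (foldr push x [])"
    using x by (simp add: Finf_def foldr_push_Nil)
  also have "\<dots> = []" by (rule foldr_push_inverse) simp
  finally show "\<exists>y\<in>carrier Finf. y \<otimes>\<^bsub>Finf\<^esub> x = \<one>\<^bsub>Finf\<^esub>"
    by (intro bexI[of _ y]) (simp_all add: Finf_def y_def reduced_foldr_push)
qed (simp_all add: Finf_def reduced_foldr_push foldr_push_assoc)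

lemma gen_closed [simp]: "gen i \<in> carrier Finf"
  by (simp add: Finf_def gen_def reduced_Cons)


section \<open>Operators on \<open>\<ell>\<^sup>2(S)\<close>\<close>

text \<open>
  Elements of \<open>\<ell>\<^sup>2(S)\<close> are functions on the ambient type that vanish outside \<open>S\<close>. An operator is a
  function on all of \<open>'a \<Rightarrow> complex\<close>; only its values on \<open>ell2 S\<close> are meaningful, and operators
  are compared on \<open>ell2 S\<close> only. Sums of vectors and of operators are pointwise.
\<close>

type_synonym 'a vec = "'a \<Rightarrow> complex"
type_synonym 'a oper = "'a vec \<Rightarrow> 'a vec"

definition ell2 :: "'a set \<Rightarrow> 'a vec set" where
  "ell2 S = {f. (\<forall>x. x \<notin> S \<longrightarrow> f x = 0) \<and> (\<lambda>x. (cmod (f x))\<^sup>2) summable_on S}"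

definition cinner :: "'a set \<Rightarrow> 'a vec \<Rightarrow> 'a vec \<Rightarrow> complex" where
  "cinner S f g = (\<Sum>\<^sub>\<infinity>x\<in>S. cnj (f x) * g x)"

definition ell2_norm :: "'a set \<Rightarrow> 'a vec \<Rightarrow> real" where
  "ell2_norm S f = sqrt (\<Sum>\<^sub>\<infinity>x\<in>S. (cmod (f x))\<^sup>2)"

definition cscale :: "complex \<Rightarrow> 'a vec \<Rightarrow> 'a vec" where
  "cscale c f = (\<lambda>x. c * f x)"

definition op_scale :: "complex \<Rightarrow> 'a oper \<Rightarrow> 'a oper" where
  "op_scale c T = (\<lambda>f. cscale c (T f))"

definition ket :: "'a \<Rightarrow> 'a vec" where
  "ket x = (\<lambda>y. if y = x then 1 else 0)"

interpretation cfun: vector_space "cscale :: complex \<Rightarrow> 'a vec \<Rightarrow> 'a vec"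
  by standard (simp_all add: cscale_def fun_eq_iff algebra_simps)

definition bounded_op :: "'a set \<Rightarrow> 'a oper \<Rightarrow> bool" where
  "bounded_op S T \<longleftrightarrow>
     (\<forall>f\<in>ell2 S. T f \<in> ell2 S) \<and>
     (\<forall>f\<in>ell2 S. \<forall>g\<in>ell2 S. T (f + g) = T f + T g) \<and>
     (\<forall>c. \<forall>f\<in>ell2 S. T (cscale c f) = cscale c (T f)) \<and>
     (\<exists>B. \<forall>f\<in>ell2 S. ell2_norm S (T f) \<le> B * ell2_norm S f)"

definition adj :: "'a set \<Rightarrow> 'a oper \<Rightarrow> 'a oper" where
  "adj S T f = (THE h. h \<in> ell2 S \<and> (\<forall>g\<in>ell2 S. cinner S h g = cinner S f (T g)))"

definition positive_op :: "'a set \<Rightarrow> 'a oper \<Rightarrow> bool" where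
  "positive_op S T \<longleftrightarrow> bounded_op S T \<and> (\<forall>f\<in>ell2 S. cinner S f (T f) \<in> \<real>\<^sub>\<ge>\<^sub>0)"

text \<open>\<open>P\<close> below is \<open>|T| = (T\<^sup>* T)\<^bsup>1/2\<^esup>\<close>, the unique positive square root, and the sum is its trace.\<close>

definition trace_class :: "'a set \<Rightarrow> 'a oper \<Rightarrow> bool" where
  "trace_class S T \<longleftrightarrow> bounded_op S T \<and>
     (\<exists>P. positive_op S P \<and> (\<forall>f\<in>ell2 S. P (P f) = adj S T (T f)) \<and>
          (\<lambda>x. cinner S (ket x) (P (ket x))) summable_on S)"

text \<open>\<open>proj S \<xi>\<close> is \<open>|\<xi>\<rangle>\<langle>\<xi>|\<close>.\<close>

definition proj :: "'a set \<Rightarrow> 'a vec \<Rightarrow> 'a oper" where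
  "proj S \<xi> = (\<lambda>f. cscale (cinner S \<xi> f) \<xi>)"


section \<open>Entropy\<close>

definition eigenspace :: "'a set \<Rightarrow> 'a oper \<Rightarrow> real \<Rightarrow> 'a vec set" where
  "eigenspace S T \<mu> = {f \<in> ell2 S. T f = cscale (complex_of_real \<mu>) f}"

text \<open>
  The decreasing sequence of eigenvalues of a state: every \<open>\<mu> > 0\<close> is listed as often as its
  multiplicity, and the sequence is continued by zeros if there are only finitely many positive
  eigenvalues. (Multiplicities of positive eigenvalues of a state are finite.)
\<close>

definition eigenvalues :: "'a set \<Rightarrow> 'a oper \<Rightarrow> nat \<Rightarrow> real" where
  "eigenvalues S \<rho> = (THE l. decseq l \<and> (\<forall>n. 0 \<le> l n) \<and>
     (\<forall>\<mu>>0. finite {n. l n = \<mu>} \<and> card {n. l n = \<mu>} = cfun.dim (eigenspace S \<rho> \<mu>)))"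

text \<open>The entropy of a state may be \<open>\<infinity>\<close>; all summands are nonnegative for a state, and
  \<open>0 * ln 0 = 0\<close>.\<close>

definition vn_entropy :: "'a set \<Rightarrow> 'a oper \<Rightarrow> ereal" where
  "vn_entropy S \<rho> = (\<Sum>n. ereal (- (eigenvalues S \<rho> n * ln (eigenvalues S \<rho> n))))"


section \<open>Quantum channels and their tensor powers\<close>

text \<open>A channel is a map on operators of which only the values on trace class operators matter.\<close>

definition kraus_rep ::
  "'a set \<Rightarrow> ('a oper \<Rightarrow> 'a oper) \<Rightarrow> nat \<Rightarrow> (nat \<Rightarrow> 'a oper) \<Rightarrow> bool" where
  "kraus_rep S \<Phi> M A \<longleftrightarrow>
     (\<forall>i\<in>{1..M}. bounded_op S (A i)) \<and>
     (\<forall>f\<in>ell2 S. (\<Sum>i=1..M. adj S (A i) (A i f)) = f) \<and>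
     (\<forall>\<rho>. trace_class S \<rho> \<longrightarrow> (\<forall>f\<in>ell2 S. \<Phi> \<rho> f = (\<Sum>i=1..M. A i (\<rho> (adj S (A i) f)))))"

text \<open>\<open>\<ell>\<^sup>2(S)\<^sup>\<otimes>\<^sup>k\<close> is identified with \<open>\<ell>\<^sup>2(S\<^sup>k)\<close>, the elementary tensor of \<open>f\<^sub>1, \<dots>, f\<^sub>k\<close> being the
  product function.\<close>

definition tuples :: "'a set \<Rightarrow> nat \<Rightarrow> (nat \<Rightarrow> 'a) set" where
  "tuples S k = (\<Pi>\<^sub>E j\<in>{1..k}. S)"

definition tensor_vec :: "'a set \<Rightarrow> nat \<Rightarrow> (nat \<Rightarrow> 'a vec) \<Rightarrow> (nat \<Rightarrow> 'a) vec" where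
  "tensor_vec S k f = (\<lambda>x. if x \<in> tuples S k then \<Prod>j=1..k. f j (x j) else 0)"

text \<open>
  \<open>A\<^sub>1 \<otimes> \<dots> \<otimes> A\<^sub>k\<close> through its matrix with respect to the standard basis; lemma
  \<open>tensor_op_tensor_vec\<close> below shows that it acts on elementary tensors as it should.
\<close>

definition tensor_op :: "'a set \<Rightarrow> nat \<Rightarrow> (nat \<Rightarrow> 'a oper) \<Rightarrow> (nat \<Rightarrow> 'a) oper" where
  "tensor_op S k A f = (\<lambda>x. if x \<in> tuples S k
     then \<Sum>\<^sub>\<infinity>y\<in>tuples S k. (\<Prod>j=1..k. A j (ket (y j)) (x j)) * f y else 0)"

text \<open>On trace class operators the result does not depend on the chosen Kraus representation,
  and \<open>\<Phi> \<mapsto> tensor_power S k \<Phi>\<close> is thus a function of the channel itself.\<close>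

definition tensor_power ::
  "'a set \<Rightarrow> nat \<Rightarrow> ('a oper \<Rightarrow> 'a oper) \<Rightarrow> (nat \<Rightarrow> 'a) oper \<Rightarrow> (nat \<Rightarrow> 'a) oper" where
  "tensor_power S k \<Phi> \<rho> =
     (let (M, A) = (SOME (M, A). kraus_rep S \<Phi> M A)
      in \<Sum>i\<in>tuples {1..M} k.
           let T = tensor_op S k (\<lambda>j. A (i j)) in T \<circ> \<rho> \<circ> adj (tuples S k) T)"

definition moe :: "'a set \<Rightarrow> ('a oper \<Rightarrow> 'a oper) \<Rightarrow> ereal" where
  "moe S \<Phi> = (INF \<xi>\<in>{\<xi> \<in> ell2 S. ell2_norm S \<xi> = 1}. vn_entropy S (\<Phi> (proj S \<xi>)))"

definition regularized_moe :: "'a set \<Rightarrow> ('a oper \<Rightarrow> 'a oper) \<Rightarrow> ereal" where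
  "regularized_moe S \<Phi> = lim (\<lambda>k. ereal (1 / real k) * moe (tuples S k) (tensor_power S k \<Phi>))"


section \<open>The two channels\<close>

definition U :: "nat \<Rightarrow> letter list oper" where
  "U i f = (\<lambda>x. if x \<in> carrier Finf then f (inv\<^bsub>Finf\<^esub> gen i \<otimes>\<^bsub>Finf\<^esub> x) else 0)"

definition V :: "nat \<Rightarrow> letter list oper" where
  "V j f = (\<lambda>x. if x \<in> carrier Finf then f (x \<otimes>\<^bsub>Finf\<^esub> gen j) else 0)"

definition Phi_l :: "nat \<Rightarrow> letter list oper \<Rightarrow> letter list oper" where
  "Phi_l N \<rho> = op_scale (1 / of_nat N) (\<Sum>i=1..N. U i \<circ> \<rho> \<circ> adj (carrier Finf) (U i))"

definition Phi_r :: "nat \<Rightarrow> letter list oper \<Rightarrow> letter list oper" where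
  "Phi_r N \<rho> = op_scale (1 / of_nat N) (\<Sum>j=1..N. V j \<circ> \<rho> \<circ> adj (carrier Finf) (V j))"


section \<open>Tensor products of operators on elementary tensors\<close>

lemma ell2I: "(\<And>x. x \<notin> S \<Longrightarrow> f x = 0) \<Longrightarrow> (\<lambda>x. (cmod (f x))\<^sup>2) summable_on S \<Longrightarrow> f \<in> ell2 S"
  by (simp add: ell2_def)

lemma ell2_finite:
  assumes "finite F" "F \<subseteq> S" "\<And>x. x \<notin> F \<Longrightarrow> f x = 0"
  shows "f \<in> ell2 S"
proof (rule ell2I)
  have "(\<lambda>x. (cmod (f x))\<^sup>2) summable_on F" using assms by simp
  then show "(\<lambda>x. (cmod (f x))\<^sup>2) summable_on S"
    using assms by (subst summable_on_cong_neutral[of F S]) auto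
qed (use assms in auto)

lemma ket_ell2: "x \<in> S \<Longrightarrow> ket x \<in> ell2 S"
  by (rule ell2_finite[of "{x}"]) (auto simp: ket_def)

lemma cinner_ket_right: "x \<in> S \<Longrightarrow> cinner S f (ket x) = cnj (f x)"
proof -
  assume x: "x \<in> S"
  have "cinner S f (ket x) = (\<Sum>\<^sub>\<infinity>y\<in>{x}. cnj (f y) * ket x y)"
    unfolding cinner_def by (rule infsum_cong_neutral) (use x in \<open>auto simp: ket_def\<close>)
  then show ?thesis by (simp add: ket_def)
qed

lemma adj_eqI:
  assumes "h \<in> ell2 S" "\<And>g. g \<in> ell2 S \<Longrightarrow> cinner S h g = cinner S f (T g)"
  shows "adj S T f = h"
  unfolding adj_def
proof (rule the_equality)
  fix h' assume h': "h' \<in> ell2 S \<and> (\<forall>g\<in>ell2 S. cinner S h' g = cinner S f (T g))"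
  show "h' = h"
  proof
    fix x show "h' x = h x"
    proof (cases "x \<in> S")
      case True
      then have "cnj (h' x) = cnj (h x)"
        using h' assms(2)[of "ket x"] by (metis cinner_ket_right ket_ell2)
      then show ?thesis by simp
    next
      case False
      then show ?thesis using h' assms(1) by (simp add: ell2_def)
    qed
  qed
qed (use assms in auto)

lemma cmod_le_ell2_norm:
  assumes "f \<in> ell2 S"
  shows "cmod (f x) \<le> ell2_norm S f"
proof (cases "x \<in> S")
  case True
  have "(cmod (f x))\<^sup>2 = (\<Sum>y\<in>{x}. (cmod (f y))\<^sup>2)" by simp
  also have "\<dots> \<le> (\<Sum>\<^sub>\<infinity>y\<in>S. (cmod (f y))\<^sup>2)"
    using assms True by (intro finite_sum_le_infsum) (auto simp: ell2_def)
  finally show ?thesis unfolding ell2_norm_def by (rule real_le_rsqrt)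
next
  case False
  then have "cmod (f x) = 0" using assms by (simp add: ell2_def)
  then show ?thesis unfolding ell2_norm_def by (simp add: infsum_nonneg)
qed

lemma bounded_op_sum:
  assumes T: "bounded_op S T" and F: "finite F" "F \<subseteq> S"
  shows "T (\<lambda>x. \<Sum>y\<in>F. c y * ket y x) = (\<lambda>x. \<Sum>y\<in>F. c y * T (ket y) x)"
  using F
proof (induction F rule: finite_induct)
  case empty
  have "(\<lambda>x. 0) \<in> ell2 S" by (rule ell2_finite[of "{}"]) auto
  then have "T (cscale 0 (\<lambda>x. 0)) = cscale 0 (T (\<lambda>x. 0))"
    using T unfolding bounded_op_def by blast
  then show ?case by (simp add: cscale_def fun_eq_iff)
next
  case (insert a F)
  let ?g = "\<lambda>x. \<Sum>y\<in>F. c y * ket y x"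
  have g: "?g \<in> ell2 S" using insert
    by (intro ell2_finite[of F]) (auto simp: ket_def intro!: sum.neutral)
  have k: "ket a \<in> ell2 S" using insert by (simp add: ket_ell2)
  have k': "cscale (c a) (ket a) \<in> ell2 S"
    using insert by (intro ell2_finite[of "{a}"]) (auto simp: cscale_def ket_def)
  have "(\<lambda>x. \<Sum>y\<in>insert a F. c y * ket y x) = cscale (c a) (ket a) + ?g"
    using insert by (auto simp: cscale_def fun_eq_iff)
  then have "T (\<lambda>x. \<Sum>y\<in>insert a F. c y * ket y x) = T (cscale (c a) (ket a)) + T ?g"
    using T g k' by (simp add: bounded_op_def)
  also have "T (cscale (c a) (ket a)) = cscale (c a) (T (ket a))"
    using T k by (simp add: bounded_op_def)
  finally show ?case using insert by (auto simp: cscale_def fun_eq_iff)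
qed

lemma bounded_op_has_sum:
  assumes T: "bounded_op S T" and f: "f \<in> ell2 S"
  shows "((\<lambda>y. T (ket y) x * f y) has_sum T f x) S"
proof -
  define q where "q y = (cmod (f y))\<^sup>2" for y
  have q: "q summable_on S" using f unfolding q_def by (simp add: ell2_def)
  obtain B where B: "\<And>g. g \<in> ell2 S \<Longrightarrow> ell2_norm S (T g) \<le> B * ell2_norm S g"
    using T unfolding bounded_op_def by blast
  have bound: "cmod (T f x - (\<Sum>y\<in>F. T (ket y) x * f y))
      \<le> B * sqrt (infsum q S - sum q F)" if F: "finite F" "F \<subseteq> S" for F
  proof -
    define g where "g = (\<lambda>x. \<Sum>y\<in>F. f y * ket y x)"
    define h where "h = (\<lambda>x. if x \<in> F then 0 else f x)"
    have g_eq: "g = (\<lambda>x. if x \<in> F then f x else 0)"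
    proof
      fix x show "g x = (if x \<in> F then f x else 0)"
        unfolding g_def ket_def using F(1) by (simp add: if_distrib[of "\<lambda>z. _ * z"] cong: if_cong)
    qed
    have hsum: "((\<lambda>x. (cmod (h x))\<^sup>2) has_sum (infsum q S - sum q F)) S"
    proof -
      have "(q has_sum (infsum q S - sum q F)) (S - F)"
        using q F by (intro has_sum_Diff) (auto simp: has_sum_infsum)
      also have "?this \<longleftrightarrow> ?thesis"
        by (rule has_sum_cong_neutral) (use F in \<open>auto simp: h_def q_def\<close>)
      finally show ?thesis .
    qed
    have h: "h \<in> ell2 S"
      using f hsum by (intro ell2I) (auto simp: ell2_def h_def summable_on_def)
    have nh: "ell2_norm S h = sqrt (infsum q S - sum q F)"
      unfolding ell2_norm_def using hsum by (simp add: infsumI)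
    have g: "g \<in> ell2 S" by (rule ell2_finite[of F]) (use F in \<open>auto simp: g_eq\<close>)
    have "f = g + h" by (auto simp: g_eq h_def)
    then have "T f = T g + T h" using T g h by (simp add: bounded_op_def)
    moreover have "T g = (\<lambda>x. \<Sum>y\<in>F. f y * T (ket y) x)"
      unfolding g_def by (rule bounded_op_sum[OF T F])
    ultimately have "T f x - (\<Sum>y\<in>F. T (ket y) x * f y) = T h x"
      by (simp add: mult.commute)
    also have "cmod (T h x) \<le> ell2_norm S (T h)"
      using T h by (intro cmod_le_ell2_norm) (simp add: bounded_op_def)
    also have "\<dots> \<le> B * ell2_norm S h" by (rule B[OF h])
    finally show ?thesis by (simp add: nh)
  qed
  have "(sum q \<longlongrightarrow> infsum q S) (finite_subsets_at_top S)"
    using q by (simp add: has_sum_infsum flip: has_sum_def)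
  then have "((\<lambda>F. B * sqrt (infsum q S - sum q F)) \<longlongrightarrow> B * sqrt (infsum q S - infsum q S))
      (finite_subsets_at_top S)"
    by (intro tendsto_intros)
  then have lim: "((\<lambda>F. B * sqrt (infsum q S - sum q F)) \<longlongrightarrow> 0) (finite_subsets_at_top S)"
    by simp
  have "((\<lambda>F. (\<Sum>y\<in>F. T (ket y) x * f y) - T f x) \<longlongrightarrow> 0) (finite_subsets_at_top S)"
    by (rule Lim_null_comparison[OF _ lim])
       (auto intro!: eventually_finite_subsets_at_top_weakI bound simp: norm_minus_commute)
  then show ?thesis unfolding has_sum_def by (subst Lim_null)
qed

lemma tensor_op_tensor_vec:
  assumes "\<And>j. j \<in> {1..k} \<Longrightarrow> bounded_op S (A j)" "\<And>j. j \<in> {1..k} \<Longrightarrow> f j \<in> ell2 S"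
  shows "tensor_op S k A (tensor_vec S k f) = tensor_vec S k (\<lambda>j. A j (f j))"
proof
  fix x
  have hs: "((\<lambda>y. A j (ket y) (x j) * f j y) has_sum A j (f j) (x j)) S" if "j \<in> {1..k}" for j
    using that assms by (intro bounded_op_has_sum) auto
  have "(\<Sum>\<^sub>\<infinity>y\<in>tuples S k. (\<Prod>j=1..k. A j (ket (y j)) (x j)) * tensor_vec S k f y)
      = (\<Sum>\<^sub>\<infinity>y\<in>tuples S k. \<Prod>j=1..k. A j (ket (y j)) (x j) * f j (y j))"
    by (intro infsum_cong) (simp add: tensor_vec_def prod.distrib)
  also have "\<dots> = (\<Prod>j=1..k. \<Sum>\<^sub>\<infinity>y\<in>S. A j (ket y) (x j) * f j y)"
    unfolding tuples_def
  proof (rule infsum_prod_PiE_abs)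
    fix j assume "j \<in> {1..k}"
    then have "(\<lambda>y. A j (ket y) (x j) * f j y) summable_on S"
      using hs by (auto simp: summable_on_def)
    then show "(\<lambda>y. norm (A j (ket y) (x j) * f j y)) summable_on S"
      by (simp only: summable_on_iff_abs_summable_on_complex)
  qed simp
  also have "\<dots> = (\<Prod>j=1..k. A j (f j) (x j))"
    using hs by (intro prod.cong) (auto intro: infsumI)
  finally show "tensor_op S k A (tensor_vec S k f) x = tensor_vec S k (\<lambda>j. A j (f j)) x"
    by (simp add: tensor_op_def tensor_vec_def)
qed


section \<open>Kraus representations of the channels of interest\<close>

text \<open>The following shows that the choice in \<open>tensor_power\<close> is not vacuous for \<open>Phi_l N\<close>, \<open>Phi_r N\<close>
  and their composition. All Kraus operators are multiples of operators induced by bijections.\<close>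

lemma sum_apply: "(\<Sum>i\<in>I. F i) x = (\<Sum>i\<in>I. F i x)"
  by (induction I rule: infinite_finite_induct) auto

definition subst_op :: "'a set \<Rightarrow> ('a \<Rightarrow> 'a) \<Rightarrow> 'a oper" where
  "subst_op S \<pi> f = (\<lambda>x. if x \<in> S then f (\<pi> x) else 0)"

lemma subst_op_ell2:
  assumes "bij_betw \<pi> S S" "f \<in> ell2 S"
  shows "subst_op S \<pi> f \<in> ell2 S"
proof (rule ell2I)
  have "(\<lambda>x. (cmod (f (\<pi> x)))\<^sup>2) summable_on S"
    using assms(2) by (subst summable_on_reindex_bij_betw[OF assms(1)]) (simp add: ell2_def)
  then show "(\<lambda>x. (cmod (subst_op S \<pi> f x))\<^sup>2) summable_on S"
    by (rule summable_on_cong[THEN iffD1, rotated]) (simp add: subst_op_def)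
qed (simp add: subst_op_def)

lemma ell2_norm_subst_op:
  assumes "bij_betw \<pi> S S"
  shows "ell2_norm S (subst_op S \<pi> f) = ell2_norm S f"
proof -
  have "(\<Sum>\<^sub>\<infinity>x\<in>S. (cmod (subst_op S \<pi> f x))\<^sup>2) = (\<Sum>\<^sub>\<infinity>x\<in>S. (cmod (f (\<pi> x)))\<^sup>2)"
    by (rule infsum_cong) (simp add: subst_op_def)
  also have "\<dots> = (\<Sum>\<^sub>\<infinity>x\<in>S. (cmod (f x))\<^sup>2)"
    by (rule infsum_reindex_bij_betw[OF assms])
  finally show ?thesis by (simp add: ell2_norm_def)
qed

lemma cscale_ell2: "f \<in> ell2 S \<Longrightarrow> cscale c f \<in> ell2 S"
  unfolding ell2_def cscale_def
  by (auto simp: norm_mult power_mult_distrib intro: summable_on_cmult_right)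

lemma ell2_norm_cscale: "ell2_norm S (cscale c f) = cmod c * ell2_norm S f"
  unfolding ell2_norm_def cscale_def
  by (simp add: norm_mult power_mult_distrib infsum_cmult_right' real_sqrt_mult)

lemma bounded_op_subst_op:
  assumes "bij_betw \<pi> S S"
  shows "bounded_op S (op_scale c (subst_op S \<pi>))"
  unfolding bounded_op_def
proof (intro conjI ballI allI exI)
  fix f assume "f \<in> ell2 S"
  then show "op_scale c (subst_op S \<pi>) f \<in> ell2 S"
    using assms by (simp add: op_scale_def cscale_ell2 subst_op_ell2)
next
  fix f show "ell2_norm S (op_scale c (subst_op S \<pi>) f) \<le> cmod c * ell2_norm S f"
    by (simp add: op_scale_def ell2_norm_cscale ell2_norm_subst_op assms)
qed (auto simp: op_scale_def subst_op_def cscale_def fun_eq_iff algebra_simps)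

lemma adj_subst_op_scale:
  assumes "bij_betw \<pi> S S" "f \<in> ell2 S"
  shows "adj S (op_scale c (subst_op S \<pi>)) f = cscale (cnj c) (subst_op S (inv_into S \<pi>) f)"
proof (rule adj_eqI)
  show "cscale (cnj c) (subst_op S (inv_into S \<pi>) f) \<in> ell2 S"
    using assms by (intro cscale_ell2 subst_op_ell2 bij_betw_inv_into)
next
  fix g
  let ?h = "\<lambda>x. c * cnj (f (inv_into S \<pi> x)) * g x"
  have "cinner S (cscale (cnj c) (subst_op S (inv_into S \<pi>) f)) g = (\<Sum>\<^sub>\<infinity>x\<in>S. ?h x)"
    unfolding cinner_def by (rule infsum_cong) (simp add: cscale_def subst_op_def)
  also have "\<dots> = (\<Sum>\<^sub>\<infinity>x\<in>S. ?h (\<pi> x))"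
    by (rule infsum_reindex_bij_betw[OF assms(1), symmetric])
  also have "\<dots> = cinner S f (op_scale c (subst_op S \<pi>) g)"
    unfolding cinner_def using assms(1)
    by (intro infsum_cong) (simp add: op_scale_def cscale_def subst_op_def bij_betw_inv_into_left)
  finally show "cinner S (cscale (cnj c) (subst_op S (inv_into S \<pi>) f)) g
      = cinner S f (op_scale c (subst_op S \<pi>) g)" .
qed

lemma adj_subst_op:
  assumes "bij_betw \<pi> S S" "f \<in> ell2 S"
  shows "adj S (subst_op S \<pi>) f = subst_op S (inv_into S \<pi>) f"
  using adj_subst_op_scale[OF assms, of 1] by (simp add: op_scale_def cscale_def)

lemma kraus_rep_subst_op:
  assumes M: "M > 0" and bij: "\<And>i. i \<in> {1..M} \<Longrightarrow> bij_betw (\<pi> i) S S"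
    and \<Phi>: "\<And>\<rho> f. bounded_op S \<rho> \<Longrightarrow> f \<in> ell2 S \<Longrightarrow>
      \<Phi> \<rho> f = cscale (1 / of_nat M) (\<Sum>i=1..M. subst_op S (\<pi> i) (\<rho> (adj S (subst_op S (\<pi> i)) f)))"
  shows "kraus_rep S \<Phi> M (\<lambda>i. op_scale (complex_of_real (1 / sqrt (real M))) (subst_op S (\<pi> i)))"
proof -
  define c where "c = complex_of_real (1 / sqrt (real M))"
  have c: "cnj c = c" "c * c = 1 / of_nat M" "c * (c * z) = z / of_nat M" for z
    using M by (simp_all add: c_def flip: of_real_mult)
  show ?thesis
    unfolding kraus_rep_def c_def[symmetric]
  proof (intro conjI ballI allI impI)
    fix f assume f: "f \<in> ell2 S"
    have "adj S (op_scale c (subst_op S (\<pi> i))) (op_scale c (subst_op S (\<pi> i)) f) = cscale (1 / of_nat M) f"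
      if i: "i \<in> {1..M}" for i
    proof -
      have "op_scale c (subst_op S (\<pi> i)) f \<in> ell2 S"
        using bij[OF i] f by (simp add: op_scale_def cscale_ell2 subst_op_ell2)
      moreover have "inv_into S (\<pi> i) x \<in> S" "\<pi> i (inv_into S (\<pi> i) x) = x" if "x \<in> S" for x
        using bij[OF i] that by (metis bij_betw_def inv_into_into, simp add: bij_betw_inv_into_right)
      ultimately show ?thesis
        using f bij[OF i] by (subst adj_subst_op_scale)
          (auto simp: op_scale_def cscale_def subst_op_def fun_eq_iff c ell2_def)
    qed
    then have "(\<Sum>i=1..M. adj S (op_scale c (subst_op S (\<pi> i))) (op_scale c (subst_op S (\<pi> i)) f))
        = (\<Sum>i=1..M. cscale (1 / of_nat M) f)" by simp
    also have "\<dots> = f" using M by (simp add: fun_eq_iff sum_apply cscale_def)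
    finally show "(\<Sum>i=1..M. adj S (op_scale c (subst_op S (\<pi> i))) (op_scale c (subst_op S (\<pi> i)) f)) = f" .
  next
    fix \<rho> f assume \<rho>: "trace_class S \<rho>" and f: "f \<in> ell2 S"
    have b: "bounded_op S \<rho>" using \<rho> by (simp add: trace_class_def)
    have "op_scale c (subst_op S (\<pi> i)) (\<rho> (adj S (op_scale c (subst_op S (\<pi> i))) f))
        = cscale (1 / of_nat M) (subst_op S (\<pi> i) (\<rho> (adj S (subst_op S (\<pi> i)) f)))"
      if i: "i \<in> {1..M}" for i
    proof -
      have "subst_op S (inv_into S (\<pi> i)) f \<in> ell2 S"
        using bij[OF i] f by (intro subst_op_ell2 bij_betw_inv_into)
      then have "\<rho> (cscale c (subst_op S (inv_into S (\<pi> i)) f)) = cscale c (\<rho> (subst_op S (inv_into S (\<pi> i)) f))"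
        using b by (simp add: bounded_op_def)
      then have "\<rho> (adj S (op_scale c (subst_op S (\<pi> i))) f) = cscale c (\<rho> (adj S (subst_op S (\<pi> i)) f))"
        using f bij[OF i] by (simp add: adj_subst_op_scale adj_subst_op c)
      then show ?thesis
        by (simp add: op_scale_def cscale_def subst_op_def fun_eq_iff c)
    qed
    then have "(\<Sum>i=1..M. op_scale c (subst_op S (\<pi> i)) (\<rho> (adj S (op_scale c (subst_op S (\<pi> i))) f)))
        = (\<Sum>i=1..M. cscale (1 / of_nat M) (subst_op S (\<pi> i) (\<rho> (adj S (subst_op S (\<pi> i)) f))))" by simp
    also have "\<dots> = \<Phi> \<rho> f"
      unfolding \<Phi>[OF b f] by (simp add: fun_eq_iff sum_apply cscale_def sum_distrib_left)
    finally show "\<Phi> \<rho> f = (\<Sum>i=1..M. op_scale c (subst_op S (\<pi> i)) (\<rho> (adj S (op_scale c (subst_op S (\<pi> i))) f)))"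
      by simp
  qed (use bij in \<open>simp add: bounded_op_subst_op\<close>)
qed

definition lmove :: "nat \<Rightarrow> letter list \<Rightarrow> letter list" where
  "lmove i x = inv\<^bsub>Finf\<^esub> gen i \<otimes>\<^bsub>Finf\<^esub> x"
definition rmove :: "nat \<Rightarrow> letter list \<Rightarrow> letter list" where
  "rmove j x = x \<otimes>\<^bsub>Finf\<^esub> gen j"

lemma U_eq: "U i = subst_op (carrier Finf) (lmove i)" and V_eq: "V j = subst_op (carrier Finf) (rmove j)"
  by (simp_all add: fun_eq_iff U_def V_def subst_op_def lmove_def rmove_def)

lemma bij_lmove: "bij_betw (lmove i) (carrier Finf) (carrier Finf)"
proof -
  interpret group Finf by (rule group_Finf)
  show ?thesis
    by (rule bij_betw_byWitness[where f' = "\<lambda>x. gen i \<otimes>\<^bsub>Finf\<^esub> x"])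
       (auto simp: lmove_def simp flip: m_assoc)
qed

lemma bij_rmove: "bij_betw (rmove j) (carrier Finf) (carrier Finf)"
proof -
  interpret group Finf by (rule group_Finf)
  show ?thesis
    by (rule bij_betw_byWitness[where f' = "\<lambda>x. x \<otimes>\<^bsub>Finf\<^esub> inv\<^bsub>Finf\<^esub> gen j"])
       (auto simp: rmove_def m_assoc)
qed

lemma kraus_rep_Phi_l:
  assumes "N > 0"
  shows "kraus_rep (carrier Finf) (Phi_l N) N (\<lambda>i. op_scale (complex_of_real (1 / sqrt (real N))) (U i))"
  unfolding U_eq using assms
  by (intro kraus_rep_subst_op)
     (auto simp: bij_lmove Phi_l_def U_eq op_scale_def sum_apply)

lemma kraus_rep_Phi_r:
  assumes "N > 0"
  shows "kraus_rep (carrier Finf) (Phi_r N) N (\<lambda>j. op_scale (complex_of_real (1 / sqrt (real N))) (V j))"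
  unfolding V_eq using assms
  by (intro kraus_rep_subst_op)
     (auto simp: bij_rmove Phi_r_def V_eq op_scale_def sum_apply)

lemma kraus_rep_Phi_l_Phi_r:
  assumes N: "N > 0"
  shows "\<exists>A. kraus_rep (carrier Finf) (Phi_l N \<circ> Phi_r N) (N * N) A"
proof -
  obtain b where b: "bij_betw b {1..N * N} ({1..N} \<times> {1..N})"
    using finite_same_card_bij[of "{1..N * N}" "{1..N} \<times> {1..N}"] by auto
  define \<pi> where "\<pi> p = rmove (snd (b p)) \<circ> lmove (fst (b p))" for p
  have bij: "bij_betw (\<pi> p) (carrier Finf) (carrier Finf)" for p
    unfolding \<pi>_def by (rule bij_betw_trans[OF bij_lmove bij_rmove])
  have comp: "subst_op (carrier Finf) (rmove j \<circ> lmove i) h = U i (V j h)" for i j h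
    using bij_lmove by (auto simp: U_eq V_eq subst_op_def fun_eq_iff bij_betw_def)
  have adj: "adj (carrier Finf) (subst_op (carrier Finf) (rmove j \<circ> lmove i)) f = adj (carrier Finf) (V j) (adj (carrier Finf) (U i) f)"
    if f: "f \<in> ell2 (carrier Finf)" for i j f
  proof -
    have f': "subst_op (carrier Finf) (inv_into (carrier Finf) (lmove i)) f \<in> ell2 (carrier Finf)"
      using f by (intro subst_op_ell2 bij_betw_inv_into bij_lmove)
    have "inv_into (carrier Finf) (rmove j \<circ> lmove i) x = inv_into (carrier Finf) (lmove i) (inv_into (carrier Finf) (rmove j) x)"
      if "x \<in> carrier Finf" for x
      using that bij_lmove[of i] bij_rmove[of j] inv_into_comp[of "rmove j" "lmove i" "carrier Finf" x]
      by (simp add: bij_betw_def)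
    moreover have "inv_into (carrier Finf) (rmove j) x \<in> carrier Finf" if "x \<in> carrier Finf" for x
      using that bij_rmove[of j] by (metis bij_betw_def inv_into_into)
    ultimately show ?thesis
      using f f' by (auto simp: U_eq V_eq adj_subst_op bij_lmove bij_rmove
          bij_betw_trans[OF bij_lmove bij_rmove] subst_op_def fun_eq_iff)
  qed
  have "kraus_rep (carrier Finf) (Phi_l N \<circ> Phi_r N) (N * N)
      (\<lambda>p. op_scale (complex_of_real (1 / sqrt (real (N * N)))) (subst_op (carrier Finf) (\<pi> p)))"
  proof (rule kraus_rep_subst_op)
    fix \<rho> f assume "bounded_op (carrier Finf) \<rho>" and f: "f \<in> ell2 (carrier Finf)"
    let ?t = "\<lambda>(i, j). U i (V j (\<rho> (adj (carrier Finf) (V j) (adj (carrier Finf) (U i) f))))"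
    have "(\<Sum>p=1..N * N. subst_op (carrier Finf) (\<pi> p) (\<rho> (adj (carrier Finf) (subst_op (carrier Finf) (\<pi> p)) f))) = (\<Sum>p=1..N * N. ?t (b p))"
      by (simp add: \<pi>_def comp adj[OF f] case_prod_beta)
    also have "\<dots> = (\<Sum>q\<in>{1..N} \<times> {1..N}. ?t q)"
      by (rule sum.reindex_bij_betw[OF b])
    finally have *: "(\<Sum>p=1..N * N. subst_op (carrier Finf) (\<pi> p) (\<rho> (adj (carrier Finf) (subst_op (carrier Finf) (\<pi> p)) f)))
        = (\<Sum>i=1..N. \<Sum>j=1..N. U i (V j (\<rho> (adj (carrier Finf) (V j) (adj (carrier Finf) (U i) f)))))"
      by (simp add: sum.cartesian_product)
    show "(Phi_l N \<circ> Phi_r N) \<rho> f = cscale (1 / of_nat (N * N))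
        (\<Sum>p=1..N * N. subst_op (carrier Finf) (\<pi> p) (\<rho> (adj (carrier Finf) (subst_op (carrier Finf) (\<pi> p)) f)))"
      unfolding *
      by (auto simp: Phi_l_def Phi_r_def op_scale_def cscale_def sum_apply fun_eq_iff U_def
          sum_distrib_left sum_divide_distrib intro!: sum.cong)
  qed (use N bij in auto)
  then show ?thesis by blast
qed

end

theory Submission
  imports Defs "HOL-Computational_Algebra.Fundamental_Theorem_Algebra"
begin

text \<open>
  On a pure state \<open>\<xi>\<close> the channel \<open>\<Phi>\<^sub>l\<^sup>\<otimes>\<^sup>k\<close> outputs the equal mixture of the \<open>N\<^sup>k\<close> vectors \<open>U\<^sub>i \<xi>\<close>, where
  \<open>i\<close> runs through the \<open>k\<close>-tuples of indices. Its purity is \<open>N\<^sup>-\<^sup>2\<^sup>k\<close> times the sum of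
  \<open>|\<langle>U\<^sub>j \<xi>, U\<^sub>i \<xi>\<rangle>|\<^sup>2\<close> over \<open>i\<close> and \<open>j\<close>. For \<open>k = 1\<close> the diagonal contributes \<open>N\<close>, while Haagerup's inequality
  for the free words \<open>g\<^sub>j\<^sup>-\<^sup>1 g\<^sub>i\<close> of length two bounds the rest by \<open>3\<^sup>2 = 9\<close>, whatever the size of \<open>N\<close>
  (\<open>collision_bound_lmove\<close>). This bound is multiplicative in \<open>k\<close> (\<open>collision_bound_tuples\<close>). As the von Neumann
  entropy is at least minus the logarithm of the purity (\<open>vn_entropy_mixture_ge\<close>), the regularized
  minimum output entropy of \<open>\<Phi>\<^sub>l\<close> is at least \<open>2 ln N - ln (N + 9) \<ge> ln N - 9 / N\<close>. Inversion in the group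
  turns \<open>\<Phi>\<^sub>r\<close> into \<open>\<Phi>\<^sub>l\<close>, so the same holds for \<open>\<Phi>\<^sub>r\<close>.

  The composition maps the basis vector at the neutral element to the equal mixture of the \<open>N\<^sup>2\<close>
  basis vectors at \<open>g\<^sub>i g\<^sub>j\<^sup>-\<^sup>1\<close>. The \<open>N\<close> pairs with \<open>i = j\<close> all give the neutral element. This
  coincidence lowers the entropy from \<open>2 ln N\<close> to at most \<open>2 ln N - ln N / N\<close>
  (\<open>regularized_moe_le_fixed_point\<close>). The gain \<open>ln N / N\<close> beats the loss \<open>18 / N\<close> in the two lower bounds as soon
  as \<open>ln N > 18\<close>.

  The regularization is a limit, whose existence has to be shown. It follows from Fekete's lemma and
  subadditivity, that is, from additivity of the entropy on product states
  (\<open>vn_entropy_tens\<close>, \<open>regularized_moe_limit\<close>). Two further points concern the definitions. Eigenvalues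
  are accessible because a mixture of finitely many pure states is also a mixture of orthogonal vectors
  (\<open>orthogonal_decomposition\<close>), and the entropy is then computed from their norms
  (\<open>vn_entropy_orthogonal\<close>). The tensor power is defined through an arbitrary Kraus representation;
  \<open>tensor_power_output\<close> shows that on pure states any other representation may be used instead.
\<close>

section \<open>The inner product of \<open>\<ell>\<^sup>2(S)\<close>\<close>

lemma ell2_outside: "f \<in> ell2 S \<Longrightarrow> x \<notin> S \<Longrightarrow> f x = 0"
  by (simp add: ell2_def)

lemma ell2_summable: "f \<in> ell2 S \<Longrightarrow> (\<lambda>x. (cmod (f x))\<^sup>2) summable_on S"
  by (simp add: ell2_def)

lemma ell2_0: "0 \<in> ell2 S"
  by (rule ell2_finite[of "{}"]) auto

lemma ell2_add:
  assumes "f \<in> ell2 S" "g \<in> ell2 S"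
  shows "f + g \<in> ell2 S"
proof (rule ell2I)
  have s: "(\<lambda>x. 2 * (cmod (f x))\<^sup>2 + 2 * (cmod (g x))\<^sup>2) summable_on S"
    using assms by (intro summable_on_add summable_on_cmult_right ell2_summable)
  have b: "(cmod ((f + g) x))\<^sup>2 \<le> 2 * (cmod (f x))\<^sup>2 + 2 * (cmod (g x))\<^sup>2" for x
  proof -
    have "(cmod ((f + g) x))\<^sup>2 \<le> (cmod (f x) + cmod (g x))\<^sup>2"
      by (simp add: norm_triangle_ineq power_mono)
    also have "\<dots> \<le> 2 * (cmod (f x))\<^sup>2 + 2 * (cmod (g x))\<^sup>2"
      using sum_squares_bound[of "cmod (f x)" "cmod (g x)"] by (simp add: power2_sum)
    finally show ?thesis .
  qed
  show "(\<lambda>x. (cmod ((f + g) x))\<^sup>2) summable_on S"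
    by (rule summable_on_comparison_test[OF s]) (use b in auto)
qed (use assms in \<open>simp add: ell2_outside\<close>)

lemma ell2_sum: "(\<And>i. i \<in> I \<Longrightarrow> f i \<in> ell2 S) \<Longrightarrow> (\<Sum>i\<in>I. f i) \<in> ell2 S"
  by (induction I rule: infinite_finite_induct) (auto intro: ell2_0 ell2_add)

lemma cfun_diff: "(f :: 'a vec) - g = f + cscale (-1) g"
  by (auto simp: cscale_def)

lemma ell2_diff: "f \<in> ell2 S \<Longrightarrow> g \<in> ell2 S \<Longrightarrow> f - g \<in> ell2 S"
  by (simp only: cfun_diff ell2_add cscale_ell2)

lemma cinner_summable:
  assumes "f \<in> ell2 S" "g \<in> ell2 S"
  shows "(\<lambda>x. cnj (f x) * g x) summable_on S"
proof -
  have "(\<lambda>x. (cmod (f x))\<^sup>2 + (cmod (g x))\<^sup>2) summable_on S"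
    using assms by (intro summable_on_add ell2_summable)
  moreover have "norm (cnj (f x) * g x) \<le> (cmod (f x))\<^sup>2 + (cmod (g x))\<^sup>2" for x
    using sum_squares_bound[of "cmod (f x)" "cmod (g x)"]
      mult_nonneg_nonneg[of "cmod (f x)" "cmod (g x)", OF norm_ge_zero norm_ge_zero]
    unfolding norm_mult complex_mod_cnj by linarith
  ultimately show ?thesis
    by (rule abs_summable_summable[OF Infinite_Sum.abs_summable_on_comparison_test'])
qed

lemma cinner_add_right:
  "f \<in> ell2 S \<Longrightarrow> g \<in> ell2 S \<Longrightarrow> h \<in> ell2 S \<Longrightarrow> cinner S f (g + h) = cinner S f g + cinner S f h"
  unfolding cinner_def by (subst infsum_add[symmetric]) (auto simp: cinner_summable distrib_left)

lemma cinner_scale_right: "cinner S f (cscale c g) = c * cinner S f g"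
  unfolding cinner_def cscale_def by (subst infsum_cmult_right'[symmetric]) (simp add: algebra_simps)

lemma cinner_commute: "cinner S g f = cnj (cinner S f g)"
  unfolding cinner_def by (subst infsum_cnj[symmetric]) (simp add: mult.commute)

lemma cinner_scale_left: "cinner S (cscale c g) f = cnj c * cinner S g f"
  unfolding cinner_commute[of S "cscale c g" f] cinner_commute[of S g f]
  by (simp add: cinner_scale_right)

lemma cinner_diff_right:
  "f \<in> ell2 S \<Longrightarrow> g \<in> ell2 S \<Longrightarrow> h \<in> ell2 S \<Longrightarrow> cinner S f (g - h) = cinner S f g - cinner S f h"
  unfolding cfun_diff by (simp only: cinner_add_right cscale_ell2 cinner_scale_right) simp

lemma cinner_zero [simp]: "cinner S f 0 = 0" "cinner S 0 f = 0"
  by (simp_all add: cinner_def)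

lemma cinner_sum_right:
  assumes "f \<in> ell2 S" "\<And>i. i \<in> I \<Longrightarrow> g i \<in> ell2 S"
  shows "cinner S f (\<Sum>i\<in>I. g i) = (\<Sum>i\<in>I. cinner S f (g i))"
  using assms
  by (induction I rule: infinite_finite_induct) (simp_all add: cinner_add_right ell2_sum)

lemma ell2_norm_nonneg: "0 \<le> ell2_norm S f"
  by (simp add: ell2_norm_def infsum_nonneg)

lemma ell2_norm_square: "(ell2_norm S f)\<^sup>2 = (\<Sum>\<^sub>\<infinity>x\<in>S. (cmod (f x))\<^sup>2)"
  by (simp add: ell2_norm_def infsum_nonneg)

lemma cinner_self:
  assumes "f \<in> ell2 S"
  shows "cinner S f f = of_real ((ell2_norm S f)\<^sup>2)"
proof -
  have "cinner S f f = (\<Sum>\<^sub>\<infinity>x\<in>S. of_real ((cmod (f x))\<^sup>2))"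
    unfolding cinner_def by (rule infsum_cong) (simp only: complex_norm_square mult.commute)
  also have "\<dots> = of_real ((ell2_norm S f)\<^sup>2)"
    unfolding ell2_norm_square
    using assms by (intro infsumI has_sum_of_real has_sum_infsum ell2_summable)
  finally show ?thesis .
qed

lemma ell2_norm_eq_0:
  assumes "f \<in> ell2 S" "ell2_norm S f = 0"
  shows "f = 0"
  using cmod_le_ell2_norm[OF assms(1)] assms(2) by (simp add: fun_eq_iff)

lemma cinner_self_eq_0: "f \<in> ell2 S \<Longrightarrow> cinner S f f = 0 \<Longrightarrow> f = 0"
  by (rule ell2_norm_eq_0) (auto simp: cinner_self)

lemma L2_set_le_ell2_norm:
  assumes "f \<in> ell2 S" "finite F" "F \<subseteq> S"
  shows "L2_set (\<lambda>x. cmod (f x)) F \<le> ell2_norm S f"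
  unfolding L2_set_def ell2_norm_def
  using assms by (intro real_sqrt_le_mono finite_sum_le_infsum) (auto intro: ell2_summable)

lemma ell2_Cauchy_Schwarz:
  assumes f: "f \<in> ell2 S" and g: "g \<in> ell2 S"
  shows "cmod (cinner S f g) \<le> ell2_norm S f * ell2_norm S g"
proof -
  have abs: "(\<lambda>x. norm (cnj (f x) * g x)) summable_on S"
    using cinner_summable[OF f g] by (simp only: summable_on_iff_abs_summable_on_complex)
  have "cmod (cinner S f g) \<le> (\<Sum>\<^sub>\<infinity>x\<in>S. norm (cnj (f x) * g x))"
    unfolding cinner_def by (rule norm_infsum_bound[OF abs])
  also have "\<dots> \<le> ell2_norm S f * ell2_norm S g"
  proof (rule infsum_le_finite_sums[OF abs])
    fix F assume F: "finite F" "F \<subseteq> S"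
    have "(\<Sum>x\<in>F. norm (cnj (f x) * g x)) \<le> L2_set (\<lambda>x. cmod (f x)) F * L2_set (\<lambda>x. cmod (g x)) F"
      using L2_set_mult_ineq[of "\<lambda>x. cmod (f x)" "\<lambda>x. cmod (g x)" F] by (simp add: norm_mult)
    also have "\<dots> \<le> ell2_norm S f * ell2_norm S g"
      using f g F by (intro mult_mono L2_set_le_ell2_norm) (auto simp: ell2_norm_nonneg L2_set_nonneg)
    finally show "(\<Sum>x\<in>F. norm (cnj (f x) * g x)) \<le> ell2_norm S f * ell2_norm S g" .
  qed
  finally show ?thesis .
qed

lemma bounded_opD:
  assumes "bounded_op S T" "f \<in> ell2 S"
  shows "T f \<in> ell2 S" "g \<in> ell2 S \<Longrightarrow> T (f + g) = T f + T g" "T (cscale c f) = cscale c (T f)"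
  using assms by (auto simp: bounded_op_def)

lemma bounded_op_bound:
  assumes "bounded_op S T"
  obtains B where "B \<ge> 0" "\<And>f. f \<in> ell2 S \<Longrightarrow> ell2_norm S (T f) \<le> B * ell2_norm S f"
proof -
  obtain B where B: "\<And>f. f \<in> ell2 S \<Longrightarrow> ell2_norm S (T f) \<le> B * ell2_norm S f"
    using assms unfolding bounded_op_def by blast
  have "ell2_norm S (T f) \<le> max B 0 * ell2_norm S f" if "f \<in> ell2 S" for f
    using B[OF that] mult_right_mono[of B "max B 0" "ell2_norm S f"] ell2_norm_nonneg[of S f] by simp
  then show thesis by (intro that[of "max B 0"]) auto
qed

text \<open>The adjoint is defined by a description. Its values are square summable because for a finite
  set \<open>F\<close> the sum of \<open>|h x|\<^sup>2\<close> over \<open>F\<close> equals \<open>\<langle>f, T h\<^sub>F\<rangle>\<close>, with \<open>h\<^sub>F\<close> the truncation of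
  \<open>h x = \<langle>T e\<^sub>x, f\<rangle>\<close> to \<open>F\<close>.\<close>

lemma adj_exists:
  assumes T: "bounded_op S T" and f: "f \<in> ell2 S"
  shows "adj S T f \<in> ell2 S" "g \<in> ell2 S \<Longrightarrow> cinner S (adj S T f) g = cinner S f (T g)"
proof -
  obtain B where B0: "B \<ge> 0" and B: "\<And>f. f \<in> ell2 S \<Longrightarrow> ell2_norm S (T f) \<le> B * ell2_norm S f"
    using bounded_op_bound[OF T] by blast
  define h where "h x = (if x \<in> S then cinner S (T (ket x)) f else 0)" for x
  define C where "C = ell2_norm S f * B"
  have C0: "C \<ge> 0" using B0 by (simp add: C_def ell2_norm_nonneg)
  have bd: "(\<Sum>x\<in>F. (cmod (h x))\<^sup>2) \<le> C\<^sup>2" if F: "finite F" "F \<subseteq> S" for F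
  proof -
    define g where "g = (\<lambda>x. \<Sum>y\<in>F. h y * ket y x)"
    have g_eq: "g = (\<lambda>x. if x \<in> F then h x else 0)"
    proof
      fix x show "g x = (if x \<in> F then h x else 0)"
        unfolding g_def ket_def using F(1) by (simp add: if_distrib[of "\<lambda>z. _ * z"] cong: if_cong)
    qed
    have g: "g \<in> ell2 S" by (rule ell2_finite[of F]) (use F in \<open>auto simp: g_eq\<close>)
    have ng: "(ell2_norm S g)\<^sup>2 = (\<Sum>x\<in>F. (cmod (h x))\<^sup>2)"
    proof -
      have "(ell2_norm S g)\<^sup>2 = (\<Sum>\<^sub>\<infinity>x\<in>F. (cmod (h x))\<^sup>2)"
        unfolding ell2_norm_square by (rule infsum_cong_neutral) (use F in \<open>auto simp: g_eq\<close>)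
      then show ?thesis using F by simp
    qed
    have Tg: "T g = (\<Sum>y\<in>F. cscale (h y) (T (ket y)))"
      using bounded_op_sum[OF T F, of h] by (simp add: g_def fun_eq_iff sum_apply cscale_def)
    have "cinner S f (T g) = (\<Sum>y\<in>F. h y * cinner S f (T (ket y)))"
      unfolding Tg using F f T
      by (subst cinner_sum_right) (auto intro!: cscale_ell2 bounded_opD(1)[OF T] ket_ell2 simp: cinner_scale_right)
    also have "\<dots> = (\<Sum>y\<in>F. of_real ((cmod (h y))\<^sup>2))"
      using F by (intro sum.cong refl, subst cinner_commute)
        (auto simp: h_def complex_norm_square simp del: of_real_power)
    finally have "cinner S f (T g) = of_real ((ell2_norm S g)\<^sup>2)" by (simp add: ng)
    then have "(ell2_norm S g)\<^sup>2 = cmod (cinner S f (T g))"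
      by (simp only: norm_of_real) simp
    also have "\<dots> \<le> ell2_norm S f * ell2_norm S (T g)"
      by (rule ell2_Cauchy_Schwarz[OF f bounded_opD(1)[OF T g]])
    also have "\<dots> \<le> ell2_norm S f * (B * ell2_norm S g)"
      by (rule mult_left_mono[OF B[OF g] ell2_norm_nonneg])
    finally have "ell2_norm S g * ell2_norm S g \<le> C * ell2_norm S g"
      by (simp add: C_def power2_eq_square mult.assoc)
    then have "ell2_norm S g \<le> C"
      using C0 ell2_norm_nonneg[of S g] by (cases "ell2_norm S g = 0") (auto simp: mult_le_cancel_right)
    then show ?thesis unfolding ng[symmetric] by (intro power_mono ell2_norm_nonneg)
  qed
  have h: "h \<in> ell2 S"
  proof (rule ell2I)
    show "(\<lambda>x. (cmod (h x))\<^sup>2) summable_on S"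
      by (rule nonneg_bdd_above_summable_on) (auto intro!: bdd_aboveI[of _ "C\<^sup>2"] bd)
  qed (simp add: h_def)
  have hg: "cinner S h g = cinner S f (T g)" if g: "g \<in> ell2 S" for g
  proof -
    \<comment> \<open>The rank one operator \<open>g \<mapsto> \<langle>f, T g\<rangle> e\<^sub>z\<close> is bounded, hence given by its matrix.\<close>
    show ?thesis
    proof (cases "S = {}")
      case True
      then show ?thesis by (simp add: cinner_def)
    next
      case False
      then obtain z where z: "z \<in> S" by blast
      define R where "R g = cscale (cinner S f (T g)) (ket z)" for g
      have nk: "ell2_norm S (ket z) = 1"
      proof -
        have "(\<Sum>\<^sub>\<infinity>x\<in>S. (cmod (ket z x))\<^sup>2) = (\<Sum>\<^sub>\<infinity>x\<in>{z}. (cmod (ket z x))\<^sup>2)"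
          by (rule infsum_cong_neutral) (use z in \<open>auto simp: ket_def\<close>)
        then show ?thesis by (simp add: ell2_norm_def ket_def)
      qed
      have "bounded_op S R"
        unfolding bounded_op_def
      proof (intro conjI ballI allI exI)
        fix g assume g: "g \<in> ell2 S"
        show "R g \<in> ell2 S" using z by (simp add: R_def cscale_ell2 ket_ell2)
        have "cmod (cinner S f (T g)) \<le> ell2_norm S f * (B * ell2_norm S g)"
          using ell2_Cauchy_Schwarz[OF f bounded_opD(1)[OF T g]] B[OF g]
            mult_left_mono[OF B[OF g] ell2_norm_nonneg[of S f]] by linarith
        then show "ell2_norm S (R g) \<le> (ell2_norm S f * B) * ell2_norm S g"
          by (simp add: R_def ell2_norm_cscale nk mult.assoc)
        fix c show "R (cscale c g) = cscale c (R g)"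
          using g by (simp add: R_def bounded_opD[OF T] cinner_scale_right)
      next
        fix g h assume "g \<in> ell2 S" "h \<in> ell2 S"
        then show "R (g + h) = R g + R h"
          using f by (simp add: R_def bounded_opD[OF T] cinner_add_right cfun.scale_left_distrib)
      qed
      from bounded_op_has_sum[OF this g, of z]
      have "((\<lambda>y. cinner S f (T (ket y)) * g y) has_sum cinner S f (T g)) S"
        by (simp add: R_def cscale_def ket_def)
      moreover have "cinner S f (T (ket y)) * g y = cnj (h y) * g y" if "y \<in> S" for y
        using that by (simp add: h_def) (subst cinner_commute, simp)
      ultimately show ?thesis
        unfolding cinner_def[of S h] by (intro infsumI) (simp cong: has_sum_cong)
    qed
  qed
  have "adj S T f = h" by (rule adj_eqI[OF h hg])
  then show "adj S T f \<in> ell2 S" "g \<in> ell2 S \<Longrightarrow> cinner S (adj S T f) g = cinner S f (T g)"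
    using h hg by auto
qed

section \<open>Mixtures of rank one operators\<close>

text \<open>This is the matrix of the operator \<open>\<Sum>\<^sub>i |v\<^sub>i\<rangle>\<langle>v\<^sub>i|\<close>. Different families can have the same
  matrix; all invariants of the operator are transferred between families along this equality.\<close>

definition gram_kernel :: "'i set \<Rightarrow> ('i \<Rightarrow> 'a vec) \<Rightarrow> 'a \<Rightarrow> 'a \<Rightarrow> complex" where
  "gram_kernel I v x y = (\<Sum>i\<in>I. v i x * cnj (v i y))"

definition mixture :: "'a set \<Rightarrow> 'i set \<Rightarrow> ('i \<Rightarrow> 'a vec) \<Rightarrow> 'a oper" where
  "mixture S I v f = (\<Sum>i\<in>I. cscale (cinner S (v i) f) (v i))"

definition orthogonal_on :: "'a set \<Rightarrow> 'i set \<Rightarrow> ('i \<Rightarrow> 'a vec) \<Rightarrow> bool" where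
  "orthogonal_on S I v \<longleftrightarrow> (\<forall>i\<in>I. \<forall>j\<in>I. i \<noteq> j \<longrightarrow> cinner S (v i) (v j) = 0)"

lemma has_sum_sum:
  assumes "\<And>i. i \<in> I \<Longrightarrow> (f i has_sum a i) S"
  shows "((\<lambda>x. \<Sum>i\<in>I. f i x) has_sum (\<Sum>i\<in>I. a i :: complex)) S"
  using assms by (induction I rule: infinite_finite_induct) (auto intro!: has_sum_add)

lemma mixture_apply:
  assumes "\<And>i. i \<in> I \<Longrightarrow> v i \<in> ell2 S" "f \<in> ell2 S"
  shows "mixture S I v f x = (\<Sum>\<^sub>\<infinity>y\<in>S. gram_kernel I v x y * f y)"
proof -
  have "((\<lambda>y. \<Sum>i\<in>I. v i x * (cnj (v i y) * f y)) has_sum (\<Sum>i\<in>I. v i x * cinner S (v i) f)) S"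
    unfolding cinner_def using assms
    by (intro has_sum_sum has_sum_cmult_right has_sum_infsum cinner_summable)
  then have "((\<lambda>y. gram_kernel I v x y * f y) has_sum mixture S I v f x) S"
    by (simp add: mixture_def sum_apply cscale_def gram_kernel_def sum_distrib_right mult.assoc mult.commute[of "v _ x" "cinner _ _ _"])
  then show ?thesis by (simp add: infsumI)
qed

lemma mixture_cong:
  assumes "\<And>i. i \<in> I \<Longrightarrow> v i \<in> ell2 S" "\<And>j. j \<in> J \<Longrightarrow> w j \<in> ell2 S"
    and "gram_kernel I v = gram_kernel J w" "f \<in> ell2 S"
  shows "mixture S I v f = mixture S J w f"
  using assms by (auto simp: fun_eq_iff mixture_apply)

lemma mixture_ell2: "(\<And>i. i \<in> I \<Longrightarrow> v i \<in> ell2 S) \<Longrightarrow> mixture S I v f \<in> ell2 S"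
  unfolding mixture_def by (intro ell2_sum cscale_ell2)

lemma mixture_scale: "mixture S I v (cscale c f) = cscale c (mixture S I v f)"
  by (simp add: mixture_def cinner_scale_right cfun.scale_sum_right)

lemma mixture_sum:
  assumes "\<And>i. i \<in> I \<Longrightarrow> v i \<in> ell2 S" "\<And>k. k \<in> K \<Longrightarrow> f k \<in> ell2 S"
  shows "mixture S I v (\<Sum>k\<in>K. f k) = (\<Sum>k\<in>K. mixture S I v (f k))"
  unfolding mixture_def using assms
  by (subst sum.swap) (simp add: cinner_sum_right cfun.scale_sum_left cong: sum.cong)

lemma cinner_mixture:
  assumes "\<And>i. i \<in> I \<Longrightarrow> v i \<in> ell2 S" "f \<in> ell2 S"
  shows "cinner S f (mixture S I v f) = of_real (\<Sum>i\<in>I. (cmod (cinner S (v i) f))\<^sup>2)"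
proof -
  have "cinner S f (mixture S I v f) = (\<Sum>i\<in>I. cinner S (v i) f * cinner S f (v i))"
    unfolding mixture_def using assms by (simp add: cinner_sum_right cscale_ell2 cinner_scale_right)
  also have "\<dots> = (\<Sum>i\<in>I. of_real ((cmod (cinner S (v i) f))\<^sup>2))"
    by (intro sum.cong refl, subst (2) cinner_commute) (simp only: complex_norm_square)
  finally show ?thesis by simp
qed

text \<open>The nonzero vector \<open>w = v i\<^sub>0\<close> is annihilated by some nonzero polynomial in the mixture \<open>T\<close>, as
  the vectors \<open>T\<^sup>n w\<close> lie in a space of finite dimension. Dividing such a polynomial of least degree
  by one of its linear factors \<open>X - z\<close> gives an eigenvector for \<open>z\<close>. An eigenvector
  with eigenvalue \<open>0\<close> would be orthogonal to all \<open>v i\<close> and thus to itself.\<close>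

lemma mixture_eigenvector:
  assumes I: "finite I" and v: "\<And>i. i \<in> I \<Longrightarrow> v i \<in> ell2 S"
    and B: "finite B" "v ` I \<subseteq> cfun.span B"
    and i0: "i0 \<in> I" "v i0 \<noteq> 0"
  obtains e \<mu> where "\<mu> > 0" "e \<in> ell2 S" "cinner S e e = 1"
    "mixture S I v e = cscale (complex_of_real \<mu>) e"
proof -
  define T where "T = mixture S I v"
  define s where "s n = (T ^^ n) (v i0)" for n
  have s_Suc: "s (Suc n) = T (s n)" for n by (simp add: s_def)
  have T_span: "T f \<in> cfun.span (v ` I)" for f
    unfolding T_def mixture_def by (intro cfun.span_sum cfun.span_scale cfun.span_base) auto
  have s_ell2: "s n \<in> ell2 S" for n
    by (cases n) (use i0 v in \<open>auto simp: s_Suc T_def mixture_ell2 s_def\<close>)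
  have s_span: "s n \<in> cfun.span (v ` I)" for n
    by (cases n) (use i0 in \<open>auto simp: s_Suc T_span s_def cfun.span_base\<close>)
  have span_B: "cfun.span (v ` I) \<subseteq> cfun.span B"
    using B by (simp add: cfun.span_minimal)
  define ev where "ev p = (\<Sum>i\<le>degree p. cscale (coeff p i) (s i))" for p :: "complex poly"
  have ev_eq: "ev p = (\<Sum>i\<le>n. cscale (coeff p i) (s i))" if "degree p \<le> n" for p n
    unfolding ev_def by (rule sum.mono_neutral_left) (use that in \<open>auto simp: coeff_eq_0\<close>)
  have "\<exists>p. p \<noteq> 0 \<and> ev p = 0"
  proof (rule ccontr)
    assume *: "\<not> ?thesis"
    have inj: "inj_on s {..card B}"
    proof
      fix a b assume ab: "a \<in> {..card B}" "b \<in> {..card B}" "s a = s b"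
      define p where "p = monom (1::complex) a - monom 1 b"
      have "ev p = (\<Sum>i\<le>max a b. cscale (coeff p i) (s i))"
        by (rule ev_eq) (auto simp: p_def intro!: degree_diff_le degree_monom_le[THEN order_trans])
      also have "\<dots> = (\<Sum>i\<le>max a b. if i = a then s i else 0) - (\<Sum>i\<le>max a b. if i = b then s i else 0)"
        unfolding sum_subtractf[symmetric]
        by (intro sum.cong) (auto simp: p_def cscale_def fun_eq_iff)
      also have "\<dots> = 0" using ab by simp
      finally have "p = 0" using * by blast
      then have "coeff p a = 0" by simp
      then show "a = b" by (auto simp: p_def split: if_splits)
    qed
    have "cfun.independent (s ` {..card B})"
    proof (rule cfun.independent_if_scalars_zero)
      fix f x assume sm: "(\<Sum>x\<in>s ` {..card B}. cscale (f x) x) = 0" and x: "x \<in> s ` {..card B}"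
      define p where "p = (\<Sum>i\<le>card B. monom (f (s i)) i)"
      have c: "coeff p i = f (s i)" if "i \<le> card B" for i
        using that by (simp add: p_def coeff_sum)
      have "degree p \<le> card B"
        unfolding p_def by (intro degree_sum_le) (auto intro: order_trans[OF degree_monom_le])
      then have "ev p = (\<Sum>i\<le>card B. cscale (f (s i)) (s i))"
        by (simp add: ev_eq c)
      also have "\<dots> = 0" using sm by (simp add: sum.reindex[OF inj])
      finally have "p = 0" using * by blast
      then show "f x = 0" using x c by fastforce
    qed simp
    then have "card (s ` {..card B}) \<le> card B"
      using cfun.independent_span_bound[OF B(1), of "s ` {..card B}"] s_span span_B by blast
    then show False by (simp add: card_image inj)
  qed
  then obtain p where p: "p \<noteq> 0" "ev p = 0" and least: "\<And>q. q \<noteq> 0 \<Longrightarrow> ev q = 0 \<Longrightarrow> degree p \<le> degree q"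
    using ex_has_least_nat[of "\<lambda>p. p \<noteq> 0 \<and> ev p = 0" _ degree] by blast
  have "degree p \<noteq> 0"
  proof
    assume d: "degree p = 0"
    then have "cscale (coeff p 0) (v i0) = 0" using p by (simp add: ev_def s_def)
    then have "coeff p 0 = 0" using i0 by simp
    then show False using d p by (metis leading_coeff_0_iff)
  qed
  then obtain z where "poly p z = 0"
    using fundamental_theorem_of_algebra[of p] by (auto simp: constant_degree)
  then obtain q where q: "p = [:- z, 1:] * q" by (auto simp: poly_eq_0_iff_dvd dvd_def)
  then have q0: "q \<noteq> 0" using p by auto
  have dp: "degree p = Suc (degree q)"
    unfolding q using q0 by (subst degree_mult_eq) auto
  define u where "u = ev q"
  have u0: "u \<noteq> 0" using least[OF q0] dp by (auto simp: u_def)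
  have u: "u \<in> ell2 S" unfolding u_def ev_def by (intro ell2_sum cscale_ell2 s_ell2)
  have u_span: "u \<in> cfun.span (v ` I)"
    unfolding u_def ev_def by (intro cfun.span_sum cfun.span_scale s_span)
  have Tu: "T u = cscale z u"
  proof -
    have "0 = (\<Sum>i\<le>Suc (degree q). cscale (coeff (pCons 0 q) i) (s i)) - (\<Sum>i\<le>Suc (degree q). cscale z (cscale (coeff q i) (s i)))"
      unfolding p(2)[symmetric] ev_eq[of p "Suc (degree q)", OF eq_refl[OF dp]] sum_subtractf[symmetric]
      by (intro sum.cong refl) (simp add: q cscale_def fun_eq_iff algebra_simps)
    also have "(\<Sum>i\<le>Suc (degree q). cscale (coeff (pCons 0 q) i) (s i)) = (\<Sum>i\<le>degree q. cscale (coeff q i) (T (s i)))"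
      by (subst sum.atMost_Suc_shift) (simp add: s_Suc)
    also have "\<dots> = T u"
      unfolding u_def ev_def T_def using v s_ell2 by (subst mixture_sum) (auto simp: mixture_scale cscale_ell2)
    also have "(\<Sum>i\<le>Suc (degree q). cscale z (cscale (coeff q i) (s i))) = cscale z u"
      using ev_eq[of q "Suc (degree q)"] by (simp only: cfun.scale_sum_right[symmetric] u_def)
    finally show ?thesis unfolding eq_commute[of 0] right_minus_eq .
  qed
  have nu: "ell2_norm S u \<noteq> 0" using ell2_norm_eq_0[OF u] u0 by blast
  define r where "r = (\<Sum>i\<in>I. (cmod (cinner S (v i) u))\<^sup>2)"
  have zr: "z * of_real ((ell2_norm S u)\<^sup>2) = of_real r"
    using cinner_mixture[of I v S u] v u Tu by (simp add: T_def cinner_scale_right cinner_self r_def)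
  have "r \<noteq> 0"
  proof
    assume "r = 0"
    then have "\<forall>i\<in>I. cinner S (v i) u = 0" using I by (simp add: r_def sum_nonneg_eq_0_iff)
    then have "\<forall>i\<in>I. cinner S u (v i) = 0" by (metis cinner_commute complex_cnj_zero)
    moreover have "cfun.subspace {f \<in> ell2 S. cinner S u f = 0}"
      using u by (auto simp: cfun.subspace_def ell2_0 ell2_add cscale_ell2 cinner_add_right cinner_scale_right)
    ultimately have "cfun.span (v ` I) \<subseteq> {f \<in> ell2 S. cinner S u f = 0}"
      using v by (intro cfun.span_minimal) auto
    then show False using u_span u0 cinner_self_eq_0[OF u] by blast
  qed
  then have r: "r > 0" by (simp add: r_def less_le sum_nonneg)
  define \<mu> where "\<mu> = r / (ell2_norm S u)\<^sup>2"
  define e where "e = cscale (of_real (1 / ell2_norm S u)) u"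
  show thesis
  proof
    show "\<mu> > 0" using r nu by (simp add: \<mu>_def)
    show e: "e \<in> ell2 S" using u by (simp add: e_def cscale_ell2)
    show "cinner S e e = 1"
      using e nu ell2_norm_nonneg[of S u] by (simp add: cinner_self e_def ell2_norm_cscale norm_divide)
    have "z = of_real \<mu>" using zr nu by (simp add: \<mu>_def field_simps)
    then show "mixture S I v e = cscale (complex_of_real \<mu>) e"
      using Tu by (simp add: e_def mixture_scale T_def mult.commute)
  qed
qed

text \<open>Spectral theorem: every mixture is a mixture of orthogonal vectors, the \<open>\<mu>\<close>-eigenvectors
  among them being scaled to norm \<open>\<surd>\<mu>\<close>. Projecting all \<open>v i\<close> to the complement of an eigenvector removes
  the corresponding term from the kernel and lowers the dimension of the space that
  they span. The last clause keeps the vectors found later orthogonal to those found before.\<close>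

lemma orthogonal_decomposition_aux:
  assumes I: "finite I" and "\<And>i. i \<in> I \<Longrightarrow> v i \<in> ell2 S"
    and "finite B" "card B \<le> m" "v ` I \<subseteq> cfun.span B"
  shows "\<exists>(n::nat) w. (\<forall>j<n. w j \<in> ell2 S) \<and> orthogonal_on S {..<n} w \<and> gram_kernel I v = gram_kernel {..<n} w
    \<and> (\<forall>g\<in>ell2 S. (\<forall>i\<in>I. cinner S g (v i) = 0) \<longrightarrow> (\<forall>j<n. cinner S g (w j) = 0))"
  using assms(2-)
proof (induction m arbitrary: v B rule: less_induct)
  case (less m)
  note v = less.prems(1)
  show ?case
  proof (cases "\<forall>i\<in>I. v i = 0")
    case True
    then have "gram_kernel I v = gram_kernel {..<0::nat} w" for w
      by (auto simp: gram_kernel_def fun_eq_iff)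
    then show ?thesis by - (rule exI[of _ 0], rule exI[of _ "\<lambda>_. 0"], auto simp: orthogonal_on_def)
  next
    case False
    then obtain i0 where "i0 \<in> I" "v i0 \<noteq> 0" by blast
    then obtain e \<mu> where l0: "\<mu> > 0" and e: "e \<in> ell2 S" and ee: "cinner S e e = 1"
      and Te: "mixture S I v e = cscale (complex_of_real \<mu>) e"
      using mixture_eigenvector[OF I v less.prems(2) less.prems(4)] by metis
    define v' where "v' i = v i - cscale (cinner S e (v i)) e" for i
    have v': "v' i \<in> ell2 S" if "i \<in> I" for i
      using that v e by (simp add: v'_def ell2_diff cscale_ell2)
    have ev': "cinner S e (v' i) = 0" if "i \<in> I" for i
      using that v e ee by (simp add: v'_def cinner_diff_right cscale_ell2 cinner_scale_right)
    have e_eq: "e = cscale (of_real (1 / \<mu>)) (mixture S I v e)"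
      using l0 by (simp add: Te flip: of_real_mult)
    have e_span: "e \<in> cfun.span (v ` I)"
      by (subst e_eq, unfold mixture_def) (intro cfun.span_scale cfun.span_sum cfun.span_base, auto)
    have span_B: "cfun.span (v ` I) \<subseteq> cfun.span B"
      using less.prems by (simp add: cfun.span_minimal)
    obtain B' where B': "B' \<subseteq> v' ` I" "cfun.independent B'" "v' ` I \<subseteq> cfun.span B'"
      using cfun.maximal_independent_subset[of "v' ` I"] by blast
    have "cfun.subspace {f \<in> ell2 S. cinner S e f = 0}"
      using e by (auto simp: cfun.subspace_def ell2_0 ell2_add cscale_ell2 cinner_add_right cinner_scale_right)
    then have "cfun.span B' \<subseteq> {f \<in> ell2 S. cinner S e f = 0}"
      using B'(1) v' ev' by (intro cfun.span_minimal) auto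
    then have e_notin: "e \<notin> cfun.span B'" using ee by auto
    have finB': "finite B'" using B'(1) I by (metis finite_imageI finite_subset)
    have "cfun.independent (insert e B')"
      using e_notin B'(2) by (rule cfun.independent_insertI)
    moreover have "insert e B' \<subseteq> cfun.span B"
      using B'(1) e_span span_B less.prems(4)
      by (auto simp: v'_def intro!: cfun.span_diff cfun.span_scale)
    ultimately have "card (insert e B') \<le> card B"
      using cfun.independent_span_bound[OF less.prems(2)] by blast
    moreover have "e \<notin> B'" using e_notin cfun.span_base by blast
    ultimately have lt: "card B' < m" using finB' less.prems(3) by simp
    obtain n :: nat and w where w: "\<forall>j<n. w j \<in> ell2 S" "orthogonal_on S {..<n} w"
      "gram_kernel I v' = gram_kernel {..<n} w"
      and orth: "\<forall>g\<in>ell2 S. (\<forall>i\<in>I. cinner S g (v' i) = 0) \<longrightarrow> (\<forall>j<n. cinner S g (w j) = 0)"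
      using less.IH[OF lt v' finB' order_refl B'(3)] by auto
    define w' where "w' = w(n := cscale (of_real (sqrt \<mu>)) e)"
    have ew: "cinner S e (w j) = 0" if "j < n" for j
      using that orth e ev' by blast
    then have we: "cinner S (w j) e = 0" if "j < n" for j
      using that by (subst cinner_commute) simp
    have ker: "gram_kernel I v x y = gram_kernel I v' x y + of_real \<mu> * (e x * cnj (e y))" for x y
    proof -
      let ?c = "\<lambda>i. cinner S e (v i)"
      have 1: "(\<Sum>i\<in>I. cnj (?c i) * v i x) = of_real \<mu> * e x" for x
      proof -
        have "(\<Sum>i\<in>I. cnj (?c i) * v i x) = mixture S I v e x"
          by (simp add: mixture_def sum_apply cscale_def flip: cinner_commute)
        then show ?thesis by (simp add: Te cscale_def)
      qed
      have 2: "(\<Sum>i\<in>I. ?c i * cnj (v i y)) = of_real \<mu> * cnj (e y)"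
        using arg_cong[OF 1[of y], of cnj] by simp
      have 3: "(\<Sum>i\<in>I. ?c i * cnj (?c i)) = of_real \<mu>"
      proof -
        have "cinner S e (mixture S I v e) = (\<Sum>i\<in>I. cnj (?c i) * ?c i)"
          unfolding mixture_def using e v
          by (simp add: cinner_sum_right cscale_ell2 cinner_scale_right flip: cinner_commute)
        then show ?thesis using ee by (simp add: Te cinner_scale_right mult.commute)
      qed
      have "gram_kernel I v' x y = (\<Sum>i\<in>I. v i x * cnj (v i y)) - e x * (\<Sum>i\<in>I. ?c i * cnj (v i y))
          - (\<Sum>i\<in>I. cnj (?c i) * v i x) * cnj (e y) + e x * cnj (e y) * (\<Sum>i\<in>I. ?c i * cnj (?c i))"
        unfolding gram_kernel_def v'_def sum_distrib_left sum_distrib_right sum_subtractf[symmetric] sum.distrib[symmetric]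
        by (intro sum.cong refl) (simp add: cscale_def algebra_simps)
      then show ?thesis unfolding 1 2 3 by (simp add: gram_kernel_def algebra_simps)
    qed
    show ?thesis
    proof (intro exI conjI ballI impI)
      show "\<forall>j<Suc n. w' j \<in> ell2 S"
        using w(1) e by (auto simp: w'_def cscale_ell2 less_Suc_eq)
      show "orthogonal_on S {..<Suc n} w'"
        using w(2) ew we by (auto simp: orthogonal_on_def w'_def less_Suc_eq cinner_scale_left cinner_scale_right)
      show "gram_kernel I v = gram_kernel {..<Suc n} w'"
      proof (intro ext)
        fix x y
        have "w' n x * cnj (w' n y) = of_real (sqrt \<mu> * sqrt \<mu>) * (e x * cnj (e y))"
          by (simp only: w'_def cscale_def fun_upd_same complex_cnj_mult complex_cnj_complex_of_real of_real_mult mult_ac)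
        also have "\<dots> = of_real \<mu> * (e x * cnj (e y))" using l0 by simp
        finally show "gram_kernel I v x y = gram_kernel {..<Suc n} w' x y"
          unfolding ker w(3) by (simp add: gram_kernel_def) (simp add: w'_def)
      qed
      fix g assume g: "g \<in> ell2 S" "\<forall>i\<in>I. cinner S g (v i) = 0"
      have "cinner S g e = 0"
        by (subst e_eq, unfold mixture_def)
          (use g v in \<open>simp add: cinner_scale_right cinner_sum_right cscale_ell2\<close>)
      moreover have "\<forall>i\<in>I. cinner S g (v' i) = 0"
        using g v e \<open>cinner S g e = 0\<close> by (simp add: v'_def cinner_diff_right cscale_ell2 cinner_scale_right)
      ultimately show "\<forall>j<Suc n. cinner S g (w' j) = 0"
        using orth g(1) by (auto simp: w'_def cinner_scale_right less_Suc_eq)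
    qed
  qed
qed

lemma orthogonal_decomposition:
  assumes "finite I" "\<And>i. i \<in> I \<Longrightarrow> v i \<in> ell2 S"
  obtains n :: nat and w where "\<And>j. j < n \<Longrightarrow> w j \<in> ell2 S" "orthogonal_on S {..<n} w"
    "gram_kernel I v = gram_kernel {..<n} w"
  using orthogonal_decomposition_aux[of I v S "v ` I" "card (v ` I)"] assms cfun.span_superset by blast

section \<open>Entropy of mixtures\<close>

text \<open>Both sequences take the same finitely many positive values. The multiplicities determine the number of terms
  that are at least \<open>\<mu>\<close>, and as the sequences decrease these terms form an initial segment of that length.\<close>

lemma decreasing_level_sets_unique:
  fixes l l' :: "nat \<Rightarrow> real"
  assumes dec: "decseq l" "decseq l'" and nn: "\<And>n. 0 \<le> l n" "\<And>n. 0 \<le> l' n"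
    and mult: "\<And>\<mu>. \<mu> > 0 \<Longrightarrow> finite {n. l' n = \<mu>} \<and> card {n. l' n = \<mu>} = card {n. l n = \<mu>}"
    and fin: "finite {n. 0 < l n}"
  shows "l' = l"
proof -
  define R where "R = l ` {n. 0 < l n}"
  have R: "finite R" using fin by (simp add: R_def)
  have fin_l: "finite {n. l n = \<mu>}" if "\<mu> > 0" for \<mu>
    by (rule finite_subset[OF _ fin]) (use that in auto)
  have R': "l' n \<in> R" if "0 < l' n" for n
  proof -
    have "{m. l' m = l' n} \<noteq> {}" by blast
    then have "{m. l m = l' n} \<noteq> {}" using mult[OF that] by (metis card_0_eq card.empty)
    then obtain m where "l m = l' n" by blast
    then show ?thesis unfolding R_def using that by (intro image_eqI[of _ _ m]) auto
  qed
  have level: "{n. \<mu> \<le> k n} = {..<(\<Sum>\<nu>\<in>{\<nu>\<in>R. \<mu> \<le> \<nu>}. card {n. l n = \<nu>})}"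
    if \<mu>: "\<mu> > 0" and k: "decseq k" "\<And>n. 0 < k n \<Longrightarrow> k n \<in> R"
      and card_k: "\<And>\<nu>. \<nu> > 0 \<Longrightarrow> finite {n. k n = \<nu>} \<and> card {n. k n = \<nu>} = card {n. l n = \<nu>}"
    for \<mu> and k :: "nat \<Rightarrow> real"
  proof -
    have eq: "{n. \<mu> \<le> k n} = (\<Union>\<nu>\<in>{\<nu>\<in>R. \<mu> \<le> \<nu>}. {n. k n = \<nu>})"
      using \<mu> k(2) by force
    have fink: "finite {n. \<mu> \<le> k n}"
      unfolding eq using R card_k \<mu> by auto
    have card: "card {n. \<mu> \<le> k n} = (\<Sum>\<nu>\<in>{\<nu>\<in>R. \<mu> \<le> \<nu>}. card {n. l n = \<nu>})"
      unfolding eq using R card_k \<mu> by (subst card_UN_disjoint) auto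
    have down: "m \<in> {n. \<mu> \<le> k n}" if "n \<in> {n. \<mu> \<le> k n}" "m \<le> n" for m n
      using that k(1) by (auto simp: decseq_def intro: order_trans)
    have "{n. \<mu> \<le> k n} = {..<card {n. \<mu> \<le> k n}}"
    proof (rule card_subset_eq[symmetric, OF fink])
      show "{..<card {n. \<mu> \<le> k n}} \<subseteq> {n. \<mu> \<le> k n}"
      proof (rule ccontr)
        assume "\<not> ?thesis"
        then obtain m where m: "m < card {n. \<mu> \<le> k n}" "m \<notin> {n. \<mu> \<le> k n}" by blast
        have "{n. \<mu> \<le> k n} \<subseteq> {..<m}"
          using down[of _ m] m(2) by (metis lessThan_iff linorder_not_less subsetI)
        then have "card {n. \<mu> \<le> k n} \<le> card {..<m}" by (intro card_mono) auto
        then show False using m(1) by simp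
      qed
    qed simp
    then show ?thesis unfolding card .
  qed
  have iff: "\<mu> \<le> l' n \<longleftrightarrow> \<mu> \<le> l n" if "\<mu> > 0" for \<mu> n
  proof -
    have "{n. \<mu> \<le> l' n} = {n. \<mu> \<le> l n}"
      using level[OF that dec(1)] level[OF that dec(2)] R' mult fin_l by (auto simp: R_def)
    then show ?thesis by blast
  qed
  show ?thesis
  proof
    fix n show "l' n = l n"
      using iff[of "l n" n] iff[of "l' n" n] nn[of n] by (cases "l n = 0"; cases "l' n = 0") force+
  qed
qed

lemma eigenvalues_eqI:
  assumes "decseq l" "\<And>n. 0 \<le> l n" "finite {n. 0 < l n}"
    and "\<And>\<mu>. \<mu> > 0 \<Longrightarrow> card {n. l n = \<mu>} = cfun.dim (eigenspace S \<rho> \<mu>)"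
  shows "eigenvalues S \<rho> = l"
  unfolding eigenvalues_def
proof (rule the_equality)
  have "finite {n. l n = \<mu>}" if "\<mu> > 0" for \<mu>
    by (rule finite_subset[OF _ assms(3)]) (use that in auto)
  then show "decseq l \<and> (\<forall>n. 0 \<le> l n) \<and>
     (\<forall>\<mu>>0. finite {n. l n = \<mu>} \<and> card {n. l n = \<mu>} = cfun.dim (eigenspace S \<rho> \<mu>))"
    using assms by blast
next
  fix l' assume l': "decseq l' \<and> (\<forall>n. 0 \<le> l' n) \<and>
     (\<forall>\<mu>>0. finite {n. l' n = \<mu>} \<and> card {n. l' n = \<mu>} = cfun.dim (eigenspace S \<rho> \<mu>))"
  show "l' = l"
    by (rule decreasing_level_sets_unique) (use assms l' in auto)
qed

text \<open>Taking the inner product of \<open>\<rho> f = \<mu> f\<close> with \<open>w j\<close> shows that a \<open>\<mu>\<close>-eigenvector is orthogonal to every \<open>w j\<close>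
  whose squared norm is not \<open>\<mu>\<close>. The \<open>w j\<close> with squared norm \<open>\<mu>\<close> thus span the eigenspace.\<close>

lemma dim_eigenspace_mixture:
  assumes J: "finite J" and w: "\<And>j. j \<in> J \<Longrightarrow> w j \<in> ell2 S" and orth: "orthogonal_on S J w"
    and \<rho>: "\<And>f. f \<in> ell2 S \<Longrightarrow> \<rho> f = mixture S J w f" and \<mu>: "\<mu> > 0"
  shows "cfun.dim (eigenspace S \<rho> \<mu>) = card {j\<in>J. (ell2_norm S (w j))\<^sup>2 = \<mu>}"
proof -
  define K where "K = {j\<in>J. (ell2_norm S (w j))\<^sup>2 = \<mu>}"
  have K: "finite K" "K \<subseteq> J" using J by (auto simp: K_def)
  have KJ: "j \<in> J" if "j \<in> K" for j using that K by auto
  have ww: "cinner S (w i) (w j) = (if i = j then of_real ((ell2_norm S (w j))\<^sup>2) else 0)"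
    if "i \<in> J" "j \<in> J" for i j
    using that orth w by (auto simp: orthogonal_on_def cinner_self)
  have inj: "inj_on w K"
  proof
    fix i j assume ij: "i \<in> K" "j \<in> K" "w i = w j"
    then have "cinner S (w i) (w j) \<noteq> 0"
      using \<mu> w by (simp add: K_def cinner_self)
    moreover have "i \<in> J" "j \<in> J" using ij K by auto
    ultimately show "i = j" using ww[of i j] by (cases "i = j") simp_all
  qed
  have indep: "cfun.independent (w ` K)"
  proof (rule cfun.independent_if_scalars_zero)
    fix f x assume sm: "(\<Sum>x\<in>w ` K. cscale (f x) x) = 0" and x: "x \<in> w ` K"
    obtain j where j: "j \<in> K" "x = w j" using x by blast
    have "0 = cinner S (w j) (\<Sum>i\<in>K. cscale (f (w i)) (w i))"
      using sm by (simp add: sum.reindex[OF inj])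
    also have "\<dots> = (\<Sum>i\<in>K. if j = i then f (w i) * of_real ((ell2_norm S (w i))\<^sup>2) else 0)"
      using w j by (subst cinner_sum_right) (auto simp: cscale_ell2 cinner_scale_right ww KJ intro!: sum.cong)
    also have "\<dots> = f x * of_real \<mu>" using K j by (simp add: K_def)
    finally show "f x = 0" using \<mu> by simp
  qed (use K in simp)
  have "eigenspace S \<rho> \<mu> = cfun.span (w ` K)"
  proof
    show "eigenspace S \<rho> \<mu> \<subseteq> cfun.span (w ` K)"
    proof
      fix f assume "f \<in> eigenspace S \<rho> \<mu>"
      then have f: "f \<in> ell2 S" and mf: "mixture S J w f = cscale (of_real \<mu>) f"
        by (auto simp: eigenspace_def \<rho>)
      have zero: "cinner S (w j) f = 0" if j: "j \<in> J - K" for j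
      proof -
        have "of_real \<mu> * cinner S (w j) f = cinner S (w j) (mixture S J w f)"
          by (simp add: mf cinner_scale_right)
        also have "\<dots> = (\<Sum>i\<in>J. if j = i then cinner S (w i) f * of_real ((ell2_norm S (w i))\<^sup>2) else 0)"
          unfolding mixture_def using w j
          by (subst cinner_sum_right) (auto simp: cscale_ell2 cinner_scale_right ww intro!: sum.cong)
        also have "\<dots> = cinner S (w j) f * of_real ((ell2_norm S (w j))\<^sup>2)" using j J by simp
        finally have "(of_real \<mu> - of_real ((ell2_norm S (w j))\<^sup>2)) * cinner S (w j) f = 0"
          by (simp add: algebra_simps)
        moreover have "\<mu> \<noteq> (ell2_norm S (w j))\<^sup>2" using j by (auto simp: K_def)
        ultimately show ?thesis
          by (metis mult_eq_0_iff of_real_eq_iff right_minus_eq)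
      qed
      have "f = cscale (of_real (1 / \<mu>)) (mixture S J w f)"
        using \<mu> by (simp add: mf flip: of_real_mult)
      also have "mixture S J w f = (\<Sum>j\<in>K. cscale (cinner S (w j) f) (w j))"
        unfolding mixture_def using J K zero by (intro sum.mono_neutral_right) auto
      finally have "f = cscale (of_real (1 / \<mu>)) (\<Sum>j\<in>K. cscale (cinner S (w j) f) (w j))" .
      moreover have "\<dots> \<in> cfun.span (w ` K)"
        by (intro cfun.span_scale cfun.span_sum cfun.span_base) auto
      ultimately show "f \<in> cfun.span (w ` K)" by metis
    qed
    have "cfun.subspace (eigenspace S \<rho> \<mu>)"
    proof (rule cfun.subspaceI)
      fix f g assume "f \<in> eigenspace S \<rho> \<mu>" "g \<in> eigenspace S \<rho> \<mu>"
      then have fg: "f \<in> ell2 S" "g \<in> ell2 S"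
        and "mixture S J w f = cscale (of_real \<mu>) f" "mixture S J w g = cscale (of_real \<mu>) g"
        by (auto simp: eigenspace_def \<rho>)
      moreover have "mixture S J w (f + g) = mixture S J w f + mixture S J w g"
        unfolding mixture_def sum.distrib[symmetric] using w fg
        by (intro sum.cong refl) (simp add: cinner_add_right cfun.scale_left_distrib)
      ultimately show "f + g \<in> eigenspace S \<rho> \<mu>"
        using fg by (simp add: eigenspace_def \<rho> ell2_add cfun.scale_right_distrib)
    qed (auto simp: eigenspace_def \<rho> ell2_0 cscale_ell2 mixture_scale mult.commute, simp add: mixture_def)
    moreover have "w j \<in> eigenspace S \<rho> \<mu>" if j: "j \<in> K" for j
    proof -
      have "mixture S J w (w j) = (\<Sum>i\<in>J. if i = j then cscale (of_real \<mu>) (w j) else 0)"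
        unfolding mixture_def using j K by (intro sum.cong refl) (auto simp: ww K_def)
      then show ?thesis using j J K w by (auto simp: eigenspace_def \<rho>)
    qed
    ultimately show "cfun.span (w ` K) \<subseteq> eigenspace S \<rho> \<mu>"
      by (intro cfun.span_minimal) auto
  qed
  then show ?thesis
    using cfun.dim_span_eq_card_independent[OF indep] card_image[OF inj] by (simp add: K_def)
qed

text \<open>For an orthogonal family the eigenvalues are the squared norms. Zero vectors are harmless: the
  eigenvalue \<open>0\<close> contributes nothing to the entropy, and the eigenvalue sequence is padded by zeros anyway.\<close>

lemma vn_entropy_orthogonal:
  assumes J: "finite J" and w: "\<And>j. j \<in> J \<Longrightarrow> w j \<in> ell2 S" and orth: "orthogonal_on S J w"
    and \<rho>: "\<And>f. f \<in> ell2 S \<Longrightarrow> \<rho> f = mixture S J w f"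
  shows "vn_entropy S \<rho> = ereal (\<Sum>j\<in>J. - ((ell2_norm S (w j))\<^sup>2 * ln ((ell2_norm S (w j))\<^sup>2)))"
proof -
  define p where "p j = (ell2_norm S (w j))\<^sup>2" for j
  obtain js where js: "set js = J" "distinct js" using finite_distinct_list[OF J] by blast
  define xs where "xs = rev (sort (map p js))"
  define l where "l n = (if n < length xs then xs ! n else 0)" for n
  have nn: "0 \<le> x" if "x \<in> set xs" for x using that by (auto simp: xs_def p_def)
  have l0: "0 \<le> l n" for n using nn by (simp add: l_def)
  have "sorted_wrt (\<ge>) xs" by (simp add: xs_def sorted_wrt_rev)
  then have dec: "decseq l"
    unfolding decseq_def l_def
    by (auto simp: nn) (metis le_eq_less_or_eq order_refl sorted_wrt_nth_less)
  have fin: "finite {n. 0 < l n}"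
    by (rule finite_subset[of _ "{..<length xs}"]) (auto simp: l_def split: if_splits)
  have "eigenvalues S \<rho> = l"
  proof (rule eigenvalues_eqI[OF dec l0 fin])
    fix \<mu> :: real assume \<mu>: "\<mu> > 0"
    have "{n. l n = \<mu>} = {n. n < length xs \<and> xs ! n = \<mu>}" using \<mu> by (auto simp: l_def)
    then have "card {n. l n = \<mu>} = length (filter (\<lambda>x. x = \<mu>) xs)"
      by (simp add: length_filter_conv_card)
    also have "\<dots> = length (filter (\<lambda>j. p j = \<mu>) js)"
      by (simp add: xs_def filter_sort filter_map o_def flip: rev_filter)
    also have "\<dots> = card {j\<in>J. p j = \<mu>}"
      using js by (simp add: distinct_length_filter Int_def conj_commute)
    finally show "card {n. l n = \<mu>} = cfun.dim (eigenspace S \<rho> \<mu>)"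
      by (simp add: dim_eigenspace_mixture[OF J w orth \<rho> \<mu>] p_def)
  qed
  then have "vn_entropy S \<rho> = (\<Sum>n. ereal (- (l n * ln (l n))))" by (simp add: vn_entropy_def)
  also have "\<dots> = (\<Sum>n<length xs. ereal (- (l n * ln (l n))))"
    by (rule suminf_finite) (auto simp: l_def)
  also have "\<dots> = ereal (\<Sum>n<length xs. - (xs ! n * ln (xs ! n)))"
    by (simp add: l_def)
  also have "(\<Sum>n<length xs. - (xs ! n * ln (xs ! n))) = sum_list (map (\<lambda>x. - (x * ln x)) xs)"
    by (simp add: sum_list_sum_nth atLeast0LessThan)
  also have "\<dots> = sum_mset (image_mset (\<lambda>x. - (x * ln x)) (mset xs))"
    by (metis mset_map sum_mset_sum_list)
  also have "mset xs = mset (map p js)" by (simp add: xs_def)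
  also have "sum_mset (image_mset (\<lambda>x. - (x * ln x)) (mset (map p js))) = sum_list (map (\<lambda>j. - (p j * ln (p j))) js)"
    by (metis (no_types, lifting) map_map mset_map sum_mset_sum_list comp_apply map_eq_conv)
  also have "\<dots> = (\<Sum>j\<in>J. - (p j * ln (p j)))"
    using js by (simp add: sum_list_distinct_conv_sum_set)
  finally show ?thesis by (simp add: p_def)
qed

text \<open>Trace and purity \<open>tr (\<rho>\<^sup>2)\<close> of a mixture, in a form that shows their dependence on the kernel only.\<close>

lemma mixture_trace_cong:
  assumes "\<And>i. i \<in> I \<Longrightarrow> v i \<in> ell2 S" "\<And>j. j \<in> J \<Longrightarrow> w j \<in> ell2 S" "gram_kernel I v = gram_kernel J w"
  shows "(\<Sum>i\<in>I. (ell2_norm S (v i))\<^sup>2) = (\<Sum>j\<in>J. (ell2_norm S (w j))\<^sup>2)"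
proof -
  have tr: "(\<Sum>i\<in>I. cinner S (u i) (u i)) = (\<Sum>\<^sub>\<infinity>x\<in>S. gram_kernel I u x x)"
    if "\<And>i. i \<in> I \<Longrightarrow> u i \<in> ell2 S" for I and u :: "'i \<Rightarrow> 'b vec" and S
  proof -
    have "((\<lambda>x. \<Sum>i\<in>I. cnj (u i x) * u i x) has_sum (\<Sum>i\<in>I. cinner S (u i) (u i))) S"
      unfolding cinner_def using that by (intro has_sum_sum has_sum_infsum cinner_summable)
    then show ?thesis by (simp add: gram_kernel_def infsumI mult.commute)
  qed
  have "complex_of_real (\<Sum>i\<in>I. (ell2_norm S (v i))\<^sup>2) = (\<Sum>i\<in>I. cinner S (v i) (v i))"
    using assms(1) by (simp add: cinner_self)
  also have "\<dots> = (\<Sum>j\<in>J. cinner S (w j) (w j))"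
    using tr[of I v S] tr[of J w S] assms by simp
  also have "\<dots> = complex_of_real (\<Sum>j\<in>J. (ell2_norm S (w j))\<^sup>2)"
    using assms(2) by (simp add: cinner_self)
  finally show ?thesis by (simp only: of_real_eq_iff)
qed

lemma mixture_purity_cong:
  assumes v: "\<And>i. i \<in> I \<Longrightarrow> v i \<in> ell2 S" and w: "\<And>j. j \<in> J \<Longrightarrow> w j \<in> ell2 S"
    and eq: "gram_kernel I v = gram_kernel J w"
  shows "(\<Sum>i\<in>I. \<Sum>i'\<in>I. (cmod (cinner S (v i') (v i)))\<^sup>2) = (\<Sum>j\<in>J. \<Sum>j'\<in>J. (cmod (cinner S (w j') (w j)))\<^sup>2)"
proof -
  have "(\<Sum>i'\<in>I. (cmod (cinner S (v i') f))\<^sup>2) = (\<Sum>j\<in>J. (cmod (cinner S (w j) f))\<^sup>2)" if "f \<in> ell2 S" for f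
  proof -
    have "mixture S I v f = mixture S J w f" using assms that by (rule mixture_cong)
    then have "complex_of_real (\<Sum>i'\<in>I. (cmod (cinner S (v i') f))\<^sup>2) = of_real (\<Sum>j\<in>J. (cmod (cinner S (w j) f))\<^sup>2)"
      using cinner_mixture[of I v S f] cinner_mixture[of J w S f] assms that by simp
    then show ?thesis by (simp only: of_real_eq_iff)
  qed
  note * = this
  have sw: "cmod (cinner S (w j) (v i)) = cmod (cinner S (v i) (w j))" for i j
    by (subst cinner_commute) (rule complex_mod_cnj)
  have "(\<Sum>i\<in>I. \<Sum>i'\<in>I. (cmod (cinner S (v i') (v i)))\<^sup>2) = (\<Sum>i\<in>I. \<Sum>j\<in>J. (cmod (cinner S (v i) (w j)))\<^sup>2)"
    by (simp only: *[OF v] sw cong: sum.cong)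
  also have "\<dots> = (\<Sum>j\<in>J. \<Sum>i\<in>I. (cmod (cinner S (v i) (w j)))\<^sup>2)"
    by (rule sum.swap)
  also have "\<dots> = (\<Sum>j\<in>J. \<Sum>j'\<in>J. (cmod (cinner S (w j') (w j)))\<^sup>2)"
    by (simp only: *[OF w] cong: sum.cong)
  finally show ?thesis .
qed

lemma orthogonal_norm_sq_le_1:
  assumes "finite J" "(\<Sum>j\<in>J. (ell2_norm S (w j))\<^sup>2) = 1" "j \<in> J"
  shows "(ell2_norm S (w j))\<^sup>2 \<le> 1"
  using member_le_sum[of j J "\<lambda>j. (ell2_norm S (w j))\<^sup>2"] assms by simp

lemma vn_entropy_mixture_finite:
  assumes I: "finite I" and v: "\<And>i. i \<in> I \<Longrightarrow> v i \<in> ell2 S" and tr: "(\<Sum>i\<in>I. (ell2_norm S (v i))\<^sup>2) = 1"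
    and \<rho>: "\<And>f. f \<in> ell2 S \<Longrightarrow> \<rho> f = mixture S I v f"
  obtains h where "h \<ge> 0" "vn_entropy S \<rho> = ereal h"
proof -
  obtain n :: nat and w where w: "\<And>j. j < n \<Longrightarrow> w j \<in> ell2 S" "orthogonal_on S {..<n} w"
    "gram_kernel I v = gram_kernel {..<n} w"
    using orthogonal_decomposition[of I v S] I v by blast
  have tw: "(\<Sum>j<n. (ell2_norm S (w j))\<^sup>2) = 1"
    using mixture_trace_cong[of I v S "{..<n}" w] v w tr by simp
  have "vn_entropy S \<rho> = ereal (\<Sum>j<n. - ((ell2_norm S (w j))\<^sup>2 * ln ((ell2_norm S (w j))\<^sup>2)))"
    by (rule vn_entropy_orthogonal) (use w v \<rho> mixture_cong[of I v S "{..<n}" w] in auto)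
  moreover have "0 \<le> - ((ell2_norm S (w j))\<^sup>2 * ln ((ell2_norm S (w j))\<^sup>2))" if "j < n" for j
  proof -
    have "(ell2_norm S (w j))\<^sup>2 \<le> 1" using orthogonal_norm_sq_le_1[OF _ tw] that by simp
    then have "ln ((ell2_norm S (w j))\<^sup>2) \<le> 0"
      by (cases "ell2_norm S (w j) = 0") auto
    then show ?thesis by (simp add: mult_nonneg_nonpos)
  qed
  ultimately show thesis by (intro that) (auto intro: sum_nonneg)
qed

text \<open>The entropy dominates the collision entropy \<open>- ln (tr (\<rho>\<^sup>2))\<close>: bound \<open>ln\<close> from above by its tangent
  at the purity.\<close>

lemma vn_entropy_mixture_ge:
  assumes I: "finite I" and v: "\<And>i. i \<in> I \<Longrightarrow> v i \<in> ell2 S" and tr: "(\<Sum>i\<in>I. (ell2_norm S (v i))\<^sup>2) = 1"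
    and \<rho>: "\<And>f. f \<in> ell2 S \<Longrightarrow> \<rho> f = mixture S I v f"
    and c: "c > 0" "(\<Sum>i\<in>I. \<Sum>i'\<in>I. (cmod (cinner S (v i') (v i)))\<^sup>2) \<le> c"
  shows "vn_entropy S \<rho> \<ge> ereal (- ln c)"
proof -
  obtain n :: nat and w where w: "\<And>j. j < n \<Longrightarrow> w j \<in> ell2 S" "orthogonal_on S {..<n} w"
    "gram_kernel I v = gram_kernel {..<n} w"
    using orthogonal_decomposition[of I v S] I v by blast
  define p where "p j = (ell2_norm S (w j))\<^sup>2" for j
  have tw: "(\<Sum>j<n. p j) = 1"
    using mixture_trace_cong[of I v S "{..<n}" w] v w tr by (simp add: p_def)
  have "(\<Sum>j<n. \<Sum>j'<n. (cmod (cinner S (w j') (w j)))\<^sup>2) = (\<Sum>j<n. \<Sum>j'<n. if j' = j then (p j)\<^sup>2 else 0)"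
    using w by (intro sum.cong refl) (auto simp: orthogonal_on_def cinner_self p_def norm_power)
  then have pur: "(\<Sum>j<n. (p j)\<^sup>2) \<le> c"
    using mixture_purity_cong[of I v S "{..<n}" w] v w c by simp
  have e: "vn_entropy S \<rho> = ereal (\<Sum>j<n. - (p j * ln (p j)))"
    unfolding p_def by (rule vn_entropy_orthogonal) (use w v \<rho> mixture_cong[of I v S "{..<n}" w] in auto)
  have "p j * (1 - ln c) - (p j)\<^sup>2 / c \<le> - (p j * ln (p j))" for j
  proof (cases "p j = 0")
    case False
    then have p0: "p j > 0" by (simp add: p_def)
    then have "ln (p j / c) \<le> p j / c - 1" using c by (intro ln_le_minus_one) simp
    then have "ln (p j) \<le> p j / c - 1 + ln c" using p0 c by (simp add: ln_div)
    then have "p j * ln (p j) \<le> p j * (p j / c - 1 + ln c)" using p0 by (intro mult_left_mono) auto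
    then show ?thesis by (simp add: algebra_simps power2_eq_square)
  qed simp
  then have "(\<Sum>j<n. p j * (1 - ln c) - (p j)\<^sup>2 / c) \<le> (\<Sum>j<n. - (p j * ln (p j)))"
    by (intro sum_mono)
  also have "(\<Sum>j<n. p j * (1 - ln c) - (p j)\<^sup>2 / c) = (1 - ln c) - (\<Sum>j<n. (p j)\<^sup>2) / c"
    using tw by (simp add: sum_subtractf flip: sum_distrib_right sum_divide_distrib)
  finally show ?thesis using pur c unfolding e by (simp add: divide_le_eq) (smt (verit) divide_le_eq_1)
qed

section \<open>Entropy of product mixtures\<close>

lemma has_sum_product:
  fixes f :: "'a \<Rightarrow> complex" and g :: "'b \<Rightarrow> complex"
  assumes f: "(f has_sum a) X" and g: "(g has_sum b) Y"
  shows "((\<lambda>(x, y). f x * g y) has_sum a * b) (X \<times> Y)"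
proof (rule has_sum_SigmaI)
  show "((\<lambda>y. case (x, y) of (x, y) \<Rightarrow> f x * g y) has_sum f x * b) Y" for x
    using has_sum_cmult_right[OF g] by simp
  show "((\<lambda>x. f x * b) has_sum a * b) X" by (rule has_sum_cmult_left[OF f])
  have fa: "(\<lambda>x. norm (f x)) summable_on X" and ga: "(\<lambda>y. norm (g y)) summable_on Y"
    using f g has_sum_imp_summable summable_on_iff_abs_summable_on_complex by blast+
  have "(\<lambda>z. norm ((\<lambda>(x, y). f x * g y) z)) summable_on (X \<times> Y)"
    unfolding Infinite_Sum.abs_summable_on_Sigma_iff
    using fa ga by (auto simp: norm_mult infsum_cmult_right' infsum_nonneg
        intro!: summable_on_cmult_right summable_on_cmult_left)
  then show "(\<lambda>(x, y). f x * g y) summable_on (X \<times> Y)"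
    by (rule abs_summable_summable)
qed

text \<open>The tensor product of \<open>f\<close> and \<open>g\<close>, where \<open>p\<close> and \<open>q\<close> are the coordinates of a product
  decomposition of \<open>Z\<close>. Keeping the decomposition abstract covers \<open>S\<^sup>k\<^sup>+\<^sup>l = S\<^sup>k \<times> S\<^sup>l\<close>.\<close>

definition tens :: "'c set \<Rightarrow> ('c \<Rightarrow> 'a) \<Rightarrow> ('c \<Rightarrow> 'b) \<Rightarrow> 'a vec \<Rightarrow> 'b vec \<Rightarrow> 'c vec" where
  "tens Z p q f g z = (if z \<in> Z then f (p z) * g (q z) else 0)"

locale product_split =
  fixes Z :: "'c set" and p :: "'c \<Rightarrow> 'a" and q :: "'c \<Rightarrow> 'b" and X :: "'a set" and Y :: "'b set"
  assumes bij: "bij_betw (\<lambda>z. (p z, q z)) Z (X \<times> Y)"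
begin

lemma tens_has_sum:
  fixes f :: "'a \<Rightarrow> complex" and g :: "'b \<Rightarrow> complex"
  assumes "(f has_sum a) X" "(g has_sum b) Y"
  shows "((\<lambda>z. f (p z) * g (q z)) has_sum a * b) Z"
  using has_sum_reindex_bij_betw[OF bij, of "\<lambda>(x, y). f x * g y"] has_sum_product[OF assms] by simp

lemma tens_ell2:
  assumes "f \<in> ell2 X" "g \<in> ell2 Y"
  shows "tens Z p q f g \<in> ell2 Z"
proof (rule ell2I)
  have "((\<lambda>x. complex_of_real ((cmod (h x))\<^sup>2)) has_sum of_real (\<Sum>\<^sub>\<infinity>x\<in>S. (cmod (h x))\<^sup>2)) S"
    if "h \<in> ell2 S" for h :: "'x vec" and S
    using that by (intro has_sum_of_real has_sum_infsum ell2_summable)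
  from tens_has_sum[OF this[OF assms(1)] this[OF assms(2)]]
  have "(\<lambda>z. complex_of_real ((cmod (f (p z)))\<^sup>2 * (cmod (g (q z)))\<^sup>2)) summable_on Z"
    by (auto simp: summable_on_def)
  then have "(\<lambda>z. (cmod (f (p z)))\<^sup>2 * (cmod (g (q z)))\<^sup>2) summable_on Z"
    using summable_on_Re by fastforce
  then show "(\<lambda>z. (cmod (tens Z p q f g z))\<^sup>2) summable_on Z"
    by (rule summable_on_cong[THEN iffD1, rotated]) (simp add: tens_def norm_mult power_mult_distrib)
qed (simp add: tens_def)

lemma cinner_tens:
  assumes "f \<in> ell2 X" "f' \<in> ell2 X" "g \<in> ell2 Y" "g' \<in> ell2 Y"
  shows "cinner Z (tens Z p q f g) (tens Z p q f' g') = cinner X f f' * cinner Y g g'"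
proof -
  have "((\<lambda>z. (cnj (f (p z)) * f' (p z)) * (cnj (g (q z)) * g' (q z))) has_sum cinner X f f' * cinner Y g g') Z"
    unfolding cinner_def by (intro tens_has_sum has_sum_infsum cinner_summable assms)
  then show ?thesis
    unfolding cinner_def[of Z] by (intro infsumI) (simp add: tens_def mult_ac cong: has_sum_cong)
qed

lemma ell2_norm_tens:
  assumes "f \<in> ell2 X" "g \<in> ell2 Y"
  shows "(ell2_norm Z (tens Z p q f g))\<^sup>2 = (ell2_norm X f)\<^sup>2 * (ell2_norm Y g)\<^sup>2"
proof -
  have "complex_of_real ((ell2_norm Z (tens Z p q f g))\<^sup>2) = of_real ((ell2_norm X f)\<^sup>2 * (ell2_norm Y g)\<^sup>2)"
    using cinner_tens[OF assms(1,1) assms(2,2)] assms tens_ell2[OF assms]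
    by (simp only: cinner_self of_real_mult)
  then show ?thesis by (simp only: of_real_eq_iff)
qed

lemma gram_kernel_tens:
  "gram_kernel (I \<times> J) (\<lambda>(i, j). tens Z p q (v i) (w j)) x y
    = (if x \<in> Z \<and> y \<in> Z then gram_kernel I v (p x) (p y) * gram_kernel J w (q x) (q y) else 0)"
  by (auto simp: gram_kernel_def tens_def sum_product sum.cartesian_product case_prod_beta mult_ac)

text \<open>Additivity of the entropy on product states: tensor products of orthogonal families are orthogonal,
  and \<open>ln\<close> turns the products of squared norms into sums, each factor having total mass \<open>1\<close>.\<close>

lemma vn_entropy_tens:
  assumes I: "finite I" "\<And>i. i \<in> I \<Longrightarrow> v i \<in> ell2 X" "(\<Sum>i\<in>I. (ell2_norm X (v i))\<^sup>2) = 1"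
    and J: "finite J" "\<And>j. j \<in> J \<Longrightarrow> w j \<in> ell2 Y" "(\<Sum>j\<in>J. (ell2_norm Y (w j))\<^sup>2) = 1"
    and \<rho>: "\<And>f. f \<in> ell2 X \<Longrightarrow> \<rho> f = mixture X I v f"
    and \<sigma>: "\<And>f. f \<in> ell2 Y \<Longrightarrow> \<sigma> f = mixture Y J w f"
    and \<tau>: "\<And>f. f \<in> ell2 Z \<Longrightarrow> \<tau> f = mixture Z (I \<times> J) (\<lambda>(i, j). tens Z p q (v i) (w j)) f"
  shows "vn_entropy Z \<tau> = vn_entropy X \<rho> + vn_entropy Y \<sigma>"
proof -
  obtain m :: nat and a where a: "\<And>i. i < m \<Longrightarrow> a i \<in> ell2 X" "orthogonal_on X {..<m} a"
    "gram_kernel I v = gram_kernel {..<m} a"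
    using orthogonal_decomposition[of I v X] I(1,2) by blast
  obtain n :: nat and b where b: "\<And>j. j < n \<Longrightarrow> b j \<in> ell2 Y" "orthogonal_on Y {..<n} b"
    "gram_kernel J w = gram_kernel {..<n} b"
    using orthogonal_decomposition[of J w Y] J(1,2) by blast
  define s where "s i = (ell2_norm X (a i))\<^sup>2" for i
  define t where "t j = (ell2_norm Y (b j))\<^sup>2" for j
  have sum_s: "(\<Sum>i<m. s i) = 1"
    using mixture_trace_cong[of I v X "{..<m}" a] I a by (simp add: s_def)
  have sum_t: "(\<Sum>j<n. t j) = 1"
    using mixture_trace_cong[of J w Y "{..<n}" b] J b by (simp add: t_def)
  have e1: "vn_entropy X \<rho> = ereal (\<Sum>i<m. - (s i * ln (s i)))"
    unfolding s_def by (rule vn_entropy_orthogonal) (use a I \<rho> mixture_cong[of I v X "{..<m}" a] in auto)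
  have e2: "vn_entropy Y \<sigma> = ereal (\<Sum>j<n. - (t j * ln (t j)))"
    unfolding t_def by (rule vn_entropy_orthogonal) (use b J \<sigma> mixture_cong[of J w Y "{..<n}" b] in auto)
  define c where "c = (\<lambda>(i, j). tens Z p q (a i) (b j))"
  have c: "c k \<in> ell2 Z" if "k \<in> {..<m} \<times> {..<n}" for k
    using that a b by (auto simp: c_def tens_ell2)
  have norm_c: "(ell2_norm Z (c (i, j)))\<^sup>2 = s i * t j" if "i < m" "j < n" for i j
    using that a b by (simp add: c_def s_def t_def ell2_norm_tens)
  have ker: "gram_kernel (I \<times> J) (\<lambda>(i, j). tens Z p q (v i) (w j)) = gram_kernel ({..<m} \<times> {..<n}) c"
    unfolding c_def by (intro ext) (simp only: gram_kernel_tens a(3) b(3))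
  have vw: "(case k of (i, j) \<Rightarrow> tens Z p q (v i) (w j)) \<in> ell2 Z" if "k \<in> I \<times> J" for k
    using that I J by (auto simp: tens_ell2)
  have "vn_entropy Z \<tau> = ereal (\<Sum>k\<in>{..<m} \<times> {..<n}. - ((ell2_norm Z (c k))\<^sup>2 * ln ((ell2_norm Z (c k))\<^sup>2)))"
  proof (rule vn_entropy_orthogonal[OF _ c])
    show "orthogonal_on Z ({..<m} \<times> {..<n}) c"
      using a b by (auto simp: orthogonal_on_def c_def cinner_tens)
    show "\<tau> f = mixture Z ({..<m} \<times> {..<n}) c f" if "f \<in> ell2 Z" for f
      unfolding \<tau>[OF that] by (rule mixture_cong[OF vw c ker that])
  qed auto
  also have "(\<Sum>k\<in>{..<m} \<times> {..<n}. - ((ell2_norm Z (c k))\<^sup>2 * ln ((ell2_norm Z (c k))\<^sup>2)))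
      = (\<Sum>i<m. \<Sum>j<n. - (s i * t j * ln (s i * t j)))"
    by (simp add: sum.cartesian_product norm_c case_prod_beta cong: sum.cong)
       (auto simp: norm_c intro!: sum.cong)
  also have "\<dots> = (\<Sum>i<m. \<Sum>j<n. - (s i * ln (s i)) * t j + s i * - (t j * ln (t j)))"
  proof (intro sum.cong refl)
    fix i j
    have "s i \<ge> 0" "t j \<ge> 0" by (simp_all add: s_def t_def)
    then show "- (s i * t j * ln (s i * t j)) = - (s i * ln (s i)) * t j + s i * - (t j * ln (t j))"
      by (cases "s i = 0"; cases "t j = 0") (simp_all add: ln_mult algebra_simps)
  qed
  also have "\<dots> = (\<Sum>i<m. - (s i * ln (s i))) * (\<Sum>j<n. t j) + (\<Sum>i<m. s i) * (\<Sum>j<n. - (t j * ln (t j)))"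
    by (simp only: sum.distrib sum_product)
  finally show ?thesis by (simp add: sum_s sum_t e1 e2)
qed

end

section \<open>Tensor products of bounded operators\<close>

definition slice :: "'a set \<Rightarrow> 'i \<Rightarrow> ('i \<Rightarrow> 'a) vec \<Rightarrow> ('i \<Rightarrow> 'a) \<Rightarrow> 'a vec" where
  "slice S j f z = (\<lambda>a. if a \<in> S then f (z(j := a)) else 0)"

text \<open>The operator \<open>1 \<otimes> \<dots> \<otimes> T \<otimes> \<dots> \<otimes> 1\<close> with \<open>T\<close> in position \<open>j\<close>.\<close>

definition act_on_factor :: "'a set \<Rightarrow> nat \<Rightarrow> nat \<Rightarrow> 'a oper \<Rightarrow> (nat \<Rightarrow> 'a) oper" where
  "act_on_factor S k j T f = (\<lambda>x. if x \<in> tuples S k then T (slice S j f x) (x j) else 0)"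

lemma bij_betw_insert_coordinate:
  assumes "j \<in> {1..k}"
  shows "bij_betw (\<lambda>(z, a). z(j := a)) ((\<Pi>\<^sub>E i\<in>{1..k} - {j}. S) \<times> S) (tuples S k)"
proof (rule bij_betw_byWitness[where f' = "\<lambda>x. (restrict x ({1..k} - {j}), x j)"])
  have "restrict (z(j := a)) ({1..k} - {j}) = z" if "z \<in> (\<Pi>\<^sub>E i\<in>{1..k} - {j}. S)" for z a
  proof -
    have "restrict (z(j := a)) ({1..k} - {j}) = restrict z ({1..k} - {j})"
      by (rule restrict_ext) simp
    then show ?thesis using PiE_restrict[OF that] by simp
  qed
  then show "\<forall>p\<in>(\<Pi>\<^sub>E i\<in>{1..k} - {j}. S) \<times> S.
      (restrict ((\<lambda>(z, a). z(j := a)) p) ({1..k} - {j}), (\<lambda>(z, a). z(j := a)) p j) = p"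
    by simp
  have "(restrict x ({1..k} - {j}))(j := x j) = x" if "x \<in> tuples S k" for x
  proof
    fix i show "((restrict x ({1..k} - {j}))(j := x j)) i = x i"
      using PiE_arb[OF that[unfolded tuples_def], of i] by simp
  qed
  then show "\<forall>x\<in>tuples S k. (\<lambda>(z, a). z(j := a)) (restrict x ({1..k} - {j}), x j) = x"
    by simp
  have "insert j ({1..k} - {j}) = {1..k}" using assms by auto
  then have *: "z(j := a) \<in> tuples S k" if "z \<in> (\<Pi>\<^sub>E i\<in>{1..k} - {j}. S)" "a \<in> S" for z a
    using PiE_fun_upd[of a "\<lambda>_. S" j z "{1..k} - {j}"] that by (simp only: tuples_def)
  show "(\<lambda>(z, a). z(j := a)) ` ((\<Pi>\<^sub>E i\<in>{1..k} - {j}. S) \<times> S) \<subseteq> tuples S k"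
    by (rule image_subsetI, clarify, rule *)
  show "(\<lambda>x. (restrict x ({1..k} - {j}), x j)) ` tuples S k \<subseteq> (\<Pi>\<^sub>E i\<in>{1..k} - {j}. S) \<times> S"
  proof (rule image_subsetI)
    fix x assume "x \<in> tuples S k"
    then have "\<forall>i\<in>{1..k}. x i \<in> S" unfolding tuples_def by blast
    then show "(restrict x ({1..k} - {j}), x j) \<in> (\<Pi>\<^sub>E i\<in>{1..k} - {j}. S) \<times> S"
      using assms by (simp add: restrict_PiE_iff)
  qed
qed

text \<open>Fubini: the squared norm of \<open>f\<close> is the sum of the squared norms of its slices, and \<open>T\<close> acts on each slice.\<close>

lemma bounded_op_act_on_factor:
  assumes T: "bounded_op S T" and j: "j \<in> {1..k}"
  shows "bounded_op (tuples S k) (act_on_factor S k j T)"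
proof -
  define Z where "Z = (\<Pi>\<^sub>E i\<in>{1..k} - {j}. S)"
  have bij: "bij_betw (\<lambda>(z, a). z(j := a)) (Z \<times> S) (tuples S k)"
    unfolding Z_def by (rule bij_betw_insert_coordinate[OF j])
  have ins: "z(j := a) \<in> tuples S k" if "z \<in> Z" "a \<in> S" for z a
    using bij that by (auto simp: bij_betw_def)
  have in_Z: "\<exists>z\<in>Z. \<exists>a\<in>S. x = z(j := a)" if "x \<in> tuples S k" for x
    using bij that by (force simp: bij_betw_def)
  have slice_upd: "slice S j f (z(j := a)) = slice S j f z" for f :: "(nat \<Rightarrow> 'a) vec" and z a
    by (auto simp: slice_def fun_eq_iff)
  obtain B where B0: "B \<ge> 0" and B: "\<And>f. f \<in> ell2 S \<Longrightarrow> ell2_norm S (T f) \<le> B * ell2_norm S f"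
    using bounded_op_bound[OF T] by blast
  have slice_has_sum: "((\<lambda>a. (cmod (f (z(j := a))))\<^sup>2) has_sum (ell2_norm S (slice S j f z))\<^sup>2) S"
    if "slice S j f z \<in> ell2 S" for f :: "(nat \<Rightarrow> 'a) vec" and z
    using has_sum_infsum[OF ell2_summable[OF that]]
    unfolding ell2_norm_square slice_def by (simp cong: has_sum_cong infsum_cong)
  have slices: "slice S j f z \<in> ell2 S" "((\<lambda>z. (ell2_norm S (slice S j f z))\<^sup>2) has_sum (ell2_norm (tuples S k) f)\<^sup>2) Z"
    if f: "f \<in> ell2 (tuples S k)" and z: "z \<in> Z" for f z
  proof -
    have hs: "((\<lambda>x. (cmod (f x))\<^sup>2) has_sum (ell2_norm (tuples S k) f)\<^sup>2) (tuples S k)"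
      unfolding ell2_norm_square using f by (intro has_sum_infsum ell2_summable)
    then have hs': "((\<lambda>p. (cmod (f ((\<lambda>(z, a). z(j := a)) p)))\<^sup>2) has_sum (ell2_norm (tuples S k) f)\<^sup>2) (Z \<times> S)"
      by (subst has_sum_reindex_bij_betw[OF bij])
    have sl: "slice S j f z \<in> ell2 S" if "z \<in> Z" for z
    proof (rule ell2I)
      have "(\<lambda>(z, a). (cmod (f (z(j := a))))\<^sup>2) summable_on Z \<times> S"
        using has_sum_imp_summable[OF hs'] by (simp only: case_prod_unfold)
      then have "(\<lambda>a. (cmod (f (z(j := a))))\<^sup>2) summable_on S"
        using that by (rule summable_on_SigmaD1)
      then show "(\<lambda>a. (cmod (slice S j f z a))\<^sup>2) summable_on S"
        by (simp add: slice_def cong: summable_on_cong)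
    qed (simp add: slice_def)
    then show "slice S j f z \<in> ell2 S" using z .
    show "((\<lambda>z. (ell2_norm S (slice S j f z))\<^sup>2) has_sum (ell2_norm (tuples S k) f)\<^sup>2) Z"
      using hs' by (rule has_sum_SigmaD) (simp add: slice_has_sum sl)
  qed
  show ?thesis
    unfolding bounded_op_def
  proof (intro conjI ballI allI exI)
    fix f assume f: "f \<in> ell2 (tuples S k)"
    define g where "g = act_on_factor S k j T f"
    define r where "r z = (ell2_norm S (T (slice S j f z)))\<^sup>2" for z
    have g_upd: "g (z(j := a)) = T (slice S j f z) a" if "z \<in> Z" "a \<in> S" for z a
      using that ins by (simp add: g_def act_on_factor_def slice_upd)
    have r: "((\<lambda>a. (cmod (g (z(j := a))))\<^sup>2) has_sum r z) S" if "z \<in> Z" for z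
      using has_sum_infsum[OF ell2_summable[OF bounded_opD(1)[OF T slices(1)[OF f that]]]]
      unfolding r_def ell2_norm_square by (simp add: g_upd that cong: has_sum_cong)
    have r_le: "r z \<le> B\<^sup>2 * (ell2_norm S (slice S j f z))\<^sup>2" if "z \<in> Z" for z
      unfolding r_def power_mult_distrib[symmetric]
      by (intro power_mono B slices(1)[OF f that] ell2_norm_nonneg)
    have bound: "((\<lambda>z. B\<^sup>2 * (ell2_norm S (slice S j f z))\<^sup>2) has_sum B\<^sup>2 * (ell2_norm (tuples S k) f)\<^sup>2) Z"
    proof (cases "Z = {}")
      case True
      then have "tuples S k = {}" using bij by (simp add: bij_betw_def)
      then show ?thesis by (simp add: True ell2_norm_def)
    next
      case False
      then show ?thesis using slices(2)[OF f] by (auto intro: has_sum_cmult_right)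
    qed
    have r_sum: "r summable_on Z"
      by (rule summable_on_comparison_test[OF has_sum_imp_summable[OF bound] r_le]) (simp_all add: r_def)
    have "(\<lambda>p. (cmod (g ((\<lambda>(z, a). z(j := a)) p)))\<^sup>2) summable_on (Z \<times> S)"
      by (rule summable_on_SigmaI[OF _ r_sum]) (simp_all add: r)
    then have g_hs': "((\<lambda>p. (cmod (g ((\<lambda>(z, a). z(j := a)) p)))\<^sup>2) has_sum infsum r Z) (Z \<times> S)"
      by (rule has_sum_SigmaI[OF _ has_sum_infsum[OF r_sum], rotated]) (simp add: r)
    then have g_hs: "((\<lambda>x. (cmod (g x))\<^sup>2) has_sum infsum r Z) (tuples S k)"
      by (subst (asm) has_sum_reindex_bij_betw[OF bij])
    show "act_on_factor S k j T f \<in> ell2 (tuples S k)"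
      unfolding g_def[symmetric]
      by (rule ell2I) (use has_sum_imp_summable[OF g_hs] in \<open>auto simp: g_def act_on_factor_def\<close>)
    have "(ell2_norm (tuples S k) g)\<^sup>2 = infsum r Z"
      using g_hs by (simp add: ell2_norm_square infsumI)
    also have "\<dots> \<le> (B * ell2_norm (tuples S k) f)\<^sup>2"
      using has_sum_mono[OF has_sum_infsum[OF r_sum] bound r_le] by (simp add: power_mult_distrib)
    finally show "ell2_norm (tuples S k) (act_on_factor S k j T f) \<le> B * ell2_norm (tuples S k) f"
      unfolding g_def[symmetric] by (rule power2_le_imp_le) (simp add: B0 ell2_norm_nonneg)
    fix c
    have sl: "slice S j (cscale c f) x = cscale c (slice S j f x)" for x
      by (auto simp: slice_def cscale_def)
    have "slice S j f x \<in> ell2 S" if "x \<in> tuples S k" for x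
      using in_Z[OF that] slices(1)[OF f] by (auto simp: slice_upd)
    then have "T (slice S j (cscale c f) x) = cscale c (T (slice S j f x))" if "x \<in> tuples S k" for x
      unfolding sl using that by (intro bounded_opD(3)[OF T])
    then show "act_on_factor S k j T (cscale c f) = cscale c (act_on_factor S k j T f)"
      unfolding act_on_factor_def by (intro ext) (simp add: cscale_def)
  next
    fix f g assume fg: "f \<in> ell2 (tuples S k)" "g \<in> ell2 (tuples S k)"
    have sl: "slice S j (f + g) x = slice S j f x + slice S j g x" for x
      by (auto simp: slice_def)
    have "slice S j f x \<in> ell2 S" "slice S j g x \<in> ell2 S" if "x \<in> tuples S k" for x
      using in_Z[OF that] slices(1)[OF fg(1)] slices(1)[OF fg(2)] by (auto simp: slice_upd)
    then have "T (slice S j (f + g) x) = T (slice S j f x) + T (slice S j g x)" if "x \<in> tuples S k" for x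
      unfolding sl using that by (intro bounded_opD(2)[OF T])
    then show "act_on_factor S k j T (f + g) = act_on_factor S k j T f + act_on_factor S k j T g"
      unfolding act_on_factor_def by (intro ext) simp
  qed
qed

lemma bounded_op_cong:
  assumes "\<And>f. f \<in> ell2 S \<Longrightarrow> T f = T' f" "bounded_op S T"
  shows "bounded_op S T'"
  using assms(2) unfolding bounded_op_def
  by (simp add: ell2_add cscale_ell2 flip: assms(1))

lemma bounded_op_id: "bounded_op S (\<lambda>f. f)"
  by (auto simp: bounded_op_def intro!: exI[of _ 1])

lemma bounded_op_compose:
  assumes "bounded_op S T" "bounded_op S T'"
  shows "bounded_op S (\<lambda>f. T (T' f))"
proof -
  obtain B where B: "B \<ge> 0" "\<And>f. f \<in> ell2 S \<Longrightarrow> ell2_norm S (T f) \<le> B * ell2_norm S f"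
    using bounded_op_bound[OF assms(1)] by blast
  obtain B' where B': "\<And>f. f \<in> ell2 S \<Longrightarrow> ell2_norm S (T' f) \<le> B' * ell2_norm S f"
    using bounded_op_bound[OF assms(2)] by blast
  have "ell2_norm S (T (T' f)) \<le> (B * B') * ell2_norm S f" if f: "f \<in> ell2 S" for f
    using B(2)[OF bounded_opD(1)[OF assms(2) f]] mult_left_mono[OF B'[OF f] B(1)] by (simp add: mult.assoc)
  then show ?thesis
    unfolding bounded_op_def using bounded_opD[OF assms(1)] bounded_opD[OF assms(2)] by auto
qed

text \<open>A tensor product of operators is the composition of their actions on the single factors. It
  suffices to compare the two on standard basis vectors, because bounded operators are given by their matrices.
  The induction composes the actions on the first \<open>m\<close> factors.\<close>

lemma bounded_op_tensor_op:
  assumes A: "\<And>j. j \<in> {1..k} \<Longrightarrow> bounded_op S (A j)"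
  shows "bounded_op (tuples S k) (tensor_op S k A)"
proof -
  have "\<exists>C. bounded_op (tuples S k) C \<and> (\<forall>y\<in>tuples S k. \<forall>x\<in>tuples S k. C (ket y) x
      = (\<Prod>j=1..m. A j (ket (y j)) (x j)) * (\<Prod>j=m+1..k. ket (y j) (x j)))" if "m \<le> k" for m
    using that
  proof (induction m)
    case 0
    have "ket y x = (\<Prod>j=1..k. ket (y j) (x j))" if xy: "y \<in> tuples S k" "x \<in> tuples S k" for x y
    proof (cases "x = y")
      case True
      then show ?thesis by (simp add: ket_def)
    next
      case False
      then obtain j where "j \<in> {1..k}" "x j \<noteq> y j"
        using PiE_ext[of x "{1..k}" "\<lambda>_. S" y] xy unfolding tuples_def by metis
      then have "(\<Prod>j=1..k. ket (y j) (x j)) = 0" by (intro prod_zero) (auto simp: ket_def)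
      then show ?thesis using False by (simp add: ket_def)
    qed
    then show ?case by (intro exI[of _ "\<lambda>f. f"]) (auto simp: bounded_op_id)
  next
    case (Suc m)
    then obtain C where C: "bounded_op (tuples S k) C"
      and Ck: "\<And>y x. y \<in> tuples S k \<Longrightarrow> x \<in> tuples S k \<Longrightarrow> C (ket y) x
        = (\<Prod>j=1..m. A j (ket (y j)) (x j)) * (\<Prod>j=m+1..k. ket (y j) (x j))"
      by auto
    have m: "Suc m \<in> {1..k}" using Suc.prems by simp
    show ?case
    proof (intro exI conjI ballI)
      show "bounded_op (tuples S k) (\<lambda>f. act_on_factor S k (Suc m) (A (Suc m)) (C f))"
        by (rule bounded_op_compose[OF bounded_op_act_on_factor[OF A[OF m] m] C])
      fix y x assume y: "y \<in> tuples S k" and x: "x \<in> tuples S k"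
      define c where "c = (\<Prod>j=1..m. A j (ket (y j)) (x j)) * (\<Prod>j=Suc m+1..k. ket (y j) (x j))"
      have yS: "y (Suc m) \<in> S" using y m by (auto simp: tuples_def)
      have "slice S (Suc m) (C (ket y)) x = cscale c (ket (y (Suc m)))"
      proof
        fix a
        show "slice S (Suc m) (C (ket y)) x a = cscale c (ket (y (Suc m))) a"
        proof (cases "a \<in> S")
          case True
          have "x(Suc m := a) \<in> tuples S k"
            using x m True by (auto simp: tuples_def PiE_iff extensional_def)
          then have "C (ket y) (x(Suc m := a)) = (\<Prod>j=1..m. A j (ket (y j)) ((x(Suc m := a)) j)) * (\<Prod>j=m+1..k. ket (y j) ((x(Suc m := a)) j))"
            by (rule Ck[OF y])
          also have "(\<Prod>j=1..m. A j (ket (y j)) ((x(Suc m := a)) j)) = (\<Prod>j=1..m. A j (ket (y j)) (x j))"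
            by (intro prod.cong) auto
          also have "(\<Prod>j=m+1..k. ket (y j) ((x(Suc m := a)) j)) = ket (y (Suc m)) a * (\<Prod>j=Suc m+1..k. ket (y j) ((x(Suc m := a)) j))"
            using m by (subst prod.atLeast_Suc_atMost) auto
          also have "(\<Prod>j=Suc m+1..k. ket (y j) ((x(Suc m := a)) j)) = (\<Prod>j=Suc m+1..k. ket (y j) (x j))"
            by (intro prod.cong) auto
          finally show ?thesis using True by (simp add: slice_def cscale_def c_def fun_upd_def mult_ac)
        next
          case False
          then show ?thesis using yS by (auto simp: slice_def cscale_def ket_def)
        qed
      qed
      then have "act_on_factor S k (Suc m) (A (Suc m)) (C (ket y)) x = c * A (Suc m) (ket (y (Suc m))) (x (Suc m))"
        using x bounded_opD(3)[OF A[OF m] ket_ell2[OF yS]] by (simp add: act_on_factor_def) (simp add: cscale_def)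
      then show "act_on_factor S k (Suc m) (A (Suc m)) (C (ket y)) x
          = (\<Prod>j=1..Suc m. A j (ket (y j)) (x j)) * (\<Prod>j=Suc m+1..k. ket (y j) (x j))"
        by (simp add: c_def mult_ac)
    qed
  qed
  from this[of k] obtain C where C: "bounded_op (tuples S k) C"
    and Ck: "\<And>y x. y \<in> tuples S k \<Longrightarrow> x \<in> tuples S k \<Longrightarrow> C (ket y) x = (\<Prod>j=1..k. A j (ket (y j)) (x j))"
    by auto
  have "C f = tensor_op S k A f" if f: "f \<in> ell2 (tuples S k)" for f
  proof
    fix x show "C f x = tensor_op S k A f x"
    proof (cases "x \<in> tuples S k")
      case True
      then have "((\<lambda>y. (\<Prod>j=1..k. A j (ket (y j)) (x j)) * f y) has_sum C f x) (tuples S k)"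
        using bounded_op_has_sum[OF C f, of x] by (simp add: Ck cong: has_sum_cong)
      then show ?thesis using True by (simp add: tensor_op_def infsumI)
    next
      case False
      then show ?thesis using bounded_opD(1)[OF C f] by (simp add: tensor_op_def ell2_outside)
    qed
  qed
  then show ?thesis using C by (rule bounded_op_cong)
qed

lemma tensor_op_ket:
  assumes y: "y \<in> tuples S k" and x: "x \<in> tuples S k"
  shows "tensor_op S k A (ket y) x = (\<Prod>j=1..k. A j (ket (y j)) (x j))"
proof -
  have "tensor_op S k A (ket y) x = (\<Sum>\<^sub>\<infinity>z\<in>{y}. (\<Prod>j=1..k. A j (ket (z j)) (x j)) * ket y z)"
    unfolding tensor_op_def using x y
    by (simp only: if_True) (rule infsum_cong_neutral, auto simp: ket_def)
  then show ?thesis by (simp add: ket_def)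
qed

section \<open>Outputs of channels on pure states\<close>

lemma cinner_ket_left: "x \<in> S \<Longrightarrow> cinner S (ket x) f = f x"
  by (subst cinner_commute) (simp add: cinner_ket_right)

text \<open>As \<open>|\<xi>\<rangle>\<langle>\<xi>|\<close> is positive, it is its own absolute value.\<close>

lemma trace_class_proj:
  assumes \<xi>: "\<xi> \<in> ell2 S"
  shows "trace_class S (proj S \<xi>)"
proof -
  have bd: "bounded_op S (proj S \<xi>)"
    unfolding bounded_op_def
  proof (intro conjI ballI allI exI)
    fix f assume f: "f \<in> ell2 S"
    show "proj S \<xi> f \<in> ell2 S" using \<xi> by (simp add: proj_def cscale_ell2)
    show "ell2_norm S (proj S \<xi> f) \<le> (ell2_norm S \<xi>)\<^sup>2 * ell2_norm S f"
      using mult_right_mono[OF ell2_Cauchy_Schwarz[OF \<xi> f] ell2_norm_nonneg[of S \<xi>]]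
      by (simp add: proj_def ell2_norm_cscale power2_eq_square mult_ac)
    fix c show "proj S \<xi> (cscale c f) = cscale c (proj S \<xi> f)"
      by (simp add: proj_def cinner_scale_right)
  next
    fix f g assume "f \<in> ell2 S" "g \<in> ell2 S"
    then show "proj S \<xi> (f + g) = proj S \<xi> f + proj S \<xi> g"
      using \<xi> by (simp add: proj_def cinner_add_right cfun.scale_left_distrib)
  qed
  have adj: "adj S (proj S \<xi>) f = proj S \<xi> f" if f: "f \<in> ell2 S" for f
  proof (rule adj_eqI)
    show "proj S \<xi> f \<in> ell2 S" using \<xi> by (simp add: proj_def cscale_ell2)
    show "cinner S (proj S \<xi> f) g = cinner S f (proj S \<xi> g)" for g
      using cinner_commute[of S f \<xi>] by (simp add: proj_def cinner_scale_left cinner_scale_right)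
  qed
  have "positive_op S (proj S \<xi>)"
    unfolding positive_op_def
  proof (intro conjI ballI bd)
    fix f assume "f \<in> ell2 S"
    have "cinner S f (proj S \<xi> f) = cinner S \<xi> f * cnj (cinner S \<xi> f)"
      using cinner_commute[of S f \<xi>] by (simp add: proj_def cinner_scale_right)
    also have "\<dots> = of_real ((cmod (cinner S \<xi> f))\<^sup>2)" by (simp only: complex_norm_square)
    finally show "cinner S f (proj S \<xi> f) \<in> \<real>\<^sub>\<ge>\<^sub>0" by simp
  qed
  moreover have "(\<lambda>x. cinner S (ket x) (proj S \<xi> (ket x))) summable_on S"
    by (rule summable_on_cong[THEN iffD2, OF _ cinner_summable[OF \<xi> \<xi>]])
      (simp add: proj_def cinner_scale_right cinner_ket_right cinner_ket_left)
  ultimately show ?thesis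
    unfolding trace_class_def using bd adj bounded_opD(1)[OF bd] by auto
qed

lemma conjugate_proj:
  assumes "bounded_op S T" "\<xi> \<in> ell2 S" "f \<in> ell2 S"
  shows "T (proj S \<xi> (adj S T f)) = cscale (cinner S (T \<xi>) f) (T \<xi>)"
proof -
  have "cinner S \<xi> (adj S T f) = cnj (cinner S (adj S T f) \<xi>)" by (rule cinner_commute)
  also have "\<dots> = cnj (cinner S f (T \<xi>))" using adj_exists(2)[OF assms(1,3,2)] by simp
  also have "\<dots> = cinner S (T \<xi>) f" by (rule cinner_commute[symmetric])
  finally show ?thesis using bounded_opD(3)[OF assms(1,2)] by (simp add: proj_def)
qed

lemma kraus_rep_output:
  assumes "kraus_rep S \<Phi> M A" "\<xi> \<in> ell2 S" "f \<in> ell2 S"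
  shows "\<Phi> (proj S \<xi>) f = mixture S {1..M} (\<lambda>i. A i \<xi>) f"
  using assms trace_class_proj[OF assms(2)]
  by (auto simp: kraus_rep_def mixture_def conjugate_proj intro!: sum.cong)

lemma mixture_ket:
  assumes "y \<in> S"
  shows "mixture S I v (ket y) x = gram_kernel I v x y"
  using assms by (simp add: mixture_def gram_kernel_def sum_apply cscale_def cinner_ket_right mult.commute)

text \<open>The output on pure states determines the matrix \<open>\<Sum>\<^sub>i A\<^sub>i \<otimes> cnj A\<^sub>i\<close> by polarization.\<close>

lemma kraus_polarization:
  assumes A: "\<And>i. i \<in> I \<Longrightarrow> bounded_op S (A i)" and B: "\<And>j. j \<in> J \<Longrightarrow> bounded_op S (B j)"
    and eq: "\<And>\<xi> f. \<xi> \<in> ell2 S \<Longrightarrow> f \<in> ell2 S \<Longrightarrow> mixture S I (\<lambda>i. A i \<xi>) f = mixture S J (\<lambda>j. B j \<xi>) f"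
    and \<xi>: "\<xi> \<in> ell2 S" "\<eta> \<in> ell2 S" and y: "y \<in> S"
  shows "(\<Sum>i\<in>I. A i \<xi> x * cnj (A i \<eta> y)) = (\<Sum>j\<in>J. B j \<xi> x * cnj (B j \<eta> y))"
proof -
  define P where "P \<xi> \<eta> = (\<Sum>i\<in>I. A i \<xi> x * cnj (A i \<eta> y))" for \<xi> \<eta>
  define Q where "Q \<xi> \<eta> = (\<Sum>j\<in>J. B j \<xi> x * cnj (B j \<eta> y))" for \<xi> \<eta>
  have PQ: "P \<zeta> \<zeta> = Q \<zeta> \<zeta>" if "\<zeta> \<in> ell2 S" for \<zeta>
    using arg_cong[OF eq[OF that ket_ell2[OF y]], of "\<lambda>h. h x"] y
    by (simp add: mixture_ket gram_kernel_def P_def Q_def)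
  have P: "P (\<xi> + cscale c \<eta>) (\<xi> + cscale c \<eta>) = P \<xi> \<xi> + cnj c * P \<xi> \<eta> + c * P \<eta> \<xi> + c * cnj c * P \<eta> \<eta>" for c
    unfolding P_def sum_distrib_left sum.distrib[symmetric]
    using \<xi> by (intro sum.cong refl) (simp add: bounded_opD[OF A] cscale_ell2, simp add: cscale_def algebra_simps)
  have Q: "Q (\<xi> + cscale c \<eta>) (\<xi> + cscale c \<eta>) = Q \<xi> \<xi> + cnj c * Q \<xi> \<eta> + c * Q \<eta> \<xi> + c * cnj c * Q \<eta> \<eta>" for c
    unfolding Q_def sum_distrib_left sum.distrib[symmetric]
    using \<xi> by (intro sum.cong refl) (simp add: bounded_opD[OF B] cscale_ell2, simp add: cscale_def algebra_simps)
  \<comment> \<open>Comparing \<open>c = 1\<close> and \<open>c = \<i>\<close> separates the two mixed terms.\<close>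
  have *: "cnj c * P \<xi> \<eta> + c * P \<eta> \<xi> = cnj c * Q \<xi> \<eta> + c * Q \<eta> \<xi>" for c
    using P[of c] Q[of c] PQ[of "\<xi> + cscale c \<eta>"] PQ[of \<xi>] PQ[of \<eta>] \<xi>
    by (simp add: ell2_add cscale_ell2)
  have 1: "P \<xi> \<eta> + P \<eta> \<xi> = Q \<xi> \<eta> + Q \<eta> \<xi>" using *[of 1] by simp
  have "\<i> * (P \<eta> \<xi> - P \<xi> \<eta>) = \<i> * (Q \<eta> \<xi> - Q \<xi> \<eta>)" using *[of \<i>] by (simp add: algebra_simps)
  then have 2: "P \<eta> \<xi> - P \<xi> \<eta> = Q \<eta> \<xi> - Q \<xi> \<eta>" by simp
  have "2 * P \<xi> \<eta> = (P \<xi> \<eta> + P \<eta> \<xi>) - (P \<eta> \<xi> - P \<xi> \<eta>)" by simp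
  also have "\<dots> = 2 * Q \<xi> \<eta>" unfolding 1 2 by simp
  finally have "P \<xi> \<eta> = Q \<xi> \<eta>" by simp
  then show ?thesis by (simp add: P_def Q_def)
qed

text \<open>Conversely that matrix determines the output on pure states, one variable being summed at a time.\<close>

lemma gram_kernel_cong_ket:
  fixes T :: "'i \<Rightarrow> 'a oper" and R :: "'j \<Rightarrow> 'a oper"
  assumes T: "\<And>i. i \<in> I \<Longrightarrow> bounded_op S (T i)" and R: "\<And>j. j \<in> J \<Longrightarrow> bounded_op S (R j)"
    and eq: "\<And>x x' y y'. x \<in> S \<Longrightarrow> x' \<in> S \<Longrightarrow> y \<in> S \<Longrightarrow> y' \<in> S \<Longrightarrow>
      (\<Sum>i\<in>I. T i (ket y) x * cnj (T i (ket y') x')) = (\<Sum>j\<in>J. R j (ket y) x * cnj (R j (ket y') x'))"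
    and \<xi>: "\<xi> \<in> ell2 S"
  shows "gram_kernel I (\<lambda>i. T i \<xi>) = gram_kernel J (\<lambda>j. R j \<xi>)"
proof (intro ext)
  fix x x'
  show "gram_kernel I (\<lambda>i. T i \<xi>) x x' = gram_kernel J (\<lambda>j. R j \<xi>) x x'"
  proof (cases "x \<in> S \<and> x' \<in> S")
    case True
    have step: "((\<lambda>y. (\<Sum>i\<in>I. T i (ket y) x * c i) * \<xi> y) has_sum (\<Sum>i\<in>I. T i \<xi> x * c i)) S"
      if T: "\<And>i. i \<in> I \<Longrightarrow> bounded_op S (T i)" for I c x and T :: "'k \<Rightarrow> 'a oper"
    proof -
      have "((\<lambda>y. \<Sum>i\<in>I. T i (ket y) x * \<xi> y * c i) has_sum (\<Sum>i\<in>I. T i \<xi> x * c i)) S"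
        using T \<xi> by (intro has_sum_sum has_sum_cmult_left bounded_op_has_sum)
      then show ?thesis by (simp add: sum_distrib_left sum_distrib_right mult_ac)
    qed
    have 1: "(\<Sum>i\<in>I. T i \<xi> x * cnj (T i (ket y') x')) = (\<Sum>j\<in>J. R j \<xi> x * cnj (R j (ket y') x'))"
      if y': "y' \<in> S" for y'
    proof (rule has_sum_unique[OF step[OF T]])
      show "((\<lambda>y. (\<Sum>i\<in>I. T i (ket y) x * cnj (T i (ket y') x')) * \<xi> y) has_sum (\<Sum>j\<in>J. R j \<xi> x * cnj (R j (ket y') x'))) S"
        by (rule has_sum_cong[THEN iffD2, OF _ step[of J R, OF R]]) (use True y' eq in auto)
    qed
    have "(\<Sum>i\<in>I. T i \<xi> x' * cnj (T i \<xi> x)) = (\<Sum>j\<in>J. R j \<xi> x' * cnj (R j \<xi> x))"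
    proof (rule has_sum_unique[OF step[OF T]])
      have "(\<Sum>i\<in>I. T i (ket y) x' * cnj (T i \<xi> x)) = (\<Sum>j\<in>J. R j (ket y) x' * cnj (R j \<xi> x))" if "y \<in> S" for y
        using arg_cong[OF 1[OF that], of cnj] by (simp add: mult.commute)
      then show "((\<lambda>y. (\<Sum>i\<in>I. T i (ket y) x' * cnj (T i \<xi> x)) * \<xi> y) has_sum (\<Sum>j\<in>J. R j \<xi> x' * cnj (R j \<xi> x))) S"
        by (intro has_sum_cong[THEN iffD2, OF _ step[of J R, OF R]]) auto
    qed
    from arg_cong[OF this, of cnj] show ?thesis by (simp add: gram_kernel_def mult.commute)
  next
    case False
    then have "\<forall>i\<in>I. T i \<xi> x * cnj (T i \<xi> x') = 0" "\<forall>j\<in>J. R j \<xi> x * cnj (R j \<xi> x') = 0"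
      using ell2_outside[OF bounded_opD(1)[OF T \<xi>]] ell2_outside[OF bounded_opD(1)[OF R \<xi>]] by auto
    then show ?thesis by (simp only: gram_kernel_def sum.neutral)
  qed
qed

text \<open>Hence the tensor power does not depend on the Kraus representation: on pure states the output
  depends only on products of entries of the matrices above, one for each factor.\<close>

lemma tensor_power_output:
  fixes B :: "'i \<Rightarrow> 'a oper"
  assumes ex: "\<exists>M A. kraus_rep S \<Phi> M A"
    and I: "finite I" and B: "\<And>i. i \<in> I \<Longrightarrow> bounded_op S (B i)"
    and out: "\<And>\<xi> f. \<xi> \<in> ell2 S \<Longrightarrow> f \<in> ell2 S \<Longrightarrow> \<Phi> (proj S \<xi>) f = mixture S I (\<lambda>i. B i \<xi>) f"
    and \<xi>: "\<xi> \<in> ell2 (tuples S k)" and f: "f \<in> ell2 (tuples S k)"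
  shows "tensor_power S k \<Phi> (proj (tuples S k) \<xi>) f
    = mixture (tuples S k) (tuples I k) (\<lambda>i. tensor_op S k (\<lambda>j. B (i j)) \<xi>) f"
proof -
  obtain M A where MA: "(SOME (M, A). kraus_rep S \<Phi> M A) = (M, A)" by (rule prod.exhaust)
  have "\<exists>p. case p of (M, A) \<Rightarrow> kraus_rep S \<Phi> M A" using ex by simp
  then have "case (SOME (M, A). kraus_rep S \<Phi> M A) of (M, A) \<Rightarrow> kraus_rep S \<Phi> M A"
    by (rule someI_ex)
  then have K: "kraus_rep S \<Phi> M A" by (simp add: MA)
  then have A: "bounded_op S (A i)" if "i \<in> {1..M}" for i
    using that by (simp add: kraus_rep_def)
  have TA: "bounded_op (tuples S k) (tensor_op S k (\<lambda>j. A (i j)))" if "i \<in> tuples {1..M} k" for i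
    using that by (intro bounded_op_tensor_op A) (auto simp: tuples_def)
  have TB: "bounded_op (tuples S k) (tensor_op S k (\<lambda>j. B (i j)))" if "i \<in> tuples I k" for i
    using that by (intro bounded_op_tensor_op B) (auto simp: tuples_def)
  have "tensor_power S k \<Phi> (proj (tuples S k) \<xi>) f
      = mixture (tuples S k) (tuples {1..M} k) (\<lambda>i. tensor_op S k (\<lambda>j. A (i j)) \<xi>) f"
    unfolding tensor_power_def MA mixture_def
    by (simp add: sum_apply Let_def conjugate_proj[OF TA \<xi> f])
  also have "\<dots> = mixture (tuples S k) (tuples I k) (\<lambda>i. tensor_op S k (\<lambda>j. B (i j)) \<xi>) f"
  proof (rule mixture_cong[OF _ _ _ f])
    show "gram_kernel (tuples {1..M} k) (\<lambda>i. tensor_op S k (\<lambda>j. A (i j)) \<xi>)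
        = gram_kernel (tuples I k) (\<lambda>i. tensor_op S k (\<lambda>j. B (i j)) \<xi>)"
    proof (rule gram_kernel_cong_ket[OF TA TB _ \<xi>])
      fix x x' y y' assume xy: "x \<in> tuples S k" "x' \<in> tuples S k" "y \<in> tuples S k" "y' \<in> tuples S k"
      have prod: "(\<Sum>i\<in>tuples J k. tensor_op S k (\<lambda>j. D (i j)) (ket y) x * cnj (tensor_op S k (\<lambda>j. D (i j)) (ket y') x'))
          = (\<Prod>j=1..k. \<Sum>i\<in>J. D i (ket (y j)) (x j) * cnj (D i (ket (y' j)) (x' j)))"
        if "finite J" for J and D :: "'k \<Rightarrow> 'a oper"
        using xy that by (simp add: tensor_op_ket prod_sum_PiE tuples_def[of J] flip: prod.distrib)
      show "(\<Sum>i\<in>tuples {1..M} k. tensor_op S k (\<lambda>j. A (i j)) (ket y) x * cnj (tensor_op S k (\<lambda>j. A (i j)) (ket y') x'))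
          = (\<Sum>i\<in>tuples I k. tensor_op S k (\<lambda>j. B (i j)) (ket y) x * cnj (tensor_op S k (\<lambda>j. B (i j)) (ket y') x'))"
        unfolding prod[OF finite_atLeastAtMost] prod[OF I]
      proof (intro prod.cong refl kraus_polarization[OF A B])
        fix \<xi> f assume "\<xi> \<in> ell2 S" "f \<in> ell2 S"
        then show "mixture S {1..M} (\<lambda>i. A i \<xi>) f = mixture S I (\<lambda>j. B j \<xi>) f"
          using kraus_rep_output[OF K] out by simp
      qed (use xy in \<open>auto simp: tuples_def intro!: ket_ell2\<close>)
    qed
  qed (use TA TB \<xi> in \<open>auto intro: bounded_opD(1)\<close>)
  finally show ?thesis .
qed

section \<open>Subadditive sequences\<close>

text \<open>Fekete's lemma: writing \<open>n = q m + r\<close> gives \<open>a n / n \<le> a m / m + O(1 / n)\<close> for every \<open>m\<close>.\<close>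

lemma subadditive_convergent:
  fixes a :: "nat \<Rightarrow> real"
  assumes sub: "\<And>m n. a (m + n) \<le> a m + a n" and nn: "\<And>n. 0 \<le> a n"
  obtains L where "(\<lambda>n. a n / n) \<longlonglongrightarrow> L" "L \<le> a 1"
proof -
  define R where "R = (\<lambda>n. a n / n) ` {1..}"
  define L where "L = Inf R"
  have bdd: "bdd_below R" unfolding R_def by (rule bdd_belowI[of _ 0]) (auto simp: nn)
  have ne: "R \<noteq> {}" by (auto simp: R_def)
  have L_le: "L \<le> a n / n" if "n \<ge> 1" for n
    unfolding L_def using that by (intro cInf_lower bdd) (auto simp: R_def)
  have mult: "a (q * m + r) \<le> q * a m + a r" for q m r
  proof (induction q)
    case (Suc q)
    have "a (Suc q * m + r) \<le> a m + a (q * m + r)" using sub[of m "q * m + r"] by (simp add: add.assoc)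
    then show ?case using Suc by (simp add: algebra_simps)
  qed simp
  have "(\<lambda>n. a n / n) \<longlonglongrightarrow> L"
  proof (rule LIMSEQ_I)
    fix \<epsilon> :: real assume \<epsilon>: "\<epsilon> > 0"
    obtain x where "x \<in> R" "x < L + \<epsilon> / 2"
      using cInf_lessD[OF ne, of "L + \<epsilon> / 2"] \<epsilon> by (auto simp: L_def)
    then obtain m where m: "m \<ge> 1" "a m / m < L + \<epsilon> / 2" by (auto simp: R_def)
    define C where "C = Max (a ` {..<m})"
    have C: "a r \<le> C" if "r < m" for r unfolding C_def using that by (intro Max_ge) auto
    have C0: "C \<ge> 0" using C[of 0] nn[of 0] m by simp
    obtain n0 :: nat where n0: "n0 > 2 * C / \<epsilon>" using reals_Archimedean2 by blast
    show "\<exists>no. \<forall>n\<ge>no. norm (a n / n - L) < \<epsilon>"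
    proof (intro exI allI impI)
      fix n assume n: "n \<ge> max 1 n0"
      then have n1: "real n > 0" "n \<ge> 1" by auto
      have "a n \<le> (n div m) * a m + a (n mod m)" using mult[of "n div m" m "n mod m"] by simp
      also have "\<dots> \<le> real n / m * a m + C"
        using m nn[of m] C[of "n mod m"]
        by (intro add_mono mult_right_mono) (simp_all add: of_nat_div_le_of_nat)
      finally have "a n / n \<le> (real n / m * a m + C) / n" using n1 by (simp add: divide_right_mono)
      also have "\<dots> = a m / m + C / n" using n1 by (simp add: field_simps)
      also have "C / n < \<epsilon> / 2"
      proof -
        have "2 * C / \<epsilon> < n" using n0 n by linarith
        then show ?thesis using \<epsilon> n1 by (simp add: field_simps)
      qed
      finally have "a n / n < L + \<epsilon>" using m by linarith
      moreover have "L \<le> a n / n" using L_le n1 by blast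
      ultimately show "norm (a n / n - L) < \<epsilon>" by simp
    qed
  qed
  then show thesis using L_le[of 1] that by simp
qed

section \<open>Channels given by permutations of the standard basis\<close>

lemma finite_tuples: "finite A \<Longrightarrow> finite (tuples A k)"
  by (simp add: tuples_def finite_PiE)

lemma card_tuples: "finite A \<Longrightarrow> card (tuples A k) = card A ^ k"
  by (simp add: tuples_def card_PiE)

definition tuple_map :: "nat \<Rightarrow> ('i \<Rightarrow> 'a \<Rightarrow> 'a) \<Rightarrow> (nat \<Rightarrow> 'i) \<Rightarrow> (nat \<Rightarrow> 'a) \<Rightarrow> nat \<Rightarrow> 'a" where
  "tuple_map k \<pi> i x = (\<lambda>j\<in>{1..k}. \<pi> (i j) (x j))"

definition take_tuple :: "nat \<Rightarrow> (nat \<Rightarrow> 'a) \<Rightarrow> nat \<Rightarrow> 'a" where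
  "take_tuple k x = restrict x {1..k}"

definition drop_tuple :: "nat \<Rightarrow> nat \<Rightarrow> (nat \<Rightarrow> 'a) \<Rightarrow> nat \<Rightarrow> 'a" where
  "drop_tuple k l x = (\<lambda>j\<in>{1..l}. x (k + j))"

lemma tuplesI: "(\<And>j. j \<in> {1..k} \<Longrightarrow> x j \<in> A) \<Longrightarrow> (\<And>j. j \<notin> {1..k} \<Longrightarrow> x j = undefined) \<Longrightarrow> x \<in> tuples A k"
  unfolding tuples_def by (rule PiE_I)

lemma tuplesD: "x \<in> tuples A k \<Longrightarrow> j \<in> {1..k} \<Longrightarrow> x j \<in> A"
  unfolding tuples_def by (rule PiE_mem)

lemma tuples_undefined: "x \<in> tuples A k \<Longrightarrow> j \<notin> {1..k} \<Longrightarrow> x j = undefined"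
  unfolding tuples_def by (rule PiE_arb)

lemma bij_betw_split_tuples:
  "bij_betw (\<lambda>x. (take_tuple k x, drop_tuple k l x)) (tuples A (k + l)) (tuples A k \<times> tuples A l)"
proof (rule bij_betw_byWitness[where f' = "\<lambda>(x, y). \<lambda>j\<in>{1..k + l}. if j \<le> k then x j else y (j - k)"])
  have "(\<lambda>j\<in>{1..k + l}. if j \<le> k then take_tuple k x j else drop_tuple k l x (j - k)) = x"
    if "x \<in> tuples A (k + l)" for x
    using tuples_undefined[OF that] by (intro ext) (auto simp: take_tuple_def drop_tuple_def)
  then show "\<forall>x\<in>tuples A (k + l). (case (take_tuple k x, drop_tuple k l x) of
      (x, y) \<Rightarrow> \<lambda>j\<in>{1..k + l}. if j \<le> k then x j else y (j - k)) = x" by simp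
  have "take_tuple k (\<lambda>j\<in>{1..k + l}. if j \<le> k then x j else y (j - k)) = x" if "x \<in> tuples A k" for x y
    using tuples_undefined[OF that] by (intro ext) (auto simp: take_tuple_def)
  moreover have "drop_tuple k l (\<lambda>j\<in>{1..k + l}. if j \<le> k then x j else y (j - k)) = y" if "y \<in> tuples A l" for x y
    using tuples_undefined[OF that] by (intro ext) (auto simp: drop_tuple_def)
  ultimately show "\<forall>p\<in>tuples A k \<times> tuples A l.
      (take_tuple k (case p of (x, y) \<Rightarrow> \<lambda>j\<in>{1..k + l}. if j \<le> k then x j else y (j - k)),
       drop_tuple k l (case p of (x, y) \<Rightarrow> \<lambda>j\<in>{1..k + l}. if j \<le> k then x j else y (j - k))) = p"
    by (simp add: case_prod_beta)
  show "(\<lambda>x. (take_tuple k x, drop_tuple k l x)) ` tuples A (k + l) \<subseteq> tuples A k \<times> tuples A l"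
  proof (rule image_subsetI)
    fix x assume x: "x \<in> tuples A (k + l)"
    have "take_tuple k x \<in> tuples A k"
      using tuplesD[OF x] by (intro tuplesI) (auto simp: take_tuple_def)
    moreover have "drop_tuple k l x \<in> tuples A l"
      using tuplesD[OF x] by (intro tuplesI) (auto simp: drop_tuple_def)
    ultimately show "(take_tuple k x, drop_tuple k l x) \<in> tuples A k \<times> tuples A l" by simp
  qed
  show "(\<lambda>(x, y). \<lambda>j\<in>{1..k + l}. if j \<le> k then x j else y (j - k)) ` (tuples A k \<times> tuples A l) \<subseteq> tuples A (k + l)"
  proof (rule image_subsetI)
    fix p assume "p \<in> tuples A k \<times> tuples A l"
    then have p: "fst p \<in> tuples A k" "snd p \<in> tuples A l" by auto
    show "(\<lambda>(x, y). \<lambda>j\<in>{1..k + l}. if j \<le> k then x j else y (j - k)) p \<in> tuples A (k + l)"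
    proof (intro tuplesI)
      fix j assume j: "j \<in> {1..k + l}"
      then have "j - k \<in> {1..l}" if "\<not> j \<le> k" using that by auto
      then show "(\<lambda>(x, y). \<lambda>j\<in>{1..k + l}. if j \<le> k then x j else y (j - k)) p j \<in> A"
        using tuplesD[OF p(1), of j] tuplesD[OF p(2), of "j - k"] j by (auto simp: case_prod_beta)
    qed (auto simp: case_prod_beta)
  qed
qed

lemma take_tuple_tuple_map: "take_tuple k (tuple_map (k + l) \<pi> i x) = tuple_map k \<pi> (take_tuple k i) (take_tuple k x)"
  by (rule ext) (auto simp: take_tuple_def tuple_map_def)

lemma drop_tuple_tuple_map: "drop_tuple k l (tuple_map (k + l) \<pi> i x) = tuple_map l \<pi> (drop_tuple k l i) (drop_tuple k l x)"
  by (rule ext) (auto simp: drop_tuple_def tuple_map_def)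

lemma bij_betw_tuple_map:
  assumes "\<And>i. i \<in> I \<Longrightarrow> bij_betw (\<pi> i) S S" "i \<in> tuples I k"
  shows "bij_betw (tuple_map k \<pi> i) (tuples S k) (tuples S k)"
proof (rule bij_betw_byWitness[where f' = "tuple_map k (\<lambda>i. inv_into S (\<pi> i)) i"])
  have b: "bij_betw (\<pi> (i j)) S S" if "j \<in> {1..k}" for j
    using assms tuplesD that by metis
  have b': "bij_betw (inv_into S (\<pi> (i j))) S S" if "j \<in> {1..k}" for j
    using b[OF that] by (rule bij_betw_inv_into)
  show "\<forall>x\<in>tuples S k. tuple_map k (\<lambda>i. inv_into S (\<pi> i)) i (tuple_map k \<pi> i x) = x"
  proof (intro ballI ext)
    fix x j assume x: "x \<in> tuples S k"
    show "tuple_map k (\<lambda>i. inv_into S (\<pi> i)) i (tuple_map k \<pi> i x) j = x j"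
      using bij_betw_inv_into_left[OF b tuplesD[OF x]] tuples_undefined[OF x, of j]
      by (cases "j \<in> {1..k}") (simp_all add: tuple_map_def del: atLeastAtMost_iff)
  qed
  show "\<forall>x\<in>tuples S k. tuple_map k \<pi> i (tuple_map k (\<lambda>i. inv_into S (\<pi> i)) i x) = x"
  proof (intro ballI ext)
    fix x j assume x: "x \<in> tuples S k"
    show "tuple_map k \<pi> i (tuple_map k (\<lambda>i. inv_into S (\<pi> i)) i x) j = x j"
      using bij_betw_inv_into_right[OF b tuplesD[OF x]] tuples_undefined[OF x, of j]
      by (cases "j \<in> {1..k}") (simp_all add: tuple_map_def del: atLeastAtMost_iff)
  qed
  show "tuple_map k \<pi> i ` tuples S k \<subseteq> tuples S k"
  proof (intro image_subsetI tuplesI)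
    fix x j assume "x \<in> tuples S k" "j \<in> {1..k}"
    then show "tuple_map k \<pi> i x j \<in> S"
      using bij_betwE[OF b[of j]] tuplesD[of x S k j] by (simp add: tuple_map_def)
  qed (auto simp: tuple_map_def)
  show "tuple_map k (\<lambda>i. inv_into S (\<pi> i)) i ` tuples S k \<subseteq> tuples S k"
  proof (intro image_subsetI tuplesI)
    fix x j assume "x \<in> tuples S k" "j \<in> {1..k}"
    then show "tuple_map k (\<lambda>i. inv_into S (\<pi> i)) i x j \<in> S"
      using bij_betwE[OF b'[of j]] tuplesD[of x S k j] by (simp add: tuple_map_def)
  qed (auto simp: tuple_map_def)
qed

text \<open>Row \<open>x\<close> of the matrix of the tensor product has its only nonzero entry at \<open>tuple_map k \<pi> i x\<close>.\<close>

lemma tensor_op_subst_op: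
  assumes "\<And>i. i \<in> I \<Longrightarrow> bij_betw (\<pi> i) S S" and i: "i \<in> tuples I k"
  shows "tensor_op S k (\<lambda>j. op_scale c (subst_op S (\<pi> (i j)))) f
    = cscale (c ^ k) (subst_op (tuples S k) (tuple_map k \<pi> i) f)"
proof
  fix x
  show "tensor_op S k (\<lambda>j. op_scale c (subst_op S (\<pi> (i j)))) f x
      = cscale (c ^ k) (subst_op (tuples S k) (tuple_map k \<pi> i) f) x"
  proof (cases "x \<in> tuples S k")
    case x: True
    define y0 where "y0 = tuple_map k \<pi> i x"
    have y0: "y0 \<in> tuples S k"
      unfolding y0_def by (rule bij_betw_apply[OF bij_betw_tuple_map[OF assms] x])
    have xS: "x j \<in> S" if "j \<in> {1..k}" for j using tuplesD[OF x that] .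
    have K: "op_scale c (subst_op S (\<pi> (i j))) (ket (y j)) (x j) = c * (if y0 j = y j then 1 else 0)"
      if "j \<in> {1..k}" for j y
      using that xS[OF that] by (auto simp: op_scale_def cscale_def subst_op_def ket_def y0_def tuple_map_def)
    have "(\<Prod>j=1..k. op_scale c (subst_op S (\<pi> (i j))) (ket (y j)) (x j)) = 0"
      if y: "y \<in> tuples S k - {y0}" for y
    proof -
      obtain j where "j \<in> {1..k}" "y0 j \<noteq> y j"
        using y y0 PiE_ext[of y0 "{1..k}" "\<lambda>_. S" y] unfolding tuples_def by (metis DiffD1 DiffD2 singletonI)
      then show ?thesis by (intro prod_zero) (auto simp: K)
    qed
    then have "(\<Sum>\<^sub>\<infinity>y\<in>tuples S k. (\<Prod>j=1..k. op_scale c (subst_op S (\<pi> (i j))) (ket (y j)) (x j)) * f y)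
        = (\<Sum>\<^sub>\<infinity>y\<in>{y0}. (\<Prod>j=1..k. op_scale c (subst_op S (\<pi> (i j))) (ket (y j)) (x j)) * f y)"
      using y0 by (intro infsum_cong_neutral) auto
    also have "\<dots> = c ^ k * f y0" by (simp add: K)
    finally show ?thesis using x by (simp add: tensor_op_def cscale_def subst_op_def y0_def)
  next
    case False
    then show ?thesis by (simp add: tensor_op_def cscale_def subst_op_def)
  qed
qed

text \<open>The channel is the average of conjugations by permutation operators. These are indexed by an arbitrary
  finite set and not by an initial segment of the natural numbers, so that pairs of indices can serve for the composition of two such channels.\<close>

locale permutation_channel =
  fixes S :: "'a set" and \<Phi> :: "'a oper \<Rightarrow> 'a oper" and I :: "'i set" and \<pi> :: "'i \<Rightarrow> 'a \<Rightarrow> 'a"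
  assumes S: "S \<noteq> {}" and I: "finite I" "I \<noteq> {}"
    and perm_bij: "\<And>i. i \<in> I \<Longrightarrow> bij_betw (\<pi> i) S S"
    and kraus: "\<exists>M A. kraus_rep S \<Phi> M A"
    and out: "\<And>\<xi> f. \<xi> \<in> ell2 S \<Longrightarrow> f \<in> ell2 S \<Longrightarrow> \<Phi> (proj S \<xi>) f
      = mixture S I (\<lambda>i. op_scale (complex_of_real (1 / sqrt (card I))) (subst_op S (\<pi> i)) \<xi>) f"
begin

text \<open>The Kraus operator with index \<open>i\<close> of the \<open>k\<close>-fold tensor power, applied to \<open>\<xi>\<close>.\<close>

definition branch :: "nat \<Rightarrow> (nat \<Rightarrow> 'a) vec \<Rightarrow> (nat \<Rightarrow> 'i) \<Rightarrow> (nat \<Rightarrow> 'a) vec" where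
  "branch k \<xi> i = cscale (complex_of_real (1 / sqrt (card I)) ^ k) (subst_op (tuples S k) (tuple_map k \<pi> i) \<xi>)"

definition output_entropy :: "nat \<Rightarrow> (nat \<Rightarrow> 'a) vec \<Rightarrow> ereal" where
  "output_entropy k \<xi> = vn_entropy (tuples S k) (tensor_power S k \<Phi> (proj (tuples S k) \<xi>))"

lemma card_I: "real (card I) > 0" using I by (simp add: card_gt_0_iff)

lemma branch_ell2: "\<xi> \<in> ell2 (tuples S k) \<Longrightarrow> i \<in> tuples I k \<Longrightarrow> branch k \<xi> i \<in> ell2 (tuples S k)"
  unfolding branch_def by (intro cscale_ell2 subst_op_ell2 bij_betw_tuple_map[of I] perm_bij)

lemma tensor_power_branches:
  assumes "\<xi> \<in> ell2 (tuples S k)" "f \<in> ell2 (tuples S k)"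
  shows "tensor_power S k \<Phi> (proj (tuples S k) \<xi>) f = mixture (tuples S k) (tuples I k) (branch k \<xi>) f"
proof -
  let ?B = "\<lambda>i. op_scale (complex_of_real (1 / sqrt (card I))) (subst_op S (\<pi> i))"
  have "tensor_power S k \<Phi> (proj (tuples S k) \<xi>) f
      = mixture (tuples S k) (tuples I k) (\<lambda>i. tensor_op S k (\<lambda>j. ?B (i j)) \<xi>) f"
    by (rule tensor_power_output[OF kraus I(1) bounded_op_subst_op[OF perm_bij] out assms])
  also have "\<dots> = mixture (tuples S k) (tuples I k) (branch k \<xi>) f"
    unfolding mixture_def by (intro sum.cong refl) (simp add: tensor_op_subst_op[of I \<pi> S, OF perm_bij] branch_def)
  finally show ?thesis .
qed

lemma ell2_norm_branch:
  assumes "i \<in> tuples I k"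
  shows "(ell2_norm (tuples S k) (branch k \<xi> i))\<^sup>2 = (1 / card I) ^ k * (ell2_norm (tuples S k) \<xi>)\<^sup>2"
proof -
  have "(cmod (complex_of_real (1 / sqrt (card I)) ^ k))\<^sup>2 = ((1 / sqrt (card I))\<^sup>2) ^ k"
    by (simp add: norm_power norm_divide power_mult[symmetric] mult.commute)
  also have "\<dots> = (1 / card I) ^ k" by (simp add: power_divide)
  finally show ?thesis
    unfolding branch_def ell2_norm_cscale power_mult_distrib
    by (simp add: ell2_norm_subst_op[OF bij_betw_tuple_map[OF perm_bij assms]])
qed

lemma sum_ell2_norm_branch:
  assumes "ell2_norm (tuples S k) \<xi> = 1"
  shows "(\<Sum>i\<in>tuples I k. (ell2_norm (tuples S k) (branch k \<xi> i))\<^sup>2) = 1"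
  using assms card_I I by (simp add: ell2_norm_branch card_tuples power_divide)

lemma output_entropy_finite:
  assumes "\<xi> \<in> ell2 (tuples S k)" "ell2_norm (tuples S k) \<xi> = 1"
  obtains h where "h \<ge> 0" "output_entropy k \<xi> = ereal h"
  unfolding output_entropy_def
  using vn_entropy_mixture_finite[of "tuples I k" "branch k \<xi>" "tuples S k" "tensor_power S k \<Phi> (proj (tuples S k) \<xi>)"]
    finite_tuples[OF I(1)] branch_ell2 sum_ell2_norm_branch tensor_power_branches assms by blast

text \<open>A product input gives a product output: cutting index tuples and basis tuples after position \<open>k\<close>
  turns the branches of \<open>\<xi> \<otimes> \<eta>\<close> into tensor products of branches.\<close>

lemma output_entropy_tens:
  assumes \<xi>: "\<xi> \<in> ell2 (tuples S k)" "ell2_norm (tuples S k) \<xi> = 1"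
    and \<eta>: "\<eta> \<in> ell2 (tuples S l)" "ell2_norm (tuples S l) \<eta> = 1"
  obtains \<zeta> where "\<zeta> \<in> ell2 (tuples S (k + l))" "ell2_norm (tuples S (k + l)) \<zeta> = 1"
    "output_entropy (k + l) \<zeta> = output_entropy k \<xi> + output_entropy l \<eta>"
proof -
  interpret product_split "tuples S (k + l)" "take_tuple k" "drop_tuple k l" "tuples S k" "tuples S l"
    by unfold_locales (rule bij_betw_split_tuples)
  define tn where "tn = tens (tuples S (k + l)) (take_tuple k) (drop_tuple k l) \<xi> \<eta>"
  have tn: "tn \<in> ell2 (tuples S (k + l))" unfolding tn_def by (rule tens_ell2[OF \<xi>(1) \<eta>(1)])
  have "(ell2_norm (tuples S (k + l)) tn)\<^sup>2 = 1"
    unfolding tn_def by (simp add: ell2_norm_tens \<xi> \<eta>)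
  then have tn1: "ell2_norm (tuples S (k + l)) tn = 1"
    using ell2_norm_nonneg[of "tuples S (k + l)" tn] by (simp add: power2_eq_1_iff)
  have "output_entropy (k + l) tn = output_entropy k \<xi> + output_entropy l \<eta>"
    unfolding output_entropy_def
  proof (rule vn_entropy_tens[where I = "tuples I k" and v = "branch k \<xi>" and J = "tuples I l" and w = "branch l \<eta>"])
    fix f assume f: "f \<in> ell2 (tuples S (k + l))"
    let ?t = "\<lambda>(i, j). tens (tuples S (k + l)) (take_tuple k) (drop_tuple k l) (branch k \<xi> i) (branch l \<eta> j)"
    have br: "branch (k + l) tn i = ?t (take_tuple k i, drop_tuple k l i)" if i: "i \<in> tuples I (k + l)" for i
    proof
      fix z
      show "branch (k + l) tn i z = ?t (take_tuple k i, drop_tuple k l i) z"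
      proof (cases "z \<in> tuples S (k + l)")
        case True
        then have "tuple_map (k + l) \<pi> i z \<in> tuples S (k + l)" "take_tuple k z \<in> tuples S k" "drop_tuple k l z \<in> tuples S l"
          using bij_betw_apply[OF bij_betw_tuple_map[OF perm_bij i]] bij_betw_apply[OF bij_betw_split_tuples[of k l S]]
          by auto
        then show ?thesis
          using True by (simp add: branch_def cscale_def subst_op_def tn_def tens_def
              take_tuple_tuple_map drop_tuple_tuple_map power_add)
      next
        case False
        then show ?thesis by (simp add: branch_def cscale_def subst_op_def tens_def)
      qed
    qed
    have "tensor_power S (k + l) \<Phi> (proj (tuples S (k + l)) tn) f
        = (\<Sum>i\<in>tuples I (k + l). cscale (cinner (tuples S (k + l)) (?t (take_tuple k i, drop_tuple k l i)) f) (?t (take_tuple k i, drop_tuple k l i)))"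
      unfolding tensor_power_branches[OF tn f] mixture_def by (intro sum.cong refl) (simp only: br)
    also have "\<dots> = (\<Sum>p\<in>tuples I k \<times> tuples I l. cscale (cinner (tuples S (k + l)) (?t p) f) (?t p))"
      by (rule sum.reindex_bij_betw[OF bij_betw_split_tuples])
    finally show "tensor_power S (k + l) \<Phi> (proj (tuples S (k + l)) tn) f
        = mixture (tuples S (k + l)) (tuples I k \<times> tuples I l) ?t f"
      by (simp only: mixture_def)
  qed (use \<xi> \<eta> in \<open>simp_all add: finite_tuples I branch_ell2 sum_ell2_norm_branch tensor_power_branches\<close>)
  then show thesis using tn tn1 that by blast
qed

lemma ell2_norm_ket: "x \<in> X \<Longrightarrow> ell2_norm X (ket x) = 1"
proof -
  assume x: "x \<in> X"
  have "complex_of_real ((ell2_norm X (ket x))\<^sup>2) = 1"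
    unfolding cinner_self[OF ket_ell2[OF x], symmetric] cinner_ket_right[OF x] by (simp add: ket_def)
  then show ?thesis
    using ell2_norm_nonneg[of X "ket x"] by (simp only: of_real_eq_1_iff power2_eq_1_iff) linarith
qed

lemma tuples_nonempty: "tuples S k \<noteq> {}"
  using S by (simp add: tuples_def PiE_eq_empty_iff)

text \<open>The minimum output entropies are finite and subadditive in \<open>k\<close>, so their averages converge.\<close>

lemma regularized_moe_limit:
  obtains a :: "nat \<Rightarrow> real" and L where "\<And>k. moe (tuples S k) (tensor_power S k \<Phi>) = ereal (a k)"
    "(\<lambda>k. a k / k) \<longlonglongrightarrow> L" "regularized_moe S \<Phi> = ereal L" "L \<le> a 1"
proof -
  define W where "W k = {\<xi> \<in> ell2 (tuples S k). ell2_norm (tuples S k) \<xi> = 1}" for k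
  have moe: "moe (tuples S k) (tensor_power S k \<Phi>) = (INF \<xi>\<in>W k. output_entropy k \<xi>)" for k
    by (simp add: moe_def W_def output_entropy_def)
  have W: "W k \<noteq> {}" for k
    using tuples_nonempty[of k] ket_ell2 ell2_norm_ket by (fastforce simp: W_def)
  have fin: "\<exists>h\<ge>0. output_entropy k \<xi> = ereal h" if "\<xi> \<in> W k" for k \<xi>
    using that output_entropy_finite unfolding W_def by blast
  have "\<exists>m\<ge>0. moe (tuples S k) (tensor_power S k \<Phi>) = ereal m" for k
  proof -
    obtain \<xi> where \<xi>: "\<xi> \<in> W k" using W by blast
    obtain h where h: "output_entropy k \<xi> = ereal h" using fin[OF \<xi>] by blast
    have "moe (tuples S k) (tensor_power S k \<Phi>) \<le> ereal h"
      unfolding moe h[symmetric] using \<xi> by (rule INF_lower)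
    moreover have "0 \<le> moe (tuples S k) (tensor_power S k \<Phi>)"
      unfolding moe using fin by (intro INF_greatest) force
    ultimately show ?thesis
      by (cases "moe (tuples S k) (tensor_power S k \<Phi>)") auto
  qed
  then obtain a where a: "\<And>k. 0 \<le> a k" "\<And>k. moe (tuples S k) (tensor_power S k \<Phi>) = ereal (a k)"
    by metis
  have near: "\<exists>\<xi>\<in>W k. output_entropy k \<xi> < ereal (a k + \<epsilon>)" if "\<epsilon> > 0" for k \<epsilon>
  proof -
    have "(INF \<xi>\<in>W k. output_entropy k \<xi>) < ereal (a k + \<epsilon>)"
      using that by (simp add: a(2) flip: moe)
    then show ?thesis by (simp add: INF_less_iff)
  qed
  have sub: "a (k + l) \<le> a k + a l" for k l
  proof (rule field_le_epsilon)
    fix \<epsilon> :: real assume \<epsilon>: "\<epsilon> > 0"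
    obtain \<xi> where \<xi>: "\<xi> \<in> W k" "output_entropy k \<xi> < ereal (a k + \<epsilon> / 2)" using near[of "\<epsilon> / 2"] \<epsilon> by auto
    obtain \<eta> where \<eta>: "\<eta> \<in> W l" "output_entropy l \<eta> < ereal (a l + \<epsilon> / 2)" using near[of "\<epsilon> / 2"] \<epsilon> by auto
    obtain \<zeta> where \<zeta>: "\<zeta> \<in> W (k + l)" "output_entropy (k + l) \<zeta> = output_entropy k \<xi> + output_entropy l \<eta>"
      using output_entropy_tens[of \<xi> k \<eta> l] \<xi>(1) \<eta>(1) unfolding W_def by blast
    have "ereal (a (k + l)) \<le> output_entropy (k + l) \<zeta>"
      unfolding a(2)[symmetric] moe using \<zeta>(1) by (rule INF_lower)
    also have "\<dots> \<le> ereal (a k + \<epsilon> / 2) + ereal (a l + \<epsilon> / 2)"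
      unfolding \<zeta>(2) using \<xi>(2) \<eta>(2) by (intro add_mono less_imp_le)
    finally show "a (k + l) \<le> a k + a l + \<epsilon>" by simp
  qed
  obtain L where L: "(\<lambda>k. a k / k) \<longlonglongrightarrow> L" "L \<le> a 1"
    using subadditive_convergent[of a, OF sub a(1)] by blast
  have "(\<lambda>k. ereal (1 / real k) * moe (tuples S k) (tensor_power S k \<Phi>)) = (\<lambda>k. ereal (a k / k))"
    by (simp add: a(2))
  then have "regularized_moe S \<Phi> = ereal L"
    unfolding regularized_moe_def using L(1) by (simp add: limI)
  then show thesis using that a(2) L by blast
qed

lemma regularized_moe_geI:
  fixes c :: real
  assumes "\<And>k \<xi>. \<xi> \<in> ell2 (tuples S k) \<Longrightarrow> ell2_norm (tuples S k) \<xi> = 1 \<Longrightarrow> ereal (k * c) \<le> output_entropy k \<xi>"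
  shows "ereal c \<le> regularized_moe S \<Phi>"
proof -
  obtain a :: "nat \<Rightarrow> real" and L where a: "\<And>k. moe (tuples S k) (tensor_power S k \<Phi>) = ereal (a k)"
    "(\<lambda>k. a k / k) \<longlonglongrightarrow> L" "regularized_moe S \<Phi> = ereal L" "L \<le> a 1"
    using regularized_moe_limit by blast
  have "ereal (k * c) \<le> ereal (a k)" for k
    unfolding a(1)[symmetric] moe_def using assms by (intro INF_greatest) (auto simp: output_entropy_def)
  then have "c \<le> a k / k" if "k \<ge> 1" for k
    using that by (simp add: le_divide_eq mult.commute)
  then have "c \<le> L" by (intro LIMSEQ_le_const[OF a(2)]) auto
  then show ?thesis by (simp add: a(3))
qed

lemma regularized_moe_le_output_entropy:
  assumes "\<xi> \<in> ell2 (tuples S 1)" "ell2_norm (tuples S 1) \<xi> = 1"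
  shows "regularized_moe S \<Phi> \<le> output_entropy 1 \<xi>"
proof -
  obtain a :: "nat \<Rightarrow> real" and L where a: "\<And>k. moe (tuples S k) (tensor_power S k \<Phi>) = ereal (a k)"
    "(\<lambda>k. a k / k) \<longlonglongrightarrow> L" "regularized_moe S \<Phi> = ereal L" "L \<le> a 1"
    using regularized_moe_limit by blast
  have "ereal L \<le> moe (tuples S 1) (tensor_power S 1 \<Phi>)" using a(1,4) by simp
  also have "\<dots> \<le> output_entropy 1 \<xi>"
    unfolding moe_def output_entropy_def using assms by (intro INF_lower) simp
  finally show ?thesis by (simp add: a(3))
qed

end

section \<open>A Haagerup type inequality for tuples of permutations\<close>

text \<open>With \<open>U\<^sub>i \<xi> = \<xi> \<circ> \<pi> i\<close> this says that the sum of \<open>\<langle>U\<^sub>i \<xi>, U\<^sub>j \<eta>\<rangle>\<^sup>2\<close> over \<open>i\<close> and \<open>j\<close> is at most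
  \<open>C \<parallel>\<xi>\<parallel>\<^sup>2 \<parallel>\<eta>\<parallel>\<^sup>2\<close> for nonnegative \<open>\<xi>\<close> and \<open>\<eta>\<close>. The inner products are truncated to a finite set \<open>F\<close>, and \<open>E\<close> contains all
  points at which \<open>\<xi>\<close> and \<open>\<eta>\<close> are then evaluated, so that no question of convergence arises in the combinatorial part.\<close>

definition collision_bound :: "'a set \<Rightarrow> 'i set \<Rightarrow> ('i \<Rightarrow> 'a \<Rightarrow> 'a) \<Rightarrow> real \<Rightarrow> bool" where
  "collision_bound S I \<pi> C \<longleftrightarrow> (\<forall>F E \<xi> \<eta>. finite F \<longrightarrow> F \<subseteq> S \<longrightarrow> finite E \<longrightarrow> E \<subseteq> S \<longrightarrow> (\<forall>i\<in>I. \<pi> i ` F \<subseteq> E) \<longrightarrow>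
     (\<forall>x. 0 \<le> \<xi> x) \<longrightarrow> (\<forall>x. 0 \<le> \<eta> x) \<longrightarrow>
     (\<Sum>i\<in>I. \<Sum>j\<in>I. (\<Sum>x\<in>F. \<xi> (\<pi> i x) * \<eta> (\<pi> j x))\<^sup>2) \<le> C * (\<Sum>x\<in>E. (\<xi> x)\<^sup>2) * (\<Sum>x\<in>E. (\<eta> x)\<^sup>2))"

lemma collision_boundD:
  assumes "collision_bound S I \<pi> C" "finite F" "F \<subseteq> S" "finite E" "E \<subseteq> S" "\<And>i. i \<in> I \<Longrightarrow> \<pi> i ` F \<subseteq> E"
    "\<And>x. 0 \<le> \<xi> x" "\<And>x. 0 \<le> \<eta> x"
  shows "(\<Sum>i\<in>I. \<Sum>j\<in>I. (\<Sum>x\<in>F. \<xi> (\<pi> i x) * \<eta> (\<pi> j x))\<^sup>2) \<le> C * (\<Sum>x\<in>E. (\<xi> x)\<^sup>2) * (\<Sum>x\<in>E. (\<eta> x)\<^sup>2)"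
  by (rule assms(1)[unfolded collision_bound_def, rule_format]) (use assms(2-) in blast)+

lemma sum_squares_triangle:
  fixes g :: "'p \<Rightarrow> 'a \<Rightarrow> real"
  shows "(\<Sum>p\<in>P. (\<Sum>a\<in>F. g p a)\<^sup>2) \<le> (\<Sum>a\<in>F. sqrt (\<Sum>p\<in>P. (g p a)\<^sup>2))\<^sup>2"
proof -
  have "L2_set (\<lambda>p. \<Sum>a\<in>F. g p a) P \<le> (\<Sum>a\<in>F. L2_set (\<lambda>p. g p a) P)"
  proof (induction F rule: infinite_finite_induct)
    case (insert b F)
    then show ?case
      using L2_set_triangle_ineq[of "\<lambda>p. g p b" "\<lambda>p. \<Sum>a\<in>F. g p a" P] by simp
  qed (simp_all add: L2_set_def)
  then have "(L2_set (\<lambda>p. \<Sum>a\<in>F. g p a) P)\<^sup>2 \<le> (\<Sum>a\<in>F. L2_set (\<lambda>p. g p a) P)\<^sup>2"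
    by (intro power_mono L2_set_nonneg)
  then show ?thesis by (simp add: L2_set_def sum_nonneg)
qed

lemma sum_tuples_Suc:
  "(\<Sum>x\<in>tuples A (Suc k). f x) = (\<Sum>a\<in>A. \<Sum>x\<in>tuples A k. f (x(Suc k := a)))"
proof -
  have "{1..Suc k} - {Suc k} = {1..k}" by auto
  then have "bij_betw (\<lambda>(z, a). z(Suc k := a)) (tuples A k \<times> A) (tuples A (Suc k))"
    using bij_betw_insert_coordinate[of "Suc k" "Suc k" A] by (simp add: tuples_def)
  then have "(\<Sum>x\<in>tuples A (Suc k). f x) = (\<Sum>p\<in>tuples A k \<times> A. f ((\<lambda>(z, a). z(Suc k := a)) p))"
    by (rule sum.reindex_bij_betw[symmetric])
  also have "\<dots> = (\<Sum>x\<in>tuples A k. \<Sum>a\<in>A. f (x(Suc k := a)))"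
    by (simp add: sum.cartesian_product case_prod_beta)
  also have "\<dots> = (\<Sum>a\<in>A. \<Sum>x\<in>tuples A k. f (x(Suc k := a)))"
    by (rule sum.swap)
  finally show ?thesis .
qed

lemma tuples_0: "tuples A 0 = {\<lambda>_. undefined}"
  by (simp add: tuples_def)

lemma tuple_map_Suc:
  "tuple_map (Suc k) \<pi> (i(Suc k := i')) (x(Suc k := a)) = (tuple_map k \<pi> i x)(Suc k := \<pi> i' a)"
  by (rule ext) (auto simp: tuple_map_def)

text \<open>The bound is multiplicative. This is where nonnegative functions pay off: for fixed last
  coordinates of the two index tuples, the triangle inequality in \<open>\<ell>\<^sup>2\<close> of the remaining index pairs
  reduces the claim to the case of one coordinate for the norms of the slices of \<open>\<xi>\<close> and \<open>\<eta>\<close>.\<close>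

lemma collision_bound_tuples:
  assumes cb: "collision_bound S I \<pi> C" and C: "0 \<le> C"
    and F: "finite F" "F \<subseteq> S" and E: "finite E" "E \<subseteq> S" and FE: "\<And>i. i \<in> I \<Longrightarrow> \<pi> i ` F \<subseteq> E"
    and nn: "\<And>x. 0 \<le> \<xi> x" "\<And>x. 0 \<le> \<eta> x"
  shows "(\<Sum>i\<in>tuples I k. \<Sum>j\<in>tuples I k. (\<Sum>x\<in>tuples F k. \<xi> (tuple_map k \<pi> i x) * \<eta> (tuple_map k \<pi> j x))\<^sup>2)
    \<le> C ^ k * (\<Sum>x\<in>tuples E k. (\<xi> x)\<^sup>2) * (\<Sum>x\<in>tuples E k. (\<eta> x)\<^sup>2)"
  using nn
proof (induction k arbitrary: \<xi> \<eta>)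
  case 0
  have "tuple_map 0 \<pi> i x = (\<lambda>_. undefined)" for i x by (simp add: tuple_map_def fun_eq_iff)
  then show ?case by (simp add: tuples_0 power_mult_distrib)
next
  case (Suc k)
  define \<xi>' where "\<xi>' b y = \<xi> (y(Suc k := b))" for b y
  define \<eta>' where "\<eta>' b y = \<eta> (y(Suc k := b))" for b y
  define \<alpha> where "\<alpha> b = sqrt (\<Sum>y\<in>tuples E k. (\<xi>' b y)\<^sup>2)" for b
  define \<beta> where "\<beta> b = sqrt (\<Sum>y\<in>tuples E k. (\<eta>' b y)\<^sup>2)" for b
  define g where "g i' j' i j a = (\<Sum>x\<in>tuples F k. \<xi>' (\<pi> i' a) (tuple_map k \<pi> i x) * \<eta>' (\<pi> j' a) (tuple_map k \<pi> j x))"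
    for i' j' i j a
  have step: "(\<Sum>i\<in>tuples I k. \<Sum>j\<in>tuples I k. (\<Sum>a\<in>F. g i' j' i j a)\<^sup>2)
      \<le> C ^ k * (\<Sum>a\<in>F. \<alpha> (\<pi> i' a) * \<beta> (\<pi> j' a))\<^sup>2" for i' j'
  proof -
    have sq: "sqrt (\<Sum>p\<in>tuples I k \<times> tuples I k. (g i' j' (fst p) (snd p) a)\<^sup>2)
        \<le> sqrt (C ^ k) * (\<alpha> (\<pi> i' a) * \<beta> (\<pi> j' a))" for a
    proof -
      have "(\<Sum>p\<in>tuples I k \<times> tuples I k. (g i' j' (fst p) (snd p) a)\<^sup>2)
          \<le> C ^ k * (\<Sum>x\<in>tuples E k. (\<xi>' (\<pi> i' a) x)\<^sup>2) * (\<Sum>x\<in>tuples E k. (\<eta>' (\<pi> j' a) x)\<^sup>2)"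
        using Suc.IH[of "\<xi>' (\<pi> i' a)" "\<eta>' (\<pi> j' a)"] Suc.prems
        by (simp add: g_def \<xi>'_def \<eta>'_def sum.cartesian_product case_prod_beta)
      then have "sqrt (\<Sum>p\<in>tuples I k \<times> tuples I k. (g i' j' (fst p) (snd p) a)\<^sup>2)
          \<le> sqrt (C ^ k * (\<Sum>x\<in>tuples E k. (\<xi>' (\<pi> i' a) x)\<^sup>2) * (\<Sum>x\<in>tuples E k. (\<eta>' (\<pi> j' a) x)\<^sup>2))"
        by (rule real_sqrt_le_mono)
      then show ?thesis by (simp add: \<alpha>_def \<beta>_def real_sqrt_mult mult.assoc)
    qed
    have "(\<Sum>i\<in>tuples I k. \<Sum>j\<in>tuples I k. (\<Sum>a\<in>F. g i' j' i j a)\<^sup>2)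
        = (\<Sum>p\<in>tuples I k \<times> tuples I k. (\<Sum>a\<in>F. g i' j' (fst p) (snd p) a)\<^sup>2)"
      by (simp add: sum.cartesian_product case_prod_beta)
    also have "\<dots> \<le> (\<Sum>a\<in>F. sqrt (\<Sum>p\<in>tuples I k \<times> tuples I k. (g i' j' (fst p) (snd p) a)\<^sup>2))\<^sup>2"
      by (rule sum_squares_triangle)
    also have "\<dots> \<le> (\<Sum>a\<in>F. sqrt (C ^ k) * (\<alpha> (\<pi> i' a) * \<beta> (\<pi> j' a)))\<^sup>2"
      by (intro power_mono sum_mono sq sum_nonneg real_sqrt_ge_zero) simp
    also have "\<dots> = C ^ k * (\<Sum>a\<in>F. \<alpha> (\<pi> i' a) * \<beta> (\<pi> j' a))\<^sup>2"
      using C by (simp add: power_mult_distrib flip: sum_distrib_left)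
    finally show ?thesis .
  qed
  have sum_\<alpha>: "(\<Sum>b\<in>E. (\<alpha> b)\<^sup>2) = (\<Sum>x\<in>tuples E (Suc k). (\<xi> x)\<^sup>2)"
    unfolding sum_tuples_Suc by (simp add: \<alpha>_def \<xi>'_def sum_nonneg)
  have sum_\<beta>: "(\<Sum>b\<in>E. (\<beta> b)\<^sup>2) = (\<Sum>x\<in>tuples E (Suc k). (\<eta> x)\<^sup>2)"
    unfolding sum_tuples_Suc by (simp add: \<beta>_def \<eta>'_def sum_nonneg)
  have "(\<Sum>i\<in>tuples I (Suc k). \<Sum>j\<in>tuples I (Suc k).
      (\<Sum>x\<in>tuples F (Suc k). \<xi> (tuple_map (Suc k) \<pi> i x) * \<eta> (tuple_map (Suc k) \<pi> j x))\<^sup>2)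
    = (\<Sum>i'\<in>I. \<Sum>i\<in>tuples I k. \<Sum>j'\<in>I. \<Sum>j\<in>tuples I k. (\<Sum>a\<in>F. g i' j' i j a)\<^sup>2)"
    unfolding sum_tuples_Suc tuple_map_Suc g_def \<xi>'_def \<eta>'_def ..
  also have "\<dots> = (\<Sum>i'\<in>I. \<Sum>j'\<in>I. \<Sum>i\<in>tuples I k. \<Sum>j\<in>tuples I k. (\<Sum>a\<in>F. g i' j' i j a)\<^sup>2)"
    by (intro sum.cong refl sum.swap)
  also have "\<dots> \<le> (\<Sum>i'\<in>I. \<Sum>j'\<in>I. C ^ k * (\<Sum>a\<in>F. \<alpha> (\<pi> i' a) * \<beta> (\<pi> j' a))\<^sup>2)"
    by (intro sum_mono step)
  also have "\<dots> = C ^ k * (\<Sum>i'\<in>I. \<Sum>j'\<in>I. (\<Sum>a\<in>F. \<alpha> (\<pi> i' a) * \<beta> (\<pi> j' a))\<^sup>2)"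
    by (simp add: sum_distrib_left)
  also have "\<dots> \<le> C ^ k * (C * (\<Sum>b\<in>E. (\<alpha> b)\<^sup>2) * (\<Sum>b\<in>E. (\<beta> b)\<^sup>2))"
    using C by (intro mult_left_mono collision_boundD[OF cb F E FE]) (auto simp: \<alpha>_def \<beta>_def sum_nonneg)
  finally show ?case by (simp add: sum_\<alpha> sum_\<beta> mult_ac)
qed

text \<open>Passage to vectors in \<open>\<ell>\<^sup>2\<close>: absolute values only increase the sums, and every finite set of tuples lies in
  the finite cube over the set of its coordinates.\<close>

lemma collision_bound_ell2:
  assumes cb: "collision_bound S I \<pi> C" and C: "0 \<le> C" and I: "finite I"
    and bij: "\<And>i. i \<in> I \<Longrightarrow> bij_betw (\<pi> i) S S"
    and \<xi>: "\<xi> \<in> ell2 (tuples S k)" "ell2_norm (tuples S k) \<xi> = 1"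
  shows "(\<Sum>i\<in>tuples I k. \<Sum>j\<in>tuples I k. (cmod (cinner (tuples S k)
    (subst_op (tuples S k) (tuple_map k \<pi> j) \<xi>) (subst_op (tuples S k) (tuple_map k \<pi> i) \<xi>)))\<^sup>2) \<le> C ^ k"
proof -
  define X where "X = tuples S k"
  define u where "u i = subst_op X (tuple_map k \<pi> i) \<xi>" for i
  have u: "u i \<in> ell2 X" if "i \<in> tuples I k" for i
    unfolding u_def X_def using bij_betw_tuple_map[OF bij that] \<xi>(1) by (rule subst_op_ell2)
  define s where "s i j F = (\<Sum>x\<in>F. cnj (u j x) * u i x)" for i j F
  have lim: "((\<lambda>F. \<Sum>i\<in>tuples I k. \<Sum>j\<in>tuples I k. (cmod (s i j F))\<^sup>2) \<longlongrightarrow>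
      (\<Sum>i\<in>tuples I k. \<Sum>j\<in>tuples I k. (cmod (cinner X (u j) (u i)))\<^sup>2)) (finite_subsets_at_top X)"
  proof (intro tendsto_sum tendsto_power tendsto_norm)
    fix i j assume ij: "i \<in> tuples I k" "j \<in> tuples I k"
    have "((\<lambda>x. cnj (u j x) * u i x) has_sum cinner X (u j) (u i)) X"
      unfolding cinner_def by (intro has_sum_infsum cinner_summable u ij)
    then show "(s i j \<longlongrightarrow> cinner X (u j) (u i)) (finite_subsets_at_top X)"
      by (simp add: has_sum_def s_def[abs_def])
  qed
  have fin: "(\<Sum>i\<in>tuples I k. \<Sum>j\<in>tuples I k. (cmod (s i j F))\<^sup>2) \<le> C ^ k" if F: "finite F" "F \<subseteq> X" for F
  proof -
    define F0 where "F0 = (\<Union>x\<in>F. x ` {1..k})"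
    define E0 where "E0 = (\<Union>i\<in>I. \<pi> i ` F0)"
    have "x j \<in> S" if "x \<in> F" "j \<in> {1..k}" for x j
      using tuplesD[of x S k j] F that by (auto simp: X_def)
    then have F0: "finite F0" "F0 \<subseteq> S" using F by (auto simp: F0_def)
    have E0: "finite E0" "E0 \<subseteq> S"
      using F0 I bij_betwE[OF bij] by (auto simp: E0_def)
    have FF0: "F \<subseteq> tuples F0 k"
    proof
      fix x assume x: "x \<in> F"
      then have "x \<in> tuples S k" using F by (auto simp: X_def)
      then show "x \<in> tuples F0 k"
        using tuples_undefined unfolding F0_def by (intro tuplesI UN_I[OF x] imageI)
    qed
    have sub: "tuples A k \<subseteq> X" if "A \<subseteq> S" for A
      unfolding X_def tuples_def using that by (intro PiE_mono)
    have le1: "(\<Sum>x\<in>tuples E0 k. (cmod (\<xi> x))\<^sup>2) \<le> 1"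
    proof -
      have "(\<Sum>x\<in>tuples E0 k. (cmod (\<xi> x))\<^sup>2) \<le> (\<Sum>\<^sub>\<infinity>x\<in>X. (cmod (\<xi> x))\<^sup>2)"
        using \<xi>(1) sub[OF E0(2)] finite_tuples[OF E0(1)]
        by (intro finite_sum_le_infsum) (auto simp: X_def ell2_summable)
      also have "\<dots> = 1" using \<xi>(2) by (simp add: X_def flip: ell2_norm_square)
      finally show ?thesis .
    qed
    have "cmod (s i j F) \<le> (\<Sum>x\<in>tuples F0 k. cmod (\<xi> (tuple_map k \<pi> i x)) * cmod (\<xi> (tuple_map k \<pi> j x)))" for i j
    proof -
      have "cmod (s i j F) \<le> (\<Sum>x\<in>F. cmod (cnj (u j x) * u i x))" unfolding s_def by (rule norm_sum)
      also have "\<dots> = (\<Sum>x\<in>F. cmod (\<xi> (tuple_map k \<pi> i x)) * cmod (\<xi> (tuple_map k \<pi> j x)))"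
        using F by (intro sum.cong refl) (auto simp: u_def subst_op_def norm_mult)
      also have "\<dots> \<le> (\<Sum>x\<in>tuples F0 k. cmod (\<xi> (tuple_map k \<pi> i x)) * cmod (\<xi> (tuple_map k \<pi> j x)))"
        using FF0 finite_tuples[OF F0(1)] by (intro sum_mono2) auto
      finally show ?thesis .
    qed
    then have "(\<Sum>i\<in>tuples I k. \<Sum>j\<in>tuples I k. (cmod (s i j F))\<^sup>2)
        \<le> (\<Sum>i\<in>tuples I k. \<Sum>j\<in>tuples I k. (\<Sum>x\<in>tuples F0 k. cmod (\<xi> (tuple_map k \<pi> i x)) * cmod (\<xi> (tuple_map k \<pi> j x)))\<^sup>2)"
      by (intro sum_mono power_mono) auto
    also have "\<dots> \<le> C ^ k * (\<Sum>x\<in>tuples E0 k. (cmod (\<xi> x))\<^sup>2) * (\<Sum>x\<in>tuples E0 k. (cmod (\<xi> x))\<^sup>2)"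
      by (rule collision_bound_tuples[OF cb C F0 E0]) (auto simp: E0_def)
    also have "\<dots> \<le> C ^ k * 1 * 1"
      using le1 C by (intro mult_mono) (auto simp: sum_nonneg)
    finally show ?thesis by simp
  qed
  have "(\<Sum>i\<in>tuples I k. \<Sum>j\<in>tuples I k. (cmod (cinner X (u j) (u i)))\<^sup>2) \<le> C ^ k"
    by (rule tendsto_upperbound[OF lim])
      (auto intro!: eventually_finite_subsets_at_top_weakI fin)
  then show ?thesis by (simp add: u_def X_def)
qed

section \<open>Entropy bounds for permutation channels\<close>

context permutation_channel
begin

text \<open>The purity of the output on any unit vector is at most \<open>(C / |I|\<^sup>2)\<^sup>k\<close>.\<close>

lemma regularized_moe_ge_collision:
  assumes cb: "collision_bound S I \<pi> C" and C: "0 < C"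
  shows "ereal (2 * ln (card I) - ln C) \<le> regularized_moe S \<Phi>"
proof (rule regularized_moe_geI)
  fix k \<xi> assume \<xi>: "\<xi> \<in> ell2 (tuples S k)" "ell2_norm (tuples S k) \<xi> = 1"
  define c where "c = complex_of_real (1 / sqrt (card I)) ^ k"
  have c: "(cmod (cnj c * c))\<^sup>2 = (1 / (card I)\<^sup>2) ^ k"
    by (simp add: c_def norm_mult norm_power norm_divide power_mult_distrib[symmetric] power2_eq_square power_divide)
  define b where "b = (C / (card I)\<^sup>2) ^ k"
  have b0: "b > 0" using C card_I by (simp add: b_def)
  have "(\<Sum>i\<in>tuples I k. \<Sum>j\<in>tuples I k. (cmod (cinner (tuples S k) (branch k \<xi> j) (branch k \<xi> i)))\<^sup>2)
      = (1 / (card I)\<^sup>2) ^ k * (\<Sum>i\<in>tuples I k. \<Sum>j\<in>tuples I k. (cmod (cinner (tuples S k)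
          (subst_op (tuples S k) (tuple_map k \<pi> j) \<xi>) (subst_op (tuples S k) (tuple_map k \<pi> i) \<xi>)))\<^sup>2)"
    unfolding branch_def cinner_scale_left cinner_scale_right c_def[symmetric] mult.assoc[symmetric]
    by (simp only: norm_mult[of "_ * _" "cinner _ _ _"] power_mult_distrib mult.commute[of c] c sum_distrib_left)
  also have "\<dots> \<le> (1 / (card I)\<^sup>2) ^ k * C ^ k"
    using collision_bound_ell2[OF cb _ I(1) perm_bij \<xi>] C by (intro mult_left_mono) auto
  also have "\<dots> = b" by (simp add: b_def power_mult_distrib[symmetric])
  finally have "ereal (- ln b) \<le> output_entropy k \<xi>"
    unfolding output_entropy_def
    using \<xi> b0 by (intro vn_entropy_mixture_ge[of "tuples I k" "branch k \<xi>"])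
      (simp_all add: finite_tuples I branch_ell2 sum_ell2_norm_branch tensor_power_branches)
  also have "- ln b = k * (2 * ln (card I) - ln C)"
    using C card_I by (simp add: b_def ln_realpow ln_div algebra_simps)
  finally show "ereal (k * (2 * ln (card I) - ln C)) \<le> output_entropy k \<xi>" .
qed

end

text \<open>An equal mixture of basis vectors is diagonal; the eigenvalue at \<open>z\<close> is the proportion of the indices
  with \<open>y i = z\<close>. Written as a sum over indices, the entropy is the mean of \<open>ln |J| - ln n\<close>, where \<open>n\<close> is the
  number of indices that share the value of \<open>y\<close>. This number is at least \<open>|D|\<close> on \<open>D\<close> and at least \<open>1\<close> elsewhere.\<close>

lemma vn_entropy_ket_mixture_le:
  assumes J: "finite J" "J \<noteq> {}" and y: "\<And>i. i \<in> J \<Longrightarrow> y i \<in> X"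
    and D: "D \<subseteq> J" "D \<noteq> {}" "\<And>i. i \<in> D \<Longrightarrow> y i = e"
    and \<rho>: "\<And>f. f \<in> ell2 X \<Longrightarrow> \<rho> f = mixture X J (\<lambda>i. cscale (complex_of_real (1 / sqrt (card J))) (ket (y i))) f"
  shows "vn_entropy X \<rho> \<le> ereal (ln (card J) - card D * ln (card D) / card J)"
proof -
  define M where "M = real (card J)"
  have M: "M > 0" using J by (simp add: M_def card_gt_0_iff)
  define n where "n z = real (card {i\<in>J. y i = z})" for z
  have n_pos: "n (y i) \<ge> 1" if "i \<in> J" for i
  proof -
    have "card {k\<in>J. y k = y i} > 0" using that J by (auto simp: card_gt_0_iff)
    then show ?thesis by (simp add: n_def)
  qed
  have group: "(\<Sum>i\<in>J. f (y i)) = (\<Sum>z\<in>y ` J. of_real (n z) * f z)" for f :: "'b \<Rightarrow> 'c :: real_normed_field"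
  proof -
    have "(\<Sum>i\<in>J. f (y i)) = (\<Sum>z\<in>y ` J. \<Sum>i\<in>{i\<in>J. y i = z}. f (y i))"
      by (rule sum.image_gen[OF J(1)])
    also have "\<dots> = (\<Sum>z\<in>y ` J. of_real (n z) * f z)"
      by (intro sum.cong refl) (simp add: n_def)
    finally show ?thesis .
  qed
  define v where "v i = cscale (complex_of_real (1 / sqrt M)) (ket (y i))" for i
  define w where "w z = cscale (complex_of_real (sqrt (n z / M))) (ket z)" for z :: 'b
  have w: "w z \<in> ell2 X" if "z \<in> y ` J" for z
    using that y by (auto simp: w_def intro!: cscale_ell2 ket_ell2)
  have v: "v i \<in> ell2 X" if "i \<in> J" for i
    using that y by (auto simp: v_def intro!: cscale_ell2 ket_ell2)
  have "cinner X (w z) (w z) = of_real (n z / M)" if "z \<in> y ` J" for z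
  proof -
    have "cinner X (w z) (w z) = of_real (sqrt (n z / M) * sqrt (n z / M)) * cinner X (ket z) (ket z)"
      by (simp only: w_def cinner_scale_left cinner_scale_right complex_cnj_complex_of_real of_real_mult mult.assoc)
    also have "cinner X (ket z) (ket z) = 1"
      using that y by (subst cinner_ket_right) (auto simp: ket_def)
    finally show ?thesis using M by (simp add: n_def)
  qed
  then have norm_w: "(ell2_norm X (w z))\<^sup>2 = n z / M" if "z \<in> y ` J" for z
    using that cinner_self[OF w[OF that]] by (metis of_real_eq_iff)
  have "orthogonal_on X (y ` J) w"
    using y by (auto simp: orthogonal_on_def w_def cinner_scale_left cinner_scale_right cinner_ket_right) (auto simp: ket_def)
  moreover have "gram_kernel J v = gram_kernel (y ` J) w"
  proof (intro ext)
    fix a b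
    have "gram_kernel J v a b = (\<Sum>i\<in>J. of_real (1 / M) * (ket (y i) a * cnj (ket (y i) b)))"
      unfolding gram_kernel_def
    proof (intro sum.cong refl)
      fix i
      have "v i a * cnj (v i b) = of_real (1 / sqrt M * (1 / sqrt M)) * (ket (y i) a * cnj (ket (y i) b))"
        by (simp only: v_def cscale_def complex_cnj_mult complex_cnj_complex_of_real of_real_mult mult_ac)
      then show "v i a * cnj (v i b) = of_real (1 / M) * (ket (y i) a * cnj (ket (y i) b))"
        using M by simp
    qed
    also have "\<dots> = (\<Sum>z\<in>y ` J. of_real (n z) * (of_real (1 / M) * (ket z a * cnj (ket z b))))"
      by (rule group)
    also have "\<dots> = gram_kernel (y ` J) w a b"
      unfolding gram_kernel_def
    proof (intro sum.cong refl)
      fix z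
      have "w z a * cnj (w z b) = of_real (sqrt (n z / M) * sqrt (n z / M)) * (ket z a * cnj (ket z b))"
        by (simp only: w_def cscale_def complex_cnj_mult complex_cnj_complex_of_real of_real_mult mult_ac)
      also have "sqrt (n z / M) * sqrt (n z / M) = n z * (1 / M)" using M by (simp add: n_def)
      finally show "of_real (n z) * (of_real (1 / M) * (ket z a * cnj (ket z b))) = w z a * cnj (w z b)"
        by (simp only: of_real_mult mult.assoc)
    qed
    finally show "gram_kernel J v a b = gram_kernel (y ` J) w a b" .
  qed
  ultimately have "vn_entropy X \<rho> = ereal (\<Sum>z\<in>y ` J. - ((ell2_norm X (w z))\<^sup>2 * ln ((ell2_norm X (w z))\<^sup>2)))"
    using \<rho> mixture_cong[of J v X "y ` J" w] v w J
    by (intro vn_entropy_orthogonal) (auto simp: v_def[abs_def] M_def)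
  also have "(\<Sum>z\<in>y ` J. - ((ell2_norm X (w z))\<^sup>2 * ln ((ell2_norm X (w z))\<^sup>2))) = (\<Sum>z\<in>y ` J. n z * (- (ln (n z / M)) / M))"
    by (intro sum.cong refl) (simp add: norm_w)
  also have "\<dots> = (\<Sum>i\<in>J. - ln (n (y i) / M) / M)" using group[of "\<lambda>z. - ln (n z / M) / M"] by simp
  also have "\<dots> \<le> (\<Sum>i\<in>J. ln M / M - (if i \<in> D then ln (card D) / M else 0))"
  proof (rule sum_mono)
    fix i assume i: "i \<in> J"
    have fD: "finite D" using J D by (metis finite_subset)
    have "ln (n (y i)) \<ge> (if i \<in> D then ln (card D) else 0)"
    proof (cases "i \<in> D")
      case True
      have "card D \<le> card {k\<in>J. y k = y i}"
        using J D True by (intro card_mono) auto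
      then have "real (card D) \<le> n (y i)" by (simp add: n_def)
      moreover have "real (card D) > 0" using fD D by (simp add: card_gt_0_iff)
      ultimately show ?thesis using True by simp
    next
      case False
      then show ?thesis using n_pos[OF i] by simp
    qed
    then have "(if i \<in> D then ln (card D) else 0) / M \<le> ln (n (y i)) / M"
      using M by (intro divide_right_mono) auto
    moreover have "- ln (n (y i) / M) / M = ln M / M - ln (n (y i)) / M"
      using n_pos[OF i] M by (simp add: ln_div diff_divide_distrib)
    ultimately show "- ln (n (y i) / M) / M \<le> ln M / M - (if i \<in> D then ln (card D) / M else 0)"
      by (cases "i \<in> D") auto
  qed
  also have "\<dots> = ln M - card D * ln (card D) / M"
    using M J D by (simp add: sum_subtractf sum.If_cases Int_absorb1 flip: M_def)
  finally show ?thesis by (simp add: M_def)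
qed

context permutation_channel
begin

text \<open>For \<open>k = 1\<close> and the input \<open>ket e\<close> all branches are multiples of basis vectors, and those with index in \<open>D\<close> coincide.\<close>

lemma regularized_moe_le_fixed_point:
  assumes e: "e \<in> S" and D: "D \<subseteq> I" "D \<noteq> {}" "\<And>i. i \<in> D \<Longrightarrow> \<pi> i e = e"
  shows "regularized_moe S \<Phi> \<le> ereal (ln (card I) - card D * ln (card D) / card I)"
proof -
  define e1 where "e1 = (\<lambda>j\<in>{1::nat..1}. e)"
  define X where "X = tuples S 1"
  have e1: "e1 \<in> X" unfolding X_def using e by (intro tuplesI) (auto simp: e1_def)
  define y where "y i = inv_into X (tuple_map 1 \<pi> i) e1" for i
  have bij: "bij_betw (tuple_map 1 \<pi> i) X X" if "i \<in> tuples I 1" for i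
    unfolding X_def by (rule bij_betw_tuple_map[OF perm_bij that])
  have y: "y i \<in> X" "subst_op X (tuple_map 1 \<pi> i) (ket e1) = ket (y i)" if i: "i \<in> tuples I 1" for i
  proof -
    show yX: "y i \<in> X" unfolding y_def using bij_betw_apply[OF bij_betw_inv_into[OF bij[OF i]] e1] .
    have "tuple_map 1 \<pi> i x = e1 \<longleftrightarrow> x = y i" if "x \<in> X" for x
      using bij_betw_inv_into_left[OF bij[OF i] that] bij_betw_inv_into_right[OF bij[OF i] e1] by (auto simp: y_def)
    then have "subst_op X (tuple_map 1 \<pi> i) (ket e1) x = ket (y i) x" for x
      using yX by (cases "x \<in> X") (auto simp: subst_op_def ket_def)
    then show "subst_op X (tuple_map 1 \<pi> i) (ket e1) = ket (y i)" by blast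
  qed
  have DI: "tuples D 1 \<subseteq> tuples I 1" unfolding tuples_def using D by (intro PiE_mono)
  have cD: "card (tuples D 1) = card D" and cI: "card (tuples I 1) = card I"
    using card_tuples[of _ 1] I D by (auto dest: finite_subset)
  have "y i = e1" if i: "i \<in> tuples D 1" for i
  proof -
    have "tuple_map 1 \<pi> i e1 = e1"
      using tuplesD[OF i, of 1] D by (auto simp: tuple_map_def e1_def fun_eq_iff)
    then show ?thesis
      using bij_betw_inv_into_left[OF bij e1] i DI by (metis y_def subsetD)
  qed
  moreover have "tuples D 1 \<noteq> {}" "tuples I 1 \<noteq> {}"
    using D I by (auto simp: tuples_def PiE_eq_empty_iff)
  moreover have "tensor_power S 1 \<Phi> (proj X (ket e1)) f
      = mixture X (tuples I 1) (\<lambda>i. cscale (complex_of_real (1 / sqrt (card (tuples I 1)))) (ket (y i))) f"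
    if "f \<in> ell2 X" for f
  proof -
    have br: "branch 1 (ket e1) i = cscale (complex_of_real (1 / sqrt (card I))) (ket (y i))"
      if "i \<in> tuples I 1" for i
      unfolding branch_def X_def[symmetric] power_one_right y(2)[OF that] ..
    have "tensor_power S 1 \<Phi> (proj X (ket e1)) f = mixture X (tuples I 1) (branch 1 (ket e1)) f"
      unfolding X_def using that ket_ell2[OF e1] by (intro tensor_power_branches) (simp_all only: X_def)
    then show ?thesis
      unfolding mixture_def cI by (simp only: br cong: sum.cong)
  qed
  ultimately have "vn_entropy X (tensor_power S 1 \<Phi> (proj X (ket e1)))
      \<le> ereal (ln (card (tuples I 1)) - card (tuples D 1) * ln (card (tuples D 1)) / card (tuples I 1))"
    using finite_tuples[OF I(1), of 1] y(1) DI
    by (intro vn_entropy_ket_mixture_le[where y = y and e = e1]) auto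
  moreover have "regularized_moe S \<Phi> \<le> output_entropy 1 (ket e1)"
    using ket_ell2[OF e1] ell2_norm_ket[OF e1] by (intro regularized_moe_le_output_entropy) (simp_all add: X_def)
  ultimately show ?thesis by (simp add: output_entropy_def X_def cD[simplified] cI[simplified])
qed

end

section \<open>The free group\<close>

lemma inv_gen: "inv\<^bsub>Finf\<^esub> gen i = [(i, False)]"
proof -
  interpret group Finf by (rule group_Finf)
  have "[(i, False)] \<otimes>\<^bsub>Finf\<^esub> gen i = \<one>\<^bsub>Finf\<^esub>"
    by (simp add: Finf_def gen_def flip_def)
  then show ?thesis
    by (rule inv_equality) (simp_all, simp add: Finf_def reduced_Cons)
qed

lemma lmove_eq: "lmove i x = push (i, False) x"
  by (simp add: lmove_def inv_gen) (simp add: Finf_def)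

text \<open>Haagerup's inequality for the words \<open>g\<^sub>i\<^sup>-\<^sup>1 g\<^sub>j\<close>. For \<open>i \<noteq> j\<close> at most one of the two
  left multiplications applied to \<open>x\<close> cancels a letter. If the first one does, then \<open>x = g\<^sub>i y\<close> and
  the word \<open>g\<^sub>j\<^sup>-\<^sup>1 g\<^sub>i y\<close> determines \<open>i\<close>, \<open>j\<close> and \<open>y\<close>; the second one is treated alike. If none does, then
  \<open>g\<^sub>i\<^sup>-\<^sup>1 x\<close> determines \<open>i\<close> and \<open>x\<close>, and \<open>g\<^sub>j\<^sup>-\<^sup>1 x\<close> determines \<open>j\<close> and \<open>x\<close>. So the
  Cauchy-Schwarz inequality bounds the squares, summed over \<open>i\<close> and \<open>j\<close>, by \<open>\<parallel>\<xi>\<parallel>\<^sup>2 \<parallel>\<eta>\<parallel>\<^sup>2\<close> for each of the three parts of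
  the sum over \<open>x\<close>, and the square of a sum of three terms costs another factor \<open>3\<close>. Each of the \<open>N\<close> pairs with
  \<open>i = j\<close> contributes at most \<open>\<parallel>\<xi>\<parallel>\<^sup>2 \<parallel>\<eta>\<parallel>\<^sup>2\<close>.\<close>

lemma collision_bound_lmove: "collision_bound (carrier Finf) {1..N} lmove (real N + 9)"
  unfolding collision_bound_def
proof (intro allI impI)
  fix F E and \<xi> \<eta> :: "letter list \<Rightarrow> real"
  assume F: "finite F" "F \<subseteq> carrier Finf" and E: "finite E" "E \<subseteq> carrier Finf"
    and FE: "\<forall>i\<in>{1..N}. lmove i ` F \<subseteq> E" and nn: "\<forall>x. 0 \<le> \<xi> x" "\<forall>x. 0 \<le> \<eta> x"
  let ?I = "{1..N}"
  define A where "A = (\<Sum>x\<in>E. (\<xi> x)\<^sup>2)"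
  define B where "B = (\<Sum>x\<in>E. (\<eta> x)\<^sup>2)"
  have A0: "A \<ge> 0" and B0: "B \<ge> 0" by (simp_all add: A_def B_def sum_nonneg)
  define Fi where "Fi i = {x\<in>F. \<exists>y. x = (i, True) # y}" for i :: nat
  define F3 where "F3 i = {x\<in>F. \<nexists>y. x = (i, True) # y}" for i :: nat
  have finF: "finite (Fi i)" "finite (F3 i)" for i using F by (simp_all add: Fi_def F3_def)
  have mv1: "lmove i x = tl x" if "x \<in> Fi i" for i x
    using that by (auto simp: Fi_def lmove_eq flip_def)
  have mv2: "lmove i x = (i, False) # x" if "x \<in> F3 i" for i x
    using that by (cases x) (auto simp: F3_def lmove_eq flip_def prod_eq_iff)
  have sub: "Fi i \<subseteq> F3 j" if "i \<noteq> j" for i j using that by (auto simp: Fi_def F3_def)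
  have sub': "Fi j \<subseteq> F3 i" if "i \<noteq> j" for i j using sub that by metis
  have inE: "lmove i x \<in> E" if "i \<in> ?I" "x \<in> F" for i x using FE that by blast
  have FiF: "x \<in> F" if "x \<in> Fi i" for x i using that by (simp add: Fi_def)
  have F3F: "x \<in> F" if "x \<in> F3 i" for x i using that by (simp add: F3_def)
  have inj: "inj_on (lmove i) F" for i
    using bij_betw_imp_inj_on[OF bij_lmove] F(2) by (rule inj_on_subset)
  have le_A: "(\<Sum>x\<in>G. (\<xi> (lmove i x))\<^sup>2) \<le> A" if "i \<in> ?I" "G \<subseteq> F" for i G
  proof -
    have "(\<Sum>x\<in>G. (\<xi> (lmove i x))\<^sup>2) = (\<Sum>z\<in>lmove i ` G. (\<xi> z)\<^sup>2)"
      using inj_on_subset[OF inj that(2)] by (simp add: sum.reindex)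
    also have "\<dots> \<le> A" unfolding A_def using that inE E by (intro sum_mono2) auto
    finally show ?thesis .
  qed
  have le_B: "(\<Sum>x\<in>G. (\<eta> (lmove i x))\<^sup>2) \<le> B" if "i \<in> ?I" "G \<subseteq> F" for i G
  proof -
    have "(\<Sum>x\<in>G. (\<eta> (lmove i x))\<^sup>2) = (\<Sum>z\<in>lmove i ` G. (\<eta> z)\<^sup>2)"
      using inj_on_subset[OF inj that(2)] by (simp add: sum.reindex)
    also have "\<dots> \<le> B" unfolding B_def using that inE E by (intro sum_mono2) auto
    finally show ?thesis .
  qed
  define P where "P = {p\<in>?I \<times> ?I. fst p \<noteq> snd p}"
  have P: "finite P" by (simp add: P_def)
  \<comment> \<open>In the inner product indexed by \<open>(i, j)\<close> the letter \<open>g\<^sub>i\<close> cancels in \<open>s1\<close>, the letter \<open>g\<^sub>j\<close> in \<open>s2\<close>, and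
    nothing cancels in \<open>s3\<close>.\<close>
  define s1 where "s1 i j = (\<Sum>x\<in>Fi i. \<xi> (lmove i x) * \<eta> (lmove j x))" for i j
  define s2 where "s2 i j = (\<Sum>x\<in>Fi j. \<xi> (lmove i x) * \<eta> (lmove j x))" for i j
  define s3 where "s3 i j = (\<Sum>x\<in>F3 i \<inter> F3 j. \<xi> (lmove i x) * \<eta> (lmove j x))" for i j
  have split: "(\<Sum>x\<in>F. \<xi> (lmove i x) * \<eta> (lmove j x)) = s1 i j + s2 i j + s3 i j" if "i \<noteq> j" for i j
  proof -
    have "F = Fi i \<union> Fi j \<union> (F3 i \<inter> F3 j)" by (auto simp: Fi_def F3_def)
    then have "(\<Sum>x\<in>F. \<xi> (lmove i x) * \<eta> (lmove j x)) = (\<Sum>x\<in>Fi i \<union> Fi j \<union> (F3 i \<inter> F3 j). \<xi> (lmove i x) * \<eta> (lmove j x))"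
      by simp
    also have "\<dots> = s1 i j + s2 i j + s3 i j"
      unfolding s1_def s2_def s3_def using finF that
      by (subst sum.union_disjoint, simp, simp, force simp: Fi_def F3_def,
          subst sum.union_disjoint) (auto simp: Fi_def)
    finally show ?thesis .
  qed
  have sum1: "(\<Sum>p\<in>P. \<Sum>x\<in>Fi (fst p). (\<eta> (lmove (snd p) x))\<^sup>2) \<le> B"
  proof -
    have "(\<Sum>p\<in>P. \<Sum>x\<in>Fi (fst p). (\<eta> (lmove (snd p) x))\<^sup>2)
        = (\<Sum>q\<in>Sigma P (\<lambda>p. Fi (fst p)). (\<eta> ((snd (fst q), False) # snd q))\<^sup>2)"
      using P finF sub by (subst sum.Sigma) (auto simp: P_def mv2 subset_iff case_prod_beta intro!: sum.cong)
    also have "\<dots> = (\<Sum>z\<in>(\<lambda>q. (snd (fst q), False) # snd q) ` Sigma P (\<lambda>p. Fi (fst p)). (\<eta> z)\<^sup>2)"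
      by (subst sum.reindex) (auto simp: inj_on_def Fi_def)
    also have "\<dots> \<le> B"
      unfolding B_def
    proof (intro sum_mono2 E subsetI)
      fix z assume "z \<in> (\<lambda>q. (snd (fst q), False) # snd q) ` Sigma P (\<lambda>p. Fi (fst p))"
      then obtain i j x where z: "z = (j, False) # x" "(i, j) \<in> P" "x \<in> Fi i" by auto
      then have "z = lmove j x" using sub[of i j] mv2[of x j] by (auto simp: P_def)
      then show "z \<in> E" using z inE[of j x] FiF by (auto simp: P_def)
    qed simp
    finally show ?thesis .
  qed
  have sum2: "(\<Sum>p\<in>P. \<Sum>x\<in>Fi (snd p). (\<xi> (lmove (fst p) x))\<^sup>2) \<le> A"
  proof -
    have "(\<Sum>p\<in>P. \<Sum>x\<in>Fi (snd p). (\<xi> (lmove (fst p) x))\<^sup>2)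
        = (\<Sum>q\<in>Sigma P (\<lambda>p. Fi (snd p)). (\<xi> ((fst (fst q), False) # snd q))\<^sup>2)"
      using P finF sub by (subst sum.Sigma) (auto simp: P_def mv2 subsetD[OF sub'] case_prod_beta intro!: sum.cong)
    also have "\<dots> = (\<Sum>z\<in>(\<lambda>q. (fst (fst q), False) # snd q) ` Sigma P (\<lambda>p. Fi (snd p)). (\<xi> z)\<^sup>2)"
      by (subst sum.reindex) (auto simp: inj_on_def Fi_def)
    also have "\<dots> \<le> A"
      unfolding A_def
    proof (intro sum_mono2 E subsetI)
      fix z assume "z \<in> (\<lambda>q. (fst (fst q), False) # snd q) ` Sigma P (\<lambda>p. Fi (snd p))"
      then obtain i j x where z: "z = (i, False) # x" "(i, j) \<in> P" "x \<in> Fi j" by auto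
      then have "z = lmove i x" using sub[of j i] mv2[of x i] by (auto simp: P_def)
      then show "z \<in> E" using z inE[of i x] FiF by (auto simp: P_def)
    qed simp
    finally show ?thesis .
  qed
  have sum3: "(\<Sum>i\<in>?I. \<Sum>x\<in>F3 i. (\<zeta> (lmove i x))\<^sup>2) \<le> (\<Sum>x\<in>E. (\<zeta> x)\<^sup>2)" for \<zeta> :: "letter list \<Rightarrow> real"
  proof -
    have "(\<Sum>i\<in>?I. \<Sum>x\<in>F3 i. (\<zeta> (lmove i x))\<^sup>2) = (\<Sum>q\<in>Sigma ?I F3. (\<zeta> ((fst q, False) # snd q))\<^sup>2)"
      using finF by (subst sum.Sigma) (auto simp: mv2 case_prod_beta intro!: sum.cong)
    also have "\<dots> = (\<Sum>z\<in>(\<lambda>q. (fst q, False) # snd q) ` Sigma ?I F3. (\<zeta> z)\<^sup>2)"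
      by (subst sum.reindex) (auto simp: inj_on_def)
    also have "\<dots> \<le> (\<Sum>x\<in>E. (\<zeta> x)\<^sup>2)"
    proof (intro sum_mono2 E subsetI)
      fix z assume "z \<in> (\<lambda>q. (fst q, False) # snd q) ` Sigma ?I F3"
      then obtain i x where z: "z = (i, False) # x" "i \<in> ?I" "x \<in> F3 i" by auto
      then have "z = lmove i x" using mv2[of x i] by simp
      then show "z \<in> E" using z inE[of i x] F3F by auto
    qed simp
    finally show ?thesis .
  qed
  have b1: "(\<Sum>p\<in>P. (s1 (fst p) (snd p))\<^sup>2) \<le> A * B"
  proof -
    have "(\<Sum>p\<in>P. (s1 (fst p) (snd p))\<^sup>2) \<le> (\<Sum>p\<in>P. A * (\<Sum>x\<in>Fi (fst p). (\<eta> (lmove (snd p) x))\<^sup>2))"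
    proof (rule sum_mono)
      fix p assume p: "p \<in> P"
      have "(s1 (fst p) (snd p))\<^sup>2 \<le> (\<Sum>x\<in>Fi (fst p). (\<xi> (lmove (fst p) x))\<^sup>2) * (\<Sum>x\<in>Fi (fst p). (\<eta> (lmove (snd p) x))\<^sup>2)"
        unfolding s1_def by (rule Cauchy_Schwarz_ineq_sum)
      also have "\<dots> \<le> A * (\<Sum>x\<in>Fi (fst p). (\<eta> (lmove (snd p) x))\<^sup>2)"
        using p FiF by (intro mult_right_mono le_A) (auto simp: P_def sum_nonneg)
      finally show "(s1 (fst p) (snd p))\<^sup>2 \<le> A * (\<Sum>x\<in>Fi (fst p). (\<eta> (lmove (snd p) x))\<^sup>2)" .
    qed
    also have "\<dots> \<le> A * B"
      unfolding sum_distrib_left[symmetric] using sum1 A0 by (rule mult_left_mono)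
    finally show ?thesis .
  qed
  have b2: "(\<Sum>p\<in>P. (s2 (fst p) (snd p))\<^sup>2) \<le> A * B"
  proof -
    have "(\<Sum>p\<in>P. (s2 (fst p) (snd p))\<^sup>2) \<le> (\<Sum>p\<in>P. (\<Sum>x\<in>Fi (snd p). (\<xi> (lmove (fst p) x))\<^sup>2) * B)"
    proof (rule sum_mono)
      fix p assume p: "p \<in> P"
      have "(s2 (fst p) (snd p))\<^sup>2 \<le> (\<Sum>x\<in>Fi (snd p). (\<xi> (lmove (fst p) x))\<^sup>2) * (\<Sum>x\<in>Fi (snd p). (\<eta> (lmove (snd p) x))\<^sup>2)"
        unfolding s2_def by (rule Cauchy_Schwarz_ineq_sum)
      also have "\<dots> \<le> (\<Sum>x\<in>Fi (snd p). (\<xi> (lmove (fst p) x))\<^sup>2) * B"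
        using p FiF by (intro mult_left_mono le_B) (auto simp: P_def sum_nonneg)
      finally show "(s2 (fst p) (snd p))\<^sup>2 \<le> (\<Sum>x\<in>Fi (snd p). (\<xi> (lmove (fst p) x))\<^sup>2) * B" .
    qed
    also have "\<dots> \<le> A * B"
      unfolding sum_distrib_right[symmetric] using sum2 B0 by (rule mult_right_mono)
    finally show ?thesis .
  qed
  have b3: "(\<Sum>p\<in>P. (s3 (fst p) (snd p))\<^sup>2) \<le> A * B"
  proof -
    have "(\<Sum>p\<in>P. (s3 (fst p) (snd p))\<^sup>2)
        \<le> (\<Sum>p\<in>P. (\<Sum>x\<in>F3 (fst p). (\<xi> (lmove (fst p) x))\<^sup>2) * (\<Sum>x\<in>F3 (snd p). (\<eta> (lmove (snd p) x))\<^sup>2))"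
    proof (rule sum_mono)
      fix p
      have "(s3 (fst p) (snd p))\<^sup>2 \<le> (\<Sum>x\<in>F3 (fst p) \<inter> F3 (snd p). (\<xi> (lmove (fst p) x))\<^sup>2)
          * (\<Sum>x\<in>F3 (fst p) \<inter> F3 (snd p). (\<eta> (lmove (snd p) x))\<^sup>2)"
        unfolding s3_def by (rule Cauchy_Schwarz_ineq_sum)
      also have "\<dots> \<le> (\<Sum>x\<in>F3 (fst p). (\<xi> (lmove (fst p) x))\<^sup>2) * (\<Sum>x\<in>F3 (snd p). (\<eta> (lmove (snd p) x))\<^sup>2)"
        using finF by (intro mult_mono sum_mono2) (auto simp: sum_nonneg)
      finally show "(s3 (fst p) (snd p))\<^sup>2
          \<le> (\<Sum>x\<in>F3 (fst p). (\<xi> (lmove (fst p) x))\<^sup>2) * (\<Sum>x\<in>F3 (snd p). (\<eta> (lmove (snd p) x))\<^sup>2)" .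
    qed
    also have "\<dots> \<le> (\<Sum>p\<in>?I \<times> ?I. (\<Sum>x\<in>F3 (fst p). (\<xi> (lmove (fst p) x))\<^sup>2) * (\<Sum>x\<in>F3 (snd p). (\<eta> (lmove (snd p) x))\<^sup>2))"
      by (intro sum_mono2) (auto simp: P_def sum_nonneg)
    also have "\<dots> = (\<Sum>i\<in>?I. \<Sum>x\<in>F3 i. (\<xi> (lmove i x))\<^sup>2) * (\<Sum>j\<in>?I. \<Sum>x\<in>F3 j. (\<eta> (lmove j x))\<^sup>2)"
      by (simp only: sum_product sum.cartesian_product case_prod_unfold)
    also have "\<dots> \<le> A * B"
      unfolding A_def B_def using sum3[of \<xi>] sum3[of \<eta>] by (intro mult_mono) (auto simp: sum_nonneg)
    finally show ?thesis .
  qed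
  have three: "(a + b + c)\<^sup>2 \<le> 3 * (a\<^sup>2 + b\<^sup>2 + c\<^sup>2)" for a b c :: real
    using sum_squares_bound[of a b] sum_squares_bound[of b c] sum_squares_bound[of a c]
    by (simp add: power2_eq_square algebra_simps)
  have off: "(\<Sum>p\<in>P. (\<Sum>x\<in>F. \<xi> (lmove (fst p) x) * \<eta> (lmove (snd p) x))\<^sup>2) \<le> 9 * (A * B)"
  proof -
    have "(\<Sum>p\<in>P. (\<Sum>x\<in>F. \<xi> (lmove (fst p) x) * \<eta> (lmove (snd p) x))\<^sup>2)
        \<le> (\<Sum>p\<in>P. 3 * ((s1 (fst p) (snd p))\<^sup>2 + (s2 (fst p) (snd p))\<^sup>2 + (s3 (fst p) (snd p))\<^sup>2))"
    proof (rule sum_mono)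
      fix p assume "p \<in> P"
      then have "fst p \<noteq> snd p" by (simp add: P_def)
      then show "(\<Sum>x\<in>F. \<xi> (lmove (fst p) x) * \<eta> (lmove (snd p) x))\<^sup>2
          \<le> 3 * ((s1 (fst p) (snd p))\<^sup>2 + (s2 (fst p) (snd p))\<^sup>2 + (s3 (fst p) (snd p))\<^sup>2)"
        unfolding split[OF \<open>fst p \<noteq> snd p\<close>] by (intro three)
    qed
    also have "\<dots> = 3 * ((\<Sum>p\<in>P. (s1 (fst p) (snd p))\<^sup>2) + (\<Sum>p\<in>P. (s2 (fst p) (snd p))\<^sup>2) + (\<Sum>p\<in>P. (s3 (fst p) (snd p))\<^sup>2))"
      by (simp only: sum_distrib_left[symmetric] sum.distrib)
    also have "\<dots> \<le> 3 * (A * B + A * B + A * B)"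
      by (intro mult_left_mono add_mono b1 b2 b3) simp
    finally show ?thesis by simp
  qed
  have diag: "(\<Sum>i\<in>?I. (\<Sum>x\<in>F. \<xi> (lmove i x) * \<eta> (lmove i x))\<^sup>2) \<le> N * (A * B)"
  proof -
    have "(\<Sum>i\<in>?I. (\<Sum>x\<in>F. \<xi> (lmove i x) * \<eta> (lmove i x))\<^sup>2) \<le> (\<Sum>i\<in>?I. A * B)"
    proof (rule sum_mono)
      fix i assume i: "i \<in> ?I"
      have "(\<Sum>x\<in>F. \<xi> (lmove i x) * \<eta> (lmove i x))\<^sup>2 \<le> (\<Sum>x\<in>F. (\<xi> (lmove i x))\<^sup>2) * (\<Sum>x\<in>F. (\<eta> (lmove i x))\<^sup>2)"
        by (rule Cauchy_Schwarz_ineq_sum)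
      also have "\<dots> \<le> A * B"
        using le_A[OF i order_refl] le_B[OF i order_refl] A0 by (intro mult_mono) (auto simp: sum_nonneg)
      finally show "(\<Sum>x\<in>F. \<xi> (lmove i x) * \<eta> (lmove i x))\<^sup>2 \<le> A * B" .
    qed
    then show ?thesis by simp
  qed
  have "(\<Sum>i\<in>?I. \<Sum>j\<in>?I. (\<Sum>x\<in>F. \<xi> (lmove i x) * \<eta> (lmove j x))\<^sup>2)
      = (\<Sum>p\<in>?I \<times> ?I. (\<Sum>x\<in>F. \<xi> (lmove (fst p) x) * \<eta> (lmove (snd p) x))\<^sup>2)"
    by (simp add: sum.cartesian_product case_prod_beta)
  also have "?I \<times> ?I = P \<union> (\<lambda>i. (i, i)) ` ?I" by (auto simp: P_def)
  also have "(\<Sum>p\<in>P \<union> (\<lambda>i. (i, i)) ` ?I. (\<Sum>x\<in>F. \<xi> (lmove (fst p) x) * \<eta> (lmove (snd p) x))\<^sup>2)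
      = (\<Sum>p\<in>P. (\<Sum>x\<in>F. \<xi> (lmove (fst p) x) * \<eta> (lmove (snd p) x))\<^sup>2)
        + (\<Sum>i\<in>?I. (\<Sum>x\<in>F. \<xi> (lmove i x) * \<eta> (lmove i x))\<^sup>2)"
    by (subst sum.union_disjoint) (auto simp: P sum.reindex inj_on_def, auto simp: P_def)
  also have "\<dots> \<le> (real N + 9) * (A * B)" using off diag by (simp add: algebra_simps)
  finally show "(\<Sum>i\<in>?I. \<Sum>j\<in>?I. (\<Sum>x\<in>F. \<xi> (lmove i x) * \<eta> (lmove j x))\<^sup>2)
      \<le> (real N + 9) * (\<Sum>x\<in>E. (\<xi> x)\<^sup>2) * (\<Sum>x\<in>E. (\<eta> x)\<^sup>2)"
    by (simp add: A_def B_def mult.assoc)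
qed

text \<open>Inversion conjugates the right translations into the left translations.\<close>

lemma collision_bound_rmove: "collision_bound (carrier Finf) {1..N} rmove (real N + 9)"
  unfolding collision_bound_def
proof (intro allI impI)
  fix F E and \<xi> \<eta> :: "letter list \<Rightarrow> real"
  assume F: "finite F" "F \<subseteq> carrier Finf" and E: "finite E" "E \<subseteq> carrier Finf"
    and FE: "\<forall>i\<in>{1..N}. rmove i ` F \<subseteq> E" and nn: "\<forall>x. 0 \<le> \<xi> x" "\<forall>x. 0 \<le> \<eta> x"
  interpret group Finf by (rule group_Finf)
  let ?v = "\<lambda>x. inv\<^bsub>Finf\<^esub> x"
  have conj: "rmove i (?v x) = ?v (lmove i x)" if "x \<in> carrier Finf" for i x
    using that by (simp add: rmove_def lmove_def inv_mult_group)
  have injF: "inj_on ?v F" and injE: "inj_on ?v E"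
    using F E by (auto intro: inj_on_subset[OF inv_inj])
  have v_in: "x \<in> carrier Finf" if "x \<in> ?v ` F" for x using that F by auto
  have "(\<Sum>i\<in>{1..N}. \<Sum>j\<in>{1..N}. (\<Sum>x\<in>?v ` F. \<xi> (?v (lmove i x)) * \<eta> (?v (lmove j x)))\<^sup>2)
      \<le> (real N + 9) * (\<Sum>x\<in>?v ` E. (\<xi> (?v x))\<^sup>2) * (\<Sum>x\<in>?v ` E. (\<eta> (?v x))\<^sup>2)"
  proof (rule collision_boundD[OF collision_bound_lmove])
    fix i assume i: "i \<in> {1..N}"
    show "lmove i ` ?v ` F \<subseteq> ?v ` E"
    proof (intro subsetI, elim imageE)
      fix z x x' assume x: "z = lmove i x" "x = ?v x'" "x' \<in> F"
      have c: "x' \<in> carrier Finf" "lmove i x \<in> carrier Finf"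
        using x F bij_betw_apply[OF bij_lmove] by auto
      then have "rmove i x' = ?v z" using conj[of x i] x by simp
      moreover have "rmove i x' \<in> E" using FE i x(3) by blast
      ultimately have "?v z \<in> E" by simp
      then show "z \<in> ?v ` E" using c x by (metis image_eqI inv_inv)
    qed
  qed (use F E nn in auto)
  moreover have "(\<Sum>x\<in>?v ` F. \<xi> (?v (lmove i x)) * \<eta> (?v (lmove j x))) = (\<Sum>x\<in>F. \<xi> (rmove i x) * \<eta> (rmove j x))" for i j
    using F by (subst sum.reindex[OF injF]) (auto simp flip: conj intro!: sum.cong)
  moreover have "(\<Sum>x\<in>?v ` E. (\<zeta> (?v x))\<^sup>2) = (\<Sum>x\<in>E. (\<zeta> x)\<^sup>2)" for \<zeta> :: "letter list \<Rightarrow> real"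
    using E by (subst sum.reindex[OF injE]) (auto intro!: sum.cong)
  ultimately show "(\<Sum>i\<in>{1..N}. \<Sum>j\<in>{1..N}. (\<Sum>x\<in>F. \<xi> (rmove i x) * \<eta> (rmove j x))\<^sup>2)
      \<le> (real N + 9) * (\<Sum>x\<in>E. (\<xi> x)\<^sup>2) * (\<Sum>x\<in>E. (\<eta> x)\<^sup>2)"
    by simp
qed

section \<open>The two channels and their composition\<close>

lemma one_carrier: "[] \<in> carrier Finf" "carrier Finf \<noteq> {}"
proof -
  show "[] \<in> carrier Finf" by (simp add: Finf_def)
  then show "carrier Finf \<noteq> {}" by blast
qed

lemma permutation_channel_Phi_l:
  assumes "N > 0"
  shows "permutation_channel (carrier Finf) (Phi_l N) {1..N} lmove"
proof
  show "\<exists>M A. kraus_rep (carrier Finf) (Phi_l N) M A" using kraus_rep_Phi_l[OF assms] by blast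
  show "Phi_l N (proj (carrier Finf) \<xi>) f = mixture (carrier Finf) {1..N}
      (\<lambda>i. op_scale (complex_of_real (1 / sqrt (real (card {1..N})))) (subst_op (carrier Finf) (lmove i)) \<xi>) f"
    if "\<xi> \<in> ell2 (carrier Finf)" "f \<in> ell2 (carrier Finf)" for \<xi> f
    using kraus_rep_output[OF kraus_rep_Phi_l[OF assms] that] by (simp add: U_eq)
qed (use assms one_carrier bij_lmove in auto)

lemma permutation_channel_Phi_r:
  assumes "N > 0"
  shows "permutation_channel (carrier Finf) (Phi_r N) {1..N} rmove"
proof
  show "\<exists>M A. kraus_rep (carrier Finf) (Phi_r N) M A" using kraus_rep_Phi_r[OF assms] by blast
  show "Phi_r N (proj (carrier Finf) \<xi>) f = mixture (carrier Finf) {1..N}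
      (\<lambda>i. op_scale (complex_of_real (1 / sqrt (real (card {1..N})))) (subst_op (carrier Finf) (rmove i)) \<xi>) f"
    if "\<xi> \<in> ell2 (carrier Finf)" "f \<in> ell2 (carrier Finf)" for \<xi> f
    using kraus_rep_output[OF kraus_rep_Phi_r[OF assms] that] by (simp add: V_eq)
qed (use assms one_carrier bij_rmove in auto)

lemma permutation_channel_Phi_l_Phi_r:
  assumes "N > 0"
  shows "permutation_channel (carrier Finf) (Phi_l N \<circ> Phi_r N) ({1..N} \<times> {1..N}) (\<lambda>(i, j). rmove j \<circ> lmove i)"
proof
  let ?S = "carrier Finf" and ?c = "complex_of_real (1 / sqrt (real N))"
  show "\<exists>M A. kraus_rep ?S (Phi_l N \<circ> Phi_r N) M A" using kraus_rep_Phi_l_Phi_r[OF assms] by blast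
  fix \<xi> f assume \<xi>: "\<xi> \<in> ell2 ?S" and f: "f \<in> ell2 ?S"
  have bU: "bounded_op ?S (U i)" for i
    using bounded_op_subst_op[OF bij_lmove[of i], of 1] by (simp add: U_eq op_scale_def)
  have bV: "V j \<xi> \<in> ell2 ?S" for j
    unfolding V_eq by (rule subst_op_ell2[OF bij_rmove \<xi>])
  have comp: "subst_op ?S (rmove j \<circ> lmove i) \<xi> = U i (V j \<xi>)" for i j
    using bij_lmove by (auto simp: U_eq V_eq subst_op_def fun_eq_iff bij_betw_def)
  have cc: "?c * ?c = 1 / of_nat N" by (simp flip: of_real_mult)
  have inner: "U i (Phi_r N (proj ?S \<xi>) (adj ?S (U i) f))
      = (\<Sum>j=1..N. cscale (1 / of_nat N * cinner ?S (U i (V j \<xi>)) f) (U i (V j \<xi>)))" for i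
  proof -
    define g where "g = adj ?S (U i) f"
    have g: "g \<in> ell2 ?S" unfolding g_def by (rule adj_exists(1)[OF bU f])
    have gi: "cinner ?S (V j \<xi>) g = cinner ?S (U i (V j \<xi>)) f" for j
    proof -
      have "cinner ?S g (V j \<xi>) = cinner ?S f (U i (V j \<xi>))"
        unfolding g_def by (rule adj_exists(2)[OF bU f bV])
      then show ?thesis
        using cinner_commute[of ?S "V j \<xi>" g] cinner_commute[of ?S "U i (V j \<xi>)" f] by simp
    qed
    have "Phi_r N (proj ?S \<xi>) g = (\<Sum>j=1..N. cscale (1 / of_nat N * cinner ?S (U i (V j \<xi>)) f) (V j \<xi>))"
      unfolding kraus_rep_output[OF kraus_rep_Phi_r[OF assms] \<xi> g] mixture_def
    proof (intro sum.cong refl)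
      fix j
      have "cscale (cinner ?S (cscale ?c (V j \<xi>)) g) (cscale ?c (V j \<xi>)) = cscale (?c * ?c * cinner ?S (V j \<xi>) g) (V j \<xi>)"
        by (simp add: cinner_scale_left mult_ac)
      then show "cscale (cinner ?S (op_scale ?c (V j) \<xi>) g) (op_scale ?c (V j) \<xi>)
          = cscale (1 / of_nat N * cinner ?S (U i (V j \<xi>)) f) (V j \<xi>)"
        unfolding op_scale_def cc gi .
    qed
    then have "U i (Phi_r N (proj ?S \<xi>) g) x
        = (\<Sum>j=1..N. cscale (1 / of_nat N * cinner ?S (U i (V j \<xi>)) f) (U i (V j \<xi>))) x" for x
      by (simp add: U_def sum_apply cscale_def)
    then show ?thesis unfolding g_def by (rule ext)
  qed
  have "(Phi_l N \<circ> Phi_r N) (proj ?S \<xi>) f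
      = cscale (1 / of_nat N) (\<Sum>i=1..N. U i (Phi_r N (proj ?S \<xi>) (adj ?S (U i) f)))"
    by (simp add: Phi_l_def op_scale_def sum_apply)
  also have "\<dots> = (\<Sum>p\<in>{1..N} \<times> {1..N}. cscale (1 / of_nat N * (1 / of_nat N * cinner ?S (U (fst p) (V (snd p) \<xi>)) f)) (U (fst p) (V (snd p) \<xi>)))"
    unfolding inner by (simp add: cfun.scale_sum_right sum.cartesian_product case_prod_beta)
  also have "\<dots> = mixture ?S ({1..N} \<times> {1..N}) (\<lambda>p. op_scale (complex_of_real (1 / sqrt (real (card ({1..N} \<times> {1..N})))))
      (subst_op ?S ((\<lambda>(i, j). rmove j \<circ> lmove i) p)) \<xi>) f"
    unfolding mixture_def
  proof (intro sum.cong refl)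
    fix p assume "p \<in> {1..N} \<times> {1..N}"
    define h where "h = U (fst p) (V (snd p) \<xi>)"
    have c: "complex_of_real (1 / sqrt (real (card ({1..N} \<times> {1..N})))) = 1 / of_nat N"
      by (simp add: card_cartesian_product real_sqrt_mult)
    have h: "op_scale (1 / of_nat N) (subst_op ?S ((\<lambda>(i, j). rmove j \<circ> lmove i) p)) \<xi> = cscale (1 / of_nat N) h"
      by (simp only: op_scale_def case_prod_beta comp h_def)
    show "cscale (1 / of_nat N * (1 / of_nat N * cinner ?S (U (fst p) (V (snd p) \<xi>)) f)) (U (fst p) (V (snd p) \<xi>))
        = cscale (cinner ?S (op_scale (complex_of_real (1 / sqrt (real (card ({1..N} \<times> {1..N})))))
            (subst_op ?S ((\<lambda>(i, j). rmove j \<circ> lmove i) p)) \<xi>) f)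
          (op_scale (complex_of_real (1 / sqrt (real (card ({1..N} \<times> {1..N}))))) (subst_op ?S ((\<lambda>(i, j). rmove j \<circ> lmove i) p)) \<xi>)"
      unfolding c h h_def[symmetric] by (simp add: cinner_scale_left mult_ac)
  qed
  finally show "(Phi_l N \<circ> Phi_r N) (proj ?S \<xi>) f = mixture ?S ({1..N} \<times> {1..N}) (\<lambda>p. op_scale
      (complex_of_real (1 / sqrt (real (card ({1..N} \<times> {1..N}))))) (subst_op ?S ((\<lambda>(i, j). rmove j \<circ> lmove i) p)) \<xi>) f" .
qed (use assms one_carrier bij_betw_trans[OF bij_lmove bij_rmove] in auto)

theorem theorem4p1:
  fixes N :: nat
  assumes "real N > exp 18"
  shows "regularized_moe (carrier Finf) (Phi_l N \<circ> Phi_r N)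
       < regularized_moe (carrier Finf) (Phi_l N) + regularized_moe (carrier Finf) (Phi_r N)"
proof -
  let ?S = "carrier Finf"
  have N0: "real N > 0" using assms exp_gt_zero[of "18::real"] by linarith
  then have N: "N > 0" by simp
  have ln_N: "ln N > 18" using assms N0 by (metis exp_less_cancel_iff exp_ln)
  interpret l: permutation_channel ?S "Phi_l N" "{1..N}" lmove by (rule permutation_channel_Phi_l[OF N])
  interpret r: permutation_channel ?S "Phi_r N" "{1..N}" rmove by (rule permutation_channel_Phi_r[OF N])
  interpret lr: permutation_channel ?S "Phi_l N \<circ> Phi_r N" "{1..N} \<times> {1..N}" "\<lambda>(i, j). rmove j \<circ> lmove i"
    by (rule permutation_channel_Phi_l_Phi_r[OF N])
  define b where "b = 2 * ln N - ln (real N + 9)"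
  have l: "ereal b \<le> regularized_moe ?S (Phi_l N)"
    using l.regularized_moe_ge_collision[OF collision_bound_lmove] by (simp add: b_def)
  have r: "ereal b \<le> regularized_moe ?S (Phi_r N)"
    using r.regularized_moe_ge_collision[OF collision_bound_rmove] by (simp add: b_def)
  define D where "D = (\<lambda>i. (i, i)) ` {1..N}"
  \<comment> \<open>As \<open>g\<^sub>i\<^sup>-\<^sup>1 g\<^sub>i\<close> is the neutral element, the diagonal pairs fix it.\<close>
  have card_D: "card D = N" unfolding D_def by (subst card_image) (auto simp: inj_on_def)
  have "rmove i (lmove i []) = []" for i
    by (simp add: lmove_eq rmove_def) (simp add: Finf_def gen_def flip_def)
  then have "regularized_moe ?S (Phi_l N \<circ> Phi_r N)
      \<le> ereal (ln (card ({1..N} \<times> {1..N})) - card D * ln (card D) / card ({1..N} \<times> {1..N}))"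
    using N by (intro lr.regularized_moe_le_fixed_point[OF one_carrier(1)]) (auto simp: D_def)
  then have lr: "regularized_moe ?S (Phi_l N \<circ> Phi_r N) \<le> ereal (ln (real (N * N)) - N * ln N / real (N * N))"
    by (simp only: card_D card_cartesian_product card_atLeastAtMost diff_Suc_1 Suc_eq_plus1[symmetric])
  \<comment> \<open>Each of the two lower bounds loses at most \<open>9 / N\<close> against \<open>ln N\<close>.\<close>
  have "ln (real N + 9) = ln N + ln (1 + 9 / N)"
  proof -
    have "real N + 9 = real N * (1 + 9 / N)" using N0 by (simp add: field_simps)
    moreover have "1 + 9 / real N > 0" using N0 by (simp add: add_pos_pos)
    ultimately show ?thesis using N0 by (simp only: ln_mult) simp
  qed
  also have "ln (1 + 9 / N) \<le> 9 / N" using N0 by (intro ln_add_one_self_le_self) simp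
  finally have "2 * b \<ge> 2 * ln N - 18 / N" by (simp add: b_def)
  moreover have "ln (real (N * N)) - N * ln N / real (N * N) = 2 * ln N - ln N / N"
    using N0 by (simp add: ln_mult)
  moreover have "18 / N < ln N / N" using ln_N N0 by (intro divide_strict_right_mono)
  ultimately have "ln (real (N * N)) - N * ln N / real (N * N) < b + b" by linarith
  then have "regularized_moe ?S (Phi_l N \<circ> Phi_r N) < ereal b + ereal b"
    using lr by (simp add: order_le_less_trans)
  also have "\<dots> \<le> regularized_moe ?S (Phi_l N) + regularized_moe ?S (Phi_r N)"
    using l r by (rule add_mono)
  finally show ?thesis .
qed

end
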